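(* Let $\mathfrak{g}$ be a good $\mathcal{L}ie^{\diamond}\mathcal{B}_\infty$-algebra whose structure is given by a power series $\Gamma_\hbar=\Gamma_\hbar(\psi_i,\eta^i,\hbar)$. Then there is a natural $\mathcal{BV}_\infty^{com}$-algebra structure on the Chevalley–Eilenberg complex $CE(\mathfrak{g})=\odot^\bullet(\mathfrak{g}[-1])$ (polynomials in the $\psi_i$) given by the standard multiplication of $\odot^\bullet(\mathfrak{g}[-1])$ and, for any $a\ge1$, the operators $$\Delta_a=\sum_{p+k=a+1}\frac{1}{p!\,k!}\sum_{i_1,\dots,i_k}\frac{\partial^{a+1}\Gamma_\hbar}{\partial\hbar^p\,\partial\eta^{i_1}\cdots\partial\eta^{i_k}}\Big|_{\hbar=\eta^i=0}\ \frac{\partial^k}{\partial\psi_{i_1}\cdots\partial\psi_{i_k}} .$$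
   Context: $\mathbb{K}$ is a field of characteristic $0$; $V[k]^i=V^{i+k}$. $\mathcal{L}ie^{\diamond}\mathcal{B}_\infty$-algebras. These are representations of the minimal model of the properad of involutive Lie bialgebras, which is freely generated by corollas of weight $a\ge0$ with $m\ge1$ outputs and $n\ge1$ inputs, $m+n+a\ge3$, skew-symmetric in inputs and outputs, of degree $3-m-n-2a$. Let $\mathfrak{g}$ be a dg vector space with basis $(e_i)$ and dual basis $(e^i)$; let $\psi_i$, $\eta^i$ be formal graded commutative variables corresponding to $e_i,e^i$, of degrees $|\psi_i|=|e_i|+1$, $|\eta^i|=1-|e_i|$, and $\hbar$ a formal variable of degree $2$. A $\mathcal{L}ie^{\diamond}\mathcal{B}_\infty$-structure on $\mathfrak{g}$ is the same as a homogeneous power series $\Gamma_\hbar=D_{\mathfrak{g}}+f\in\mathbb{K}[[\psi_i,\eta^i,\hbar]]$ of degree $3$, where $D_{\mathfrak{g}}=\sum_{i,j}\pm d^i_j\psi_i\eta^j$ encodes the differential of $\mathfrak{g}$ and $f$ satisfies $f|_{\psi=0}=0$, $f|_{\eta=0}=0$, $f|_{\hbar=0}\in I^3$ ($I$ the maximal ideal of $\mathbb{K}[[\psi,\eta]]$), such that $$\Gamma_\hbar *_\hbar\Gamma_\hbar=\sum_{k\ge0}\frac{\hbar^{k-1}}{k!}\sum_{i_1,\dots,i_k}\pm\frac{\partial^k\Gamma_\hbar}{\partial\eta^{i_1}\cdots\partial\eta^{i_k}}\frac{\partial^k\Gamma_\hbar}{\partial\psi_{i_1}\cdots\partial\psi_{i_k}}=0$$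 (Koszul signs). The coefficient of $\hbar^a$ with $n$ variables $\eta$ and $m$ variables $\psi$ encodes the operation $\mathfrak{g}^{\otimes n}\to\mathfrak{g}^{\otimes m}$ of weight $a$. (This is literally valid for finite-dimensional $\mathfrak{g}$, and in general with the usual interpretation of the formulas.) The algebra is called good if for any fixed number of inputs and any fixed weight only finitely many of these operations (over all numbers of outputs) are non-zero. In that case $CE(\mathfrak{g})=\odot^\bullet(\mathfrak{g}[-1])$ carries the differential $\Delta_0=\sum_i\frac{\partial\Gamma_\hbar}{\partial\eta^i}\big|_{\hbar=\eta^i=0}\frac{\partial}{\partial\psi_i}$. $\mathcal{BV}^{com}_\infty$-algebras. For a graded commutative algebra $V$ and linear $D:V\to V$ put $F_1^D=D$ and $F^D_{n+1}(v_1,\dots,v_{n+1})=F_n^D(v_1,\dots,v_{n-1},v_nv_{n+1})-F_n^D(v_1,\dots,v_n)v_{n+1}-(-1)^{|v_n||v_{n+1}|}F_n^D(v_1,\dots,v_{n-1},v_{n+1})v_n$; $D$ has order $\le n$ if $F^D_{n+1}=0$. A $\mathcal{BV}_\infty^{com}$-algebra is a dg graded commutative algebra $(V,d)$ with linear maps $\Delta_a:V\to V$, $a\ge1$, of degree $1-2a$ and order $\le a+1$, such that $\sum_{a=0}^n\Delta_a\circ\Delta_{n-a}=0$ for all $n\ge0$, where $\Delta_0:=-d$. (In the claim, the $\Delta_0$ of $CE(\mathfrak{g})$ is used as $\Delta_0$, i.e. up to this sign convention it is the differential.) *)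

theory Defs
  imports Complex_Main "HOL-Library.Multiset" "HOL-Library.Function_Algebras"
begin

section \<open>Graded algebra\<close>

text \<open>
  Gradings are cohomological, by integers. All structures live on a carrier \<open>A\<close> inside an
  ambient vector space; operations are only constrained on \<open>A\<close>.
\<close>

definition koszul :: "int \<Rightarrow> int \<Rightarrow> 'v::ab_group_add \<Rightarrow> 'v" where
  "koszul m n x = (if odd m \<and> odd n then - x else x)"

locale graded_space = vector_space scale
  for scale :: "'k::field_char_0 \<Rightarrow> 'v::ab_group_add \<Rightarrow> 'v" +
  fixes A :: "'v set" and V :: "int \<Rightarrow> 'v set"
  assumes subspace_component: "subspace (V n)"
    and span_components: "span (\<Union>n. V n) = A"
    and components_independent:
      "\<lbrakk>finite S; \<forall>n\<in>S. x n \<in> V n; (\<Sum>n\<in>S. x n) = 0; m \<in> S\<rbrakk> \<Longrightarrow> x m = 0"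
begin

definition linear_of_degree :: "int \<Rightarrow> ('v \<Rightarrow> 'v) \<Rightarrow> bool" where
  "linear_of_degree r D \<longleftrightarrow>
     (\<forall>x\<in>A. \<forall>y\<in>A. D (x + y) = D x + D y) \<and>
     (\<forall>c. \<forall>x\<in>A. D (scale c x) = scale c (D x)) \<and>
     (\<forall>n. \<forall>x\<in>V n. D x \<in> V (n + r))"

end

locale dg_space = graded_space +
  fixes d :: "'b \<Rightarrow> 'b"
  assumes d_degree: "linear_of_degree 1 d"
    and d_squared: "x \<in> A \<Longrightarrow> d (d x) = 0"

locale graded_comm_algebra = graded_space +
  fixes mul :: "'b \<Rightarrow> 'b \<Rightarrow> 'b" and one :: 'b
  assumes mult_add_left: "\<lbrakk>x \<in> A; y \<in> A; z \<in> A\<rbrakk> \<Longrightarrow> mul (x + y) z = mul x z + mul y z"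
    and mult_add_right: "\<lbrakk>x \<in> A; y \<in> A; z \<in> A\<rbrakk> \<Longrightarrow> mul x (y + z) = mul x y + mul x z"
    and mult_scale_left: "\<lbrakk>x \<in> A; y \<in> A\<rbrakk> \<Longrightarrow> mul (scale c x) y = scale c (mul x y)"
    and mult_scale_right: "\<lbrakk>x \<in> A; y \<in> A\<rbrakk> \<Longrightarrow> mul x (scale c y) = scale c (mul x y)"
    and mult_degree: "\<lbrakk>x \<in> V m; y \<in> V n\<rbrakk> \<Longrightarrow> mul x y \<in> V (m + n)"
    and mult_assoc: "\<lbrakk>x \<in> A; y \<in> A; z \<in> A\<rbrakk> \<Longrightarrow> mul (mul x y) z = mul x (mul y z)"
    and one_degree: "one \<in> V 0"
    and mult_one: "x \<in> A \<Longrightarrow> mul one x = x"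
    and mult_comm: "\<lbrakk>x \<in> V m; y \<in> V n\<rbrakk> \<Longrightarrow> mul x y = koszul m n (mul y x)"

text \<open>
  The multibrackets \<open>F\<^sup>D\<^sub>n\<close> on homogeneous arguments. Each argument is paired with its
  degree, and the list is in reverse order, so that \<open>F\<^sup>D\<^sub>n(v\<^sub>1,\<dots>,v\<^sub>n)\<close> is
  \<open>order_bracket mul D [(|v\<^sub>n|, v\<^sub>n), \<dots>, (|v\<^sub>1|, v\<^sub>1)]\<close>.
  The value on the empty list is junk.
\<close>

fun order_bracket ::
  "('v \<Rightarrow> 'v \<Rightarrow> 'v) \<Rightarrow> ('v \<Rightarrow> 'v) \<Rightarrow> (int \<times> 'v) list \<Rightarrow> 'v::ab_group_add" where
  "order_bracket mul D [] = 0"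
| "order_bracket mul D [(m, v)] = D v"
| "order_bracket mul D ((n, w) # (m, v) # vs) =
     order_bracket mul D ((m + n, mul v w) # vs)
     - mul (order_bracket mul D ((m, v) # vs)) w
     - koszul m n (mul (order_bracket mul D ((n, w) # vs)) v)"

definition (in graded_comm_algebra) order_le :: "nat \<Rightarrow> ('b \<Rightarrow> 'b) \<Rightarrow> bool" where
  "order_le n D \<longleftrightarrow>
     (\<forall>vs. length vs = n + 1 \<and> (\<forall>(m, v)\<in>set vs. v \<in> V m) \<longrightarrow> order_bracket mul D vs = 0)"

locale dg_comm_algebra = graded_comm_algebra + dg_space +
  assumes leibniz:
    "\<lbrakk>x \<in> V m; y \<in> A\<rbrakk> \<Longrightarrow> d (mul x y) = mul (d x) y + koszul m 1 (mul x (d y))"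

text \<open>
  Only the values \<open>\<Delta> a\<close> with \<open>a \<ge> 1\<close> matter.
\<close>

locale BV_com_infty_algebra = dg_comm_algebra +
  fixes \<Delta> :: "nat \<Rightarrow> 'b \<Rightarrow> 'b"
  assumes Delta_degree: "a \<ge> 1 \<Longrightarrow> linear_of_degree (1 - 2 * int a) (\<Delta> a)"
    and Delta_order: "a \<ge> 1 \<Longrightarrow> order_le (a + 1) (\<Delta> a)"
    and Delta_relations:
      "x \<in> A \<Longrightarrow>
        (let \<Delta>' = (\<lambda>a. if a = 0 then (\<lambda>y. - d y) else \<Delta> a)
         in (\<Sum>a\<le>n. \<Delta>' a (\<Delta>' (n - a) x)) = 0)"


section \<open>Power series in graded commutative variables\<close>

datatype 'i var = Psi 'i | Eta 'i

text \<open>In what follows, \<open>deg i\<close> is the degree of the basis vector \<open>e\<^sub>i\<close>.\<close>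

fun var_deg :: "('i \<Rightarrow> int) \<Rightarrow> 'i var \<Rightarrow> int" where
  "var_deg deg (Psi i) = deg i + 1"
| "var_deg deg (Eta i) = 1 - deg i"

text \<open>
  A monomial is a multiset of variables, standing for the product of these variables in increasing
  order. The order is only used to fix this normal form: all \<open>\<psi>\<close> come before all \<open>\<eta>\<close>.
\<close>

fun precedes :: "'i::linorder var \<Rightarrow> 'i var \<Rightarrow> bool" where
  "precedes (Psi i) (Psi j) \<longleftrightarrow> i < j"
| "precedes (Psi i) (Eta j) \<longleftrightarrow> True"
| "precedes (Eta i) (Psi j) \<longleftrightarrow> False"
| "precedes (Eta i) (Eta j) \<longleftrightarrow> i < j"

definition mono_deg :: "('i \<Rightarrow> int) \<Rightarrow> 'i var multiset \<Rightarrow> int" where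
  "mono_deg deg M = (\<Sum>v\<in>#M. var_deg deg v)"

definition admissible :: "('i \<Rightarrow> int) \<Rightarrow> 'i var multiset \<Rightarrow> bool" where
  "admissible deg M \<longleftrightarrow> (\<forall>v. odd (var_deg deg v) \<longrightarrow> count M v \<le> 1)"

text \<open>\<open>x\<^sup>M x\<^sup>N = mono_sign deg M N \<cdot> x\<^sup>M\<^sup>+\<^sup>N\<close> for the ordered monomials.\<close>

definition mono_sign :: "('i::linorder \<Rightarrow> int) \<Rightarrow> 'i var multiset \<Rightarrow> 'i var multiset \<Rightarrow> 'k::field_char_0" where
  "mono_sign deg M N =
     (if admissible deg (M + N)
      then (- 1) ^ card {(v, w). v \<in># M \<and> w \<in># N \<and> odd (var_deg deg v) \<and> odd (var_deg deg w)
                               \<and> precedes w v}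
      else 0)"

text \<open>
  \<open>F M a\<close> is the coefficient in \<open>F\<close> of the ordered monomial \<open>M\<close> times \<open>\<hbar>\<^sup>a\<close>.
  The variable \<open>\<hbar>\<close> has degree 2, so it commutes with everything.
\<close>

type_synonym ('i, 'k) series = "'i var multiset \<Rightarrow> nat \<Rightarrow> 'k"

definition power_series :: "'i set \<Rightarrow> ('i \<Rightarrow> int) \<Rightarrow> ('i, 'k::field_char_0) series \<Rightarrow> bool" where
  "power_series I deg F \<longleftrightarrow>
     (\<forall>M a. F M a \<noteq> 0 \<longrightarrow> admissible deg M \<and> set_mset M \<subseteq> Psi ` I \<union> Eta ` I)"

definition homogeneous :: "('i \<Rightarrow> int) \<Rightarrow> int \<Rightarrow> ('i, 'k::field_char_0) series \<Rightarrow> bool" where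
  "homogeneous deg n F \<longleftrightarrow> (\<forall>M a. F M a \<noteq> 0 \<longrightarrow> mono_deg deg M + 2 * int a = n)"

definition series_scale :: "'k::field_char_0 \<Rightarrow> ('i, 'k) series \<Rightarrow> ('i, 'k) series" where
  "series_scale c F = (\<lambda>M a. c * F M a)"

definition series_one :: "('i, 'k::field_char_0) series" where
  "series_one = (\<lambda>M a. if M = {#} \<and> a = 0 then 1 else 0)"

definition series_var :: "'i var \<Rightarrow> ('i, 'k::field_char_0) series" where
  "series_var v = (\<lambda>M a. if M = {#v#} \<and> a = 0 then 1 else 0)"

definition series_mult ::
  "('i::linorder \<Rightarrow> int) \<Rightarrow> ('i, 'k::field_char_0) series \<Rightarrow> ('i, 'k) series \<Rightarrow> ('i, 'k) series" where
  "series_mult deg F G = (\<lambda>L a. \<Sum>b\<le>a. \<Sum>M | M \<subseteq># L.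
     mono_sign deg M (L - M) * F M b * G (L - M) (a - b))"

text \<open>
  Left and right partial derivatives: \<open>\<partial>\<^sub>v (v x\<^sup>M) = (M(v) + 1) x\<^sup>M\<close> and
  \<open>(x\<^sup>M v) \<partial>\<^sub>v = (M(v) + 1) x\<^sup>M\<close>, respectively, where \<open>M(v)\<close> is the multiplicity of \<open>v\<close> in \<open>M\<close>
  (which must be 0 for odd \<open>v\<close>, as otherwise the product vanishes).
\<close>

definition left_deriv ::
  "('i::linorder \<Rightarrow> int) \<Rightarrow> 'i var \<Rightarrow> ('i, 'k::field_char_0) series \<Rightarrow> ('i, 'k) series" where
  "left_deriv deg v F =
     (\<lambda>M a. of_nat (count M v + 1) * mono_sign deg {#v#} M * F (add_mset v M) a)"

definition right_deriv ::
  "('i::linorder \<Rightarrow> int) \<Rightarrow> 'i var \<Rightarrow> ('i, 'k::field_char_0) series \<Rightarrow> ('i, 'k) series" where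
  "right_deriv deg v F =
     (\<lambda>M a. of_nat (count M v + 1) * mono_sign deg M {#v#} * F (add_mset v M) a)"

definition hbar_deriv :: "('i, 'k::field_char_0) series \<Rightarrow> ('i, 'k) series" where
  "hbar_deriv F = (\<lambda>M a. of_nat (a + 1) * F M (a + 1))"

text \<open>
  Sign convention: derivatives with respect to \<open>\<eta>\<close> are right derivatives, those with respect to
  \<open>\<psi>\<close> are left derivatives, and in both cases
  \<open>\<partial>\<^sup>k/\<partial>v\<^sub>1\<dots>\<partial>v\<^sub>k = \<partial>/\<partial>v\<^sub>1 \<circ> \<dots> \<circ> \<partial>/\<partial>v\<^sub>k\<close>. Hence in a product
  \<open>(\<partial>\<^sup>kF/\<partial>\<eta>\<^sup>i\<^sup>1\<dots>\<partial>\<eta>\<^sup>i\<^sup>k) (\<partial>\<^sup>kG/\<partial>\<psi>\<^sub>i\<^sub>1\<dots>\<partial>\<psi>\<^sub>i\<^sub>k)\<close>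
  adjacent variables are contracted, without crossing other factors, and this product carries
  precisely the Koszul sign: the rule is \<open>\<eta>\<^sup>i \<mapsto> \<hbar> \<partial>/\<partial>\<psi>\<^sub>i\<close>.
\<close>

definition eta_derivs ::
  "('i::linorder \<Rightarrow> int) \<Rightarrow> 'i list \<Rightarrow> ('i, 'k::field_char_0) series \<Rightarrow> ('i, 'k) series" where
  "eta_derivs deg is F = foldr (right_deriv deg) (map Eta is) F"

definition psi_derivs ::
  "('i::linorder \<Rightarrow> int) \<Rightarrow> 'i list \<Rightarrow> ('i, 'k::field_char_0) series \<Rightarrow> ('i, 'k) series" where
  "psi_derivs deg is F = foldr (left_deriv deg) (map Psi is) F"

definition psi_zero :: "('i, 'k::field_char_0) series \<Rightarrow> ('i, 'k) series" where
  "psi_zero F = (\<lambda>M a. if set_mset M \<inter> range Psi = {} then F M a else 0)"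

definition eta_zero :: "('i, 'k::field_char_0) series \<Rightarrow> ('i, 'k) series" where
  "eta_zero F = (\<lambda>M a. if set_mset M \<inter> range Eta = {} then F M a else 0)"

definition hbar_zero :: "('i, 'k::field_char_0) series \<Rightarrow> ('i, 'k) series" where
  "hbar_zero F = (\<lambda>M a. if a = 0 then F M 0 else 0)"

text \<open>
  Coefficientwise sum of a possibly infinite family; it is meaningful when every monomial has a
  nonzero coefficient in only finitely many members of the family.
\<close>

definition formal_sum :: "'x set \<Rightarrow> ('x \<Rightarrow> ('i, 'k::field_char_0) series) \<Rightarrow> ('i, 'k) series" where
  "formal_sum X F = (\<lambda>M a. \<Sum>x | x \<in> X \<and> F x M a \<noteq> 0. F x M a)"

definition multi_indices :: "'i set \<Rightarrow> nat \<Rightarrow> 'i list set" where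
  "multi_indices I k = {is. set is \<subseteq> I \<and> length is = k}"

text \<open>
  The product \<open>F *\<^sub>\<hbar> G\<close>, multiplied by \<open>\<hbar>\<close> to clear the factor \<open>\<hbar>\<^sup>-\<^sup>1\<close> in the summand
  \<open>k = 0\<close>: the coefficient of \<open>\<hbar>\<^sup>a\<close> below is the coefficient of \<open>\<hbar>\<^sup>a\<^sup>-\<^sup>1\<close> in \<open>F *\<^sub>\<hbar> G\<close>.
\<close>

definition hbar_times_star ::
  "'i::linorder set \<Rightarrow> ('i \<Rightarrow> int) \<Rightarrow> ('i, 'k::field_char_0) series \<Rightarrow> ('i, 'k) series \<Rightarrow> ('i, 'k) series" where
  "hbar_times_star I deg F G = (\<lambda>M a. \<Sum>k\<le>a. 1 / fact k *
     formal_sum (multi_indices I k)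
       (\<lambda>is. series_mult deg (eta_derivs deg is F) (psi_derivs deg is G)) M (a - k))"


section \<open>Homotopy involutive Lie bialgebras\<close>

text \<open>A cochain complex \<open>\<gg>\<close> (with carrier \<open>A\<close>) and a homogeneous basis \<open>(e\<^sub>i)\<close>, \<open>i \<in> I\<close>.\<close>

locale dg_space_with_basis = dg_space +
  fixes I :: "'i::linorder set" and e :: "'i \<Rightarrow> 'b" and deg :: "'i \<Rightarrow> int"
  assumes basis_inj: "inj_on e I"
    and basis_independent: "independent (e ` I)"
    and basis_span: "span (e ` I) = A"
    and basis_degree: "i \<in> I \<Longrightarrow> e i \<in> V (deg i)"
begin

text \<open>
  \<open>D\<^sub>\<gg> = \<Sum>\<^sub>i\<^sub>j d\<^sup>i\<^sub>j \<psi>\<^sub>i \<eta>\<^sup>j\<close>, where \<open>d e\<^sub>j = \<Sum>\<^sub>i d\<^sup>i\<^sub>j e\<^sub>i\<close>. No sign is needed here: with the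
  conventions above, minus the operator \<open>\<Delta>\<^sub>0\<close> below then acts on the generators by the
  differential \<open>- d\<close> of the shifted complex \<open>\<gg>[-1]\<close>.
\<close>

definition differential_series :: "('i, 'a) series" where
  "differential_series = formal_sum (I \<times> I)
     (\<lambda>(i, j). series_scale (representation (e ` I) (d (e j)) (e i))
                 (series_mult deg (series_var (Psi i)) (series_var (Eta j))))"

end

definition outputs :: "'i var multiset \<Rightarrow> nat" where
  "outputs M = size (filter_mset (\<lambda>v. v \<in> range Psi) M)"

definition inputs :: "'i var multiset \<Rightarrow> nat" where
  "inputs M = size (filter_mset (\<lambda>v. v \<in> range Eta) M)"

text \<open>
  The assumption \<open>operations\<close> says that the coefficients do define linear maps
  \<open>\<gg>\<^sup>\<otimes>\<^sup>n \<rightarrow> \<gg>\<^sup>\<otimes>\<^sup>m\<close>, i.e. that every tuple of basis vectors (a monomial \<open>N\<close> in the \<open>\<eta>\<close>) is sent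
  to a finite linear combination of basis tensors (monomials \<open>M\<close> in the \<open>\<psi>\<close>).
  It holds automatically when \<open>\<gg>\<close> is finite-dimensional.
\<close>

locale Lie_diamond_B_infty_algebra = dg_space_with_basis scale A V d I e deg
  for scale :: "'k::field_char_0 \<Rightarrow> 'g::ab_group_add \<Rightarrow> 'g" and A V d
    and I :: "'i::linorder set" and e deg +
  fixes \<Gamma> :: "('i, 'k) series"
  assumes series: "power_series I deg \<Gamma>"
    and degree: "homogeneous deg 3 \<Gamma>"
    and operations:
      "finite {M. set_mset M \<subseteq> range Psi \<and> size M = m \<and> \<Gamma> (M + image_mset Eta N) a \<noteq> 0}"
    and no_inputless: "eta_zero (\<Gamma> - differential_series) = 0"
    and no_outputless: "psi_zero (\<Gamma> - differential_series) = 0"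
    and cubic: "size M < 3 \<Longrightarrow> hbar_zero (\<Gamma> - differential_series) M a = 0"
    and master_equation: "hbar_times_star I deg \<Gamma> \<Gamma> = 0"

definition good :: "('i, 'k::field_char_0) series \<Rightarrow> bool" where
  "good \<Gamma> \<longleftrightarrow>
     (\<forall>n a. finite {m. \<exists>M. inputs M = n \<and> outputs M = m \<and> \<Gamma> M a \<noteq> 0})"


section \<open>The Chevalley-Eilenberg complex and its operators\<close>

text \<open>Polynomials in the \<open>\<psi>\<^sub>i\<close>, as a subalgebra of the power series in \<open>\<psi>, \<eta>, \<hbar>\<close>.\<close>

definition CE :: "'i set \<Rightarrow> ('i \<Rightarrow> int) \<Rightarrow> ('i, 'k::field_char_0) series set" where
  "CE I deg = {F. power_series I deg F \<and> eta_zero F = F \<and> hbar_zero F = F \<and> finite {M. F M 0 \<noteq> 0}}"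

definition CE_component :: "'i set \<Rightarrow> ('i \<Rightarrow> int) \<Rightarrow> int \<Rightarrow> ('i, 'k::field_char_0) series set" where
  "CE_component I deg n = {F \<in> CE I deg. homogeneous deg n F}"

definition CE_Delta0 ::
  "'i::linorder set \<Rightarrow> ('i \<Rightarrow> int) \<Rightarrow> ('i, 'k::field_char_0) series \<Rightarrow> ('i, 'k) series \<Rightarrow> ('i, 'k) series" where
  "CE_Delta0 I deg \<Gamma> F = formal_sum I (\<lambda>i.
     series_mult deg (eta_zero (hbar_zero (right_deriv deg (Eta i) \<Gamma>))) (left_deriv deg (Psi i) F))"

definition CE_Delta ::
  "'i::linorder set \<Rightarrow> ('i \<Rightarrow> int) \<Rightarrow> ('i, 'k::field_char_0) series \<Rightarrow> nat \<Rightarrow> ('i, 'k) series \<Rightarrow> ('i, 'k) series" where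
  "CE_Delta I deg \<Gamma> a F = (\<Sum>(p, k) | p + k = a + 1.
     series_scale (1 / (fact p * fact k))
       (formal_sum (multi_indices I k) (\<lambda>is.
          series_mult deg
            (eta_zero (hbar_zero ((hbar_deriv ^^ p) (eta_derivs deg is \<Gamma>))))
            (psi_derivs deg is F))))"

end

(*
  Normal ordering turns a series F(psi, eta, hbar) into an operator on polynomials in psi (times powers
  of hbar): every eta^i is moved to the right and replaced by hbar d/dpsi_i. In terms of the star
  product this operator is x |-> (F * x) at eta = 0, and Delta_a x is the coefficient of hbar^(a+1) in
  the result for F = Gamma.

  The star product is determined by (psi_i F) * G = psi_i (F * G) and
  (F eta^j) * G = F * (eta^j G) + hbar F * (d_j G), where d_j is the derivative along psi_j. Together
  with (F * (eta^j x)) at eta = 0 being zero, this gives by induction on a polynomial F that the operator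
  of F * G is the composition of the operators of F and G. As Gamma * Gamma = 0, the coefficients of
  the powers of hbar in the square of the operator of Gamma are the required relations.

  Gamma itself may be an infinite series in infinitely many variables; but for a given polynomial x, a
  bounded power of hbar and a bounded number of derivatives, goodness leaves only finitely many terms
  of Gamma that matter, so Gamma can be replaced by a polynomial.
*)
theory Submission
  imports Defs "HOL-Library.Product_Plus"
begin

section \<open>Signs\<close>

text \<open>The shift from \<open>a\<close> to \<open>a + 1\<close> has two sources. Each \<eta>
  that becomes a derivative brings one \<hbar>, so the coefficient of \<open>\<hbar>^c\<close>
  contains at most \<open>c\<close> derivatives, which gives the bound on the order. As \<Gamma>
  vanishes at \<eta> = 0, every term contains a derivative; hence there are no multiplication
  operators (which the multibrackets used here would never kill), the coefficient of
  \<open>\<hbar>^0\<close> is zero, and the relation with index \<open>n\<close> is the coefficient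
  of \<open>\<hbar>^(n + 2)\<close> in the square. The obstacle is infinity: the induction needs
  polynomials and finite index sets, but a truncation of \<Gamma> no longer satisfies the master
  equation. It suffices that its star square vanishes in the coefficients that \<open>x\<close> can
  see: bounded powers of \<hbar>, and boundedly many \<eta>, all with indices from \<open>x\<close>.
  The truncation has two stages, since the first application of \<Gamma> creates new \<psi> that the
  second one may differentiate. The order is controlled by a recursive notion of differential
  operator, which is stable under left multiplication and under composition with
  derivations.\<close>

definition splits :: "'a::plus \<Rightarrow> ('a \<times> 'a) set" where
  "splits s = {(x, y). x + y = s}"

text \<open>Both sides run over all triples with \<open>x + y + z = s\<close>, grouped from the left
  or from the right.\<close>

lemma sum_splits_assoc:
  fixes f :: "'a::cancel_comm_monoid_add \<Rightarrow> 'a \<Rightarrow> 'a \<Rightarrow> 'b::comm_monoid_add"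
  assumes "\<And>s::'a. finite (splits s)"
  shows "(\<Sum>(p, z)\<in>splits s. \<Sum>(x, y)\<in>splits p. f x y z) =
         (\<Sum>(x, q)\<in>splits s. \<Sum>(y, z)\<in>splits q. f x y z)"
proof -
  have "(\<Sum>(p, z)\<in>splits s. \<Sum>(x, y)\<in>splits p. f x y z) =
        (\<Sum>((p, z), (x, y))\<in>(SIGMA t:splits s. splits (fst t)). f x y z)"
    by (subst sum.Sigma[symmetric]) (auto simp: assms case_prod_beta)
  also have "\<dots> = (\<Sum>((x, q), (y, z))\<in>(SIGMA t:splits s. splits (snd t)). f x y z)"
    by (rule sum.reindex_bij_witness
        [of _ "\<lambda>((x, q), (y, z)). ((x + y, z), (x, y))" "\<lambda>((p, z), (x, y)). ((x, y + z), (y, z))"])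
       (auto simp: splits_def add.assoc)
  also have "\<dots> = (\<Sum>(x, q)\<in>splits s. \<Sum>(y, z)\<in>splits q. f x y z)"
    by (subst sum.Sigma[symmetric]) (auto simp: assms case_prod_beta)
  finally show ?thesis .
qed

lemma finite_submultisets: "finite {M. M \<subseteq># L}"
proof (induction L)
  case (add x L)
  have "{M. M \<subseteq># add_mset x L} \<subseteq> {M. M \<subseteq># L} \<union> add_mset x ` {M. M \<subseteq># L}"
  proof
    fix M assume "M \<in> {M. M \<subseteq># add_mset x L}"
    then have M: "M \<subseteq># add_mset x L" by simp
    show "M \<in> {M. M \<subseteq># L} \<union> add_mset x ` {M. M \<subseteq># L}"
    proof (cases "x \<in># M")
      case True
      then obtain N where "M = add_mset x N" by (metis multi_member_split)
      with M show ?thesis by auto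
    next
      case False
      with M have "M \<subseteq># L"
        by (metis add_mset_remove_trivial diff_single_trivial subset_eq_diff_conv add_mset_add_single)
      then show ?thesis by simp
    qed
  qed
  with add show ?case by (meson finite_Un finite_imageI finite_subset)
qed simp

lemma finite_splits_mset: "finite (splits (L::'a multiset))"
proof -
  have "splits L \<subseteq> {M. M \<subseteq># L} \<times> {M. M \<subseteq># L}"
    by (auto simp: splits_def)
  then show ?thesis by (rule finite_subset) (simp add: finite_submultisets)
qed

lemma finite_splits_nat: "finite (splits (a::nat))"
  by (rule finite_subset[of _ "{..a} \<times> {..a}"]) (auto simp: splits_def)

lemma finite_splits: "finite (splits (s::'a multiset \<times> nat))"
proof -
  have "splits s \<subseteq> (\<lambda>((M, N), (a, b)). ((M, a), (N, b))) ` (splits (fst s) \<times> splits (snd s))"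
    by (force simp: splits_def image_iff plus_prod_def)
  then show ?thesis
    by (meson finite_SigmaI finite_imageI finite_splits_mset finite_splits_nat finite_subset)
qed

locale graded_variables =
  fixes deg :: "'i::linorder \<Rightarrow> int"
begin

abbreviation odd_var :: "'i var \<Rightarrow> bool" where
  "odd_var v \<equiv> odd (var_deg deg v)"

abbreviation mono_sgn :: "'i var multiset \<Rightarrow> 'i var multiset \<Rightarrow> 'k::field_char_0" where
  "mono_sgn \<equiv> mono_sign deg"

text \<open>The exponent of \<open>mono_sign\<close>, but counted with multiplicities: in this form
  it is additive in both arguments, which a cardinality of a set of pairs is not.\<close>

definition inversions :: "'i var multiset \<Rightarrow> 'i var multiset \<Rightarrow> nat" where
  "inversions M N = (\<Sum>v\<in>#M. \<Sum>w\<in>#N. of_bool (odd_var v \<and> odd_var w \<and> precedes w v))"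

definition odd_size :: "'i var multiset \<Rightarrow> nat" where
  "odd_size M = (\<Sum>v\<in>#M. of_bool (odd_var v))"

lemma odd_size_simps [simp]:
  "odd_size {#} = 0" "odd_size (add_mset v M) = of_bool (odd_var v) + odd_size M"
  "odd_size (M + N) = odd_size M + odd_size N"
  by (simp_all add: odd_size_def)

lemma inversions_simps [simp]:
  "inversions {#} N = 0" "inversions M {#} = 0"
  "inversions (M + M') N = inversions M N + inversions M' N"
  "inversions M (N + N') = inversions M N + inversions M N'"
  by (simp_all add: inversions_def sum_mset.distrib)

lemma inversions_add_mset:
  "inversions (add_mset v M) N = inversions {#v#} N + inversions M N"
  "inversions M (add_mset w N) = inversions M {#w#} + inversions M N"
  by (simp_all add: inversions_def sum_mset.distrib)

lemma admissible_add: "admissible deg (M + N) \<Longrightarrow> admissible deg M \<and> admissible deg N"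
  unfolding admissible_def count_union by (meson add_leD1 add_leD2)

lemma admissible_empty [simp]: "admissible deg {#}"
  by (simp add: admissible_def)

lemma admissible_single [simp]: "admissible deg {#v#}"
  by (simp add: admissible_def)

lemma admissible_add_mset:
  "admissible deg (add_mset v M) \<longleftrightarrow> admissible deg M \<and> (odd_var v \<longrightarrow> v \<notin># M)"
proof
  assume adm: "admissible deg (add_mset v M)"
  then have "admissible deg M" using admissible_add[of "{#v#}" M] by simp
  moreover have "Suc (count M v) \<le> 1" if "odd_var v"
    using adm that unfolding admissible_def by (metis count_add_mset)
  ultimately show "admissible deg M \<and> (odd_var v \<longrightarrow> v \<notin># M)" by (auto simp: not_in_iff)
next
  assume "admissible deg M \<and> (odd_var v \<longrightarrow> v \<notin># M)"
  then show "admissible deg (add_mset v M)" by (simp add: admissible_def not_in_iff)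
qed

lemma filter_odd_mset_set:
  assumes "admissible deg M"
  shows "filter_mset odd_var M = mset_set {v. v \<in># M \<and> odd_var v}"
proof (rule multiset_eqI)
  fix v
  have "count M v \<le> 1" if "odd_var v" using assms that by (simp add: admissible_def)
  moreover have "finite {v. v \<in># M \<and> odd_var v}" by simp
  ultimately show "count (filter_mset odd_var M) v = count (mset_set {v. v \<in># M \<and> odd_var v}) v"
    by (cases "v \<in># M"; cases "odd_var v")
       (auto simp: count_mset_set' not_in_iff intro!: antisym)
qed

lemma sum_mset_of_bool_conj:
  "(\<Sum>v\<in>#M. of_bool (P v \<and> Q v) :: nat) = (\<Sum>v\<in>#filter_mset P M. of_bool (Q v))"
  by (induction M) auto

text \<open>In an admissible monomial an odd variable occurs at most once, so counting odd pairs
  with multiplicities gives the cardinality of the set of these pairs.\<close>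

lemma mono_sign_inversions:
  "mono_sgn M N = (if admissible deg (M + N) then (- 1) ^ inversions M N else 0)"
proof (cases "admissible deg (M + N)")
  case True
  then have M: "admissible deg M" and N: "admissible deg N" by (auto dest: admissible_add)
  define OM where "OM = {v. v \<in># M \<and> odd_var v}"
  define ON where "ON = {v. v \<in># N \<and> odd_var v}"
  have fin: "finite OM" "finite ON" by (simp_all add: OM_def ON_def)
  have "inversions M N = (\<Sum>v\<in>#M. if odd_var v then \<Sum>w\<in>#filter_mset odd_var N. of_bool (precedes w v) else 0)"
    unfolding inversions_def sum_mset_of_bool_conj[symmetric]
    by (intro arg_cong[where f = sum_mset] image_mset_cong) auto
  also have "\<dots> = (\<Sum>v\<in>#filter_mset odd_var M. \<Sum>w\<in>#filter_mset odd_var N. of_bool (precedes w v))"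
    by (induction M) auto
  also have "\<dots> = (\<Sum>v\<in>OM. \<Sum>w\<in>ON. of_bool (precedes w v))"
    unfolding filter_odd_mset_set[OF M] filter_odd_mset_set[OF N]
    by (simp add: sum_unfold_sum_mset OM_def ON_def)
  also have "\<dots> = (\<Sum>v\<in>OM. card {w \<in> ON. precedes w v})"
    using fin by (intro sum.cong) (auto simp: Collect_conj_eq Int_commute)
  also have "\<dots> = card (SIGMA v:OM. {w \<in> ON. precedes w v})"
    using fin by (subst card_SigmaI) auto
  also have "(SIGMA v:OM. {w \<in> ON. precedes w v}) = {(v, w). v \<in># M \<and> w \<in># N \<and> odd_var v
      \<and> odd_var w \<and> precedes w v}"
    by (auto simp: OM_def ON_def)
  finally show ?thesis using True by (simp add: mono_sign_def)
qed (simp add: mono_sign_def)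

text \<open>By additivity both sides have the exponent
  \<open>inversions M N + inversions M P + inversions N P\<close>, and both vanish unless
  \<open>M + N + P\<close> is admissible. This is the associativity of the product on
  monomials.\<close>

lemma mono_sign_cocycle:
  "mono_sgn M N * mono_sgn (M + N) P = mono_sgn N P * mono_sgn M (N + P)"
proof (cases "admissible deg (M + N + P)")
  case True
  then have "admissible deg (M + N)" "admissible deg (M + (N + P))"
    using admissible_add[of "M + N" P] by (simp_all add: add.assoc)
  moreover from this(2) have "admissible deg (N + P)" using admissible_add[of M "N + P"] by blast
  ultimately show ?thesis using True
    by (simp add: mono_sign_inversions power_add add.assoc)
next
  case False
  then show ?thesis by (simp add: mono_sign_inversions add.assoc)
qed

lemma precedes_swap:
  "(if odd_var v \<and> odd_var w \<and> precedes w v then 1 else 0)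
   + (if odd_var v \<and> odd_var w \<and> precedes v w then 1 else 0)
   = (if odd_var v \<and> odd_var w \<and> v \<noteq> w then 1 else 0 :: nat)"
  by (cases v; cases w) auto

text \<open>A pair of odd variables, one from \<open>M\<close> and one from \<open>N\<close>, is
  inverted in exactly one of the two orders, because admissibility of the sum forbids that they
  coincide.\<close>

lemma inversions_swap:
  assumes "admissible deg (M + N)"
  shows "inversions M N + inversions N M = odd_size M * odd_size N"
  using assms
proof (induction M)
  case (add v M)
  have eq: "add_mset v M + N = add_mset v (M + N)" by simp
  have "admissible deg (M + N)" "odd_var v \<longrightarrow> v \<notin># N"
    using add.prems unfolding eq by (auto simp: admissible_add_mset)
  moreover from this(2) have "inversions {#v#} N + inversions N {#v#} = of_bool (odd_var v) * odd_size N"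
  proof (induction N)
    case (add w N)
    then have IH: "inversions {#v#} N + inversions N {#v#} = of_bool (odd_var v) * odd_size N"
      by auto
    have "inversions {#v#} {#w#} + inversions {#w#} {#v#} = of_bool (odd_var v) * of_bool (odd_var w)"
      using precedes_swap[of v w] add.prems by (auto simp: inversions_def split: if_splits)
    with IH show ?case
      by (simp add: inversions_add_mset(1)[of w N] inversions_add_mset(2)[of _ w N] algebra_simps)
  qed auto
  ultimately show ?case using add.IH
    by (simp add: inversions_add_mset(1)[of v M] inversions_add_mset(2)[of N v M] algebra_simps)
qed auto

lemma mono_sign_swap: "mono_sgn M N = (- 1) ^ (odd_size M * odd_size N) * mono_sgn N M"
proof (cases "admissible deg (M + N)")
  case True
  have "(- 1 :: 'k::field_char_0) ^ inversions M N = (- 1) ^ (odd_size M * odd_size N) * (- 1) ^ inversions N M"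
    unfolding inversions_swap[OF True, symmetric] power_add[symmetric] by (simp add: minus_one_power_iff)
  with True show ?thesis by (simp add: mono_sign_inversions add.commute)
qed (simp add: mono_sign_inversions add.commute)

lemma mono_sign_empty [simp]: "mono_sgn {#} M = (if admissible deg M then 1 else 0)"
  "mono_sgn M {#} = (if admissible deg M then 1 else 0)"
  by (simp_all add: mono_sign_inversions)

lemma mono_sign_square: "mono_sgn M N * mono_sgn M N = of_bool (admissible deg (M + N))"
  by (auto simp: mono_sign_inversions simp flip: power_add)

lemma odd_size_mono_deg: "odd (odd_size M) \<longleftrightarrow> odd (mono_deg deg M)"
  by (induction M) (auto simp: mono_deg_def)

section \<open>The algebra of power series\<close>

abbreviation mult :: "('i, 'k::field_char_0) series \<Rightarrow> ('i, 'k) series \<Rightarrow> ('i, 'k) series" (infixl "\<odot>" 70) where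
  "F \<odot> G \<equiv> series_mult deg F G"

text \<open>A monomial and a power of \<hbar> together form one additive index, so that
  associativity becomes a single regrouping of triples combined with the cocycle identity.\<close>

lemma mult_splits:
  "(F \<odot> G) L a = (\<Sum>(x, y)\<in>splits (L, a). mono_sgn (fst x) (fst y) * case_prod F x * case_prod G y)"
proof -
  have "(F \<odot> G) L a = (\<Sum>(b, M)\<in>{..a} \<times> {M. M \<subseteq># L}. mono_sgn M (L - M) * F M b * G (L - M) (a - b))"
    unfolding series_mult_def by (rule sum.cartesian_product)
  also have "\<dots> = (\<Sum>(x, y)\<in>splits (L, a). mono_sgn (fst x) (fst y) * case_prod F x * case_prod G y)"
    by (rule sum.reindex_bij_witness[of _ "\<lambda>((M, b), (N, c)). (b, M)" "\<lambda>(b, M). ((M, b), (L - M, a - b))"])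
       (auto simp: splits_def)
  finally show ?thesis .
qed

lemma mult_assoc: "(F \<odot> G) \<odot> H = F \<odot> (G \<odot> H)"
proof (intro ext)
  fix L a
  let ?f = "case_prod F" and ?g = "case_prod G" and ?h = "case_prod H"
  have "((F \<odot> G) \<odot> H) L a = (\<Sum>(p, z)\<in>splits (L, a). \<Sum>(x, y)\<in>splits p.
      mono_sgn (fst x) (fst y) * mono_sgn (fst x + fst y) (fst z) * (?f x * ?g y * ?h z))"
    unfolding mult_splits[of _ H]
    by (rule sum.cong, auto simp: mult_splits case_prod_beta sum_distrib_left sum_distrib_right splits_def
        intro!: sum.cong)
  also have "\<dots> = (\<Sum>(p, z)\<in>splits (L, a). \<Sum>(x, y)\<in>splits p.
      mono_sgn (fst y) (fst z) * mono_sgn (fst x) (fst y + fst z) * (?f x * ?g y * ?h z))"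
    by (simp only: mono_sign_cocycle)
  also have "\<dots> = (\<Sum>(x, q)\<in>splits (L, a). \<Sum>(y, z)\<in>splits q.
      mono_sgn (fst y) (fst z) * mono_sgn (fst x) (fst y + fst z) * (?f x * ?g y * ?h z))"
    by (rule sum_splits_assoc[OF finite_splits])
  also have "\<dots> = (F \<odot> (G \<odot> H)) L a"
    unfolding mult_splits[of F]
    by (rule sum.cong, auto simp: mult_splits case_prod_beta sum_distrib_left sum_distrib_right splits_def
        intro!: sum.cong)
  finally show "((F \<odot> G) \<odot> H) L a = (F \<odot> (G \<odot> H)) L a" .
qed

lemma mult_bilinear [simp]:
  "0 \<odot> F = 0" "F \<odot> 0 = 0"
  "(F + G) \<odot> H = F \<odot> H + G \<odot> H" "H \<odot> (F + G) = H \<odot> F + H \<odot> G"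
  "(- F) \<odot> H = - (F \<odot> H)" "H \<odot> (- F) = - (H \<odot> F)"
  "series_scale c F \<odot> H = series_scale c (F \<odot> H)" "H \<odot> series_scale c F = series_scale c (H \<odot> F)"
  by (auto simp: series_mult_def fun_eq_iff series_scale_def algebra_simps sum.distrib sum_negf sum_distrib_left)

lemma mult_sum: "(\<Sum>x\<in>X. f x) \<odot> H = (\<Sum>x\<in>X. f x \<odot> H)" "H \<odot> (\<Sum>x\<in>X. f x) = (\<Sum>x\<in>X. H \<odot> f x)"
  by (induction X rule: infinite_finite_induct) auto

end

section \<open>Generators and derivatives\<close>

text \<open>A shift of coefficients, because \<hbar> is not one of the variables that
  \<open>series_var\<close> provides.\<close>

definition hbar_mult :: "('i, 'k::field_char_0) series \<Rightarrow> ('i, 'k) series" where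
  "hbar_mult F = (\<lambda>M a. case a of 0 \<Rightarrow> 0 | Suc b \<Rightarrow> F M b)"

lemma hbar_mult_simps [simp]:
  "hbar_mult F M 0 = 0" "hbar_mult F M (Suc b) = F M b"
  by (simp_all add: hbar_mult_def)

lemma series_scale_one [simp]: "series_scale 1 F = F"
  by (simp add: series_scale_def)

lemma series_scale_linear:
  "series_scale c (F + G) = series_scale c F + series_scale c G"
  "series_scale c (- F) = - series_scale c F"
  "series_scale c 0 = 0" "series_scale 0 F = 0"
  "series_scale c (series_scale b F) = series_scale (c * b) F"
  by (auto simp: series_scale_def fun_eq_iff algebra_simps)

lemma series_scale_sum: "series_scale c (\<Sum>x\<in>X. f x) = (\<Sum>x\<in>X. series_scale c (f x))"
  by (induction X rule: infinite_finite_induct) (auto simp: series_scale_linear simp del: plus_fun_apply zero_fun_apply)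

lemma sum_series_apply: "(\<Sum>x\<in>X. f x) M a = (\<Sum>x\<in>X. f x M (a::nat))"
  by (induction X rule: infinite_finite_induct) auto

lemma hbar_mult_linear:
  "hbar_mult (F + G) = hbar_mult F + hbar_mult G" "hbar_mult (- F) = - hbar_mult F"
  "hbar_mult (series_scale c F) = series_scale c (hbar_mult F)" "hbar_mult 0 = 0"
  by (auto simp: hbar_mult_def series_scale_def fun_eq_iff split: nat.split)

lemma hbar_mult_sum: "hbar_mult (\<Sum>x\<in>X. f x) = (\<Sum>x\<in>X. hbar_mult (f x))"
  by (induction X rule: infinite_finite_induct) (auto simp: hbar_mult_linear simp del: plus_fun_apply zero_fun_apply)

lemma koszul_linear:
  "koszul m n (x + y) = koszul m n x + koszul m n y" "koszul m n (- x) = - koszul m n x"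
  "koszul m n 0 = 0" "koszul m n (x - y) = koszul m n x - koszul m n y"
  by (auto simp: koszul_def)

lemma koszul_sum: "koszul m n (\<Sum>x\<in>X. f x) = (\<Sum>x\<in>X. koszul m n (f x))"
  by (auto simp: koszul_def sum_negf)

lemma koszul_swap: "koszul m n x = koszul n m x"
  by (auto simp: koszul_def)

lemma koszul_series_apply: "koszul m n F M a = (if odd m \<and> odd n then - F M a else F M a)"
  for F :: "('i, 'k::field_char_0) series"
  by (simp add: koszul_def)

lemma koszul_series_scale: "koszul m n (series_scale c F) = series_scale c (koszul m n F)"
  by (simp add: koszul_def series_scale_linear)

lemma koszul_hbar_mult: "koszul m n (hbar_mult F) = hbar_mult (koszul m n F)"
  by (simp add: koszul_def hbar_mult_linear)

context graded_variables
begin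

abbreviation admissible_series :: "('i, 'k::field_char_0) series \<Rightarrow> bool" where
  "admissible_series \<equiv> power_series UNIV deg"

lemma admissible_series_iff: "admissible_series F \<longleftrightarrow> (\<forall>M a. F M a \<noteq> 0 \<longrightarrow> admissible deg M)"
proof -
  have "set_mset M \<subseteq> range Psi \<union> range Eta" for M :: "'i var multiset"
    by (metis UNIV_I UnI1 UnI2 rangeI subsetI var.exhaust)
  then show ?thesis by (simp add: power_series_def)
qed

lemma mult_koszul: "koszul m n F \<odot> G = koszul m n (F \<odot> G)" "F \<odot> koszul m n G = koszul m n (F \<odot> G)"
  by (simp_all add: koszul_def)

lemma one_mult: "admissible_series F \<Longrightarrow> series_one \<odot> F = F"
proof (intro ext)
  fix L a assume F: "admissible_series F"
  have "(series_one \<odot> F) L a = (\<Sum>(b, M)\<in>{..a} \<times> {M. M \<subseteq># L}. mono_sgn M (L - M) * series_one M b * F (L - M) (a - b))"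
    unfolding series_mult_def by (rule sum.cartesian_product)
  also have "\<dots> = (\<Sum>(b, M)\<in>{(0, {#})}. mono_sgn M (L - M) * series_one M b * F (L - M) (a - b))"
    by (rule sum.mono_neutral_right) (auto simp: series_one_def finite_submultisets split: if_splits)
  also have "\<dots> = F L a" using F by (auto simp: series_one_def admissible_series_iff)
  finally show "(series_one \<odot> F) L a = F L a" .
qed

lemma var_mult_eq:
  "(series_var v \<odot> F) L a = (if v \<in># L then mono_sgn {#v#} (L - {#v#}) * F (L - {#v#}) a else 0)"
proof -
  have "(series_var v \<odot> F) L a = (\<Sum>(b, M)\<in>{..a} \<times> {M. M \<subseteq># L}. mono_sgn M (L - M) * series_var v M b * F (L - M) (a - b))"
    unfolding series_mult_def by (rule sum.cartesian_product)
  also have "\<dots> = (\<Sum>(b, M)\<in>(if v \<in># L then {(0, {#v#})} else {}). mono_sgn M (L - M) * series_var v M b * F (L - M) (a - b))"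
    by (rule sum.mono_neutral_right) (auto simp: series_var_def finite_submultisets split: if_splits)
  finally show ?thesis by (auto simp: series_var_def)
qed

lemma mult_var_eq:
  fixes F :: "('i, 'k::field_char_0) series"
  shows "(F \<odot> series_var v) L a = (if v \<in># L then mono_sgn (L - {#v#}) {#v#} * F (L - {#v#}) a else 0)"
proof -
  have "(F \<odot> series_var v) L a = (\<Sum>(b, M)\<in>{..a} \<times> {M. M \<subseteq># L}. mono_sgn M (L - M) * F M b * series_var v (L - M) (a - b))"
    unfolding series_mult_def by (rule sum.cartesian_product)
  also have "\<dots> = (\<Sum>(b, M)\<in>(if v \<in># L then {(a, L - {#v#})} else {}). mono_sgn M (L - M) * F M b * series_var v (L - M) (a - b))"
  proof (rule sum.mono_neutral_right)
    show "\<forall>i\<in>{..a} \<times> {M. M \<subseteq># L} - (if v \<in># L then {(a, L - {#v#})} else {}).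
       (case i of (b, M) \<Rightarrow> mono_sgn M (L - M) * F M b * series_var v (L - M) (a - b)) = 0"
    proof
      fix p assume p: "p \<in> {..a} \<times> {M. M \<subseteq># L} - (if v \<in># L then {(a, L - {#v#})} else {})"
      obtain b M where bM: "p = (b, M)" by (cases p)
      with p have *: "b \<in> {..a}" "M \<subseteq># L" "(b, M) \<notin> (if v \<in># L then {(a, L - {#v#})} else {})"
        by auto
      have "series_var v (L - M) (a - b) = (0::'k)"
      proof (rule ccontr)
        assume "series_var v (L - M) (a - b) \<noteq> (0::'k)"
        then have "L - M = {#v#}" "a - b = 0" by (auto simp: series_var_def split: if_splits)
        moreover from this(1) *(2) have "L = add_mset v M"
          by (metis add_mset_add_single subset_mset.add_diff_inverse)
        moreover from calculation *(1) have "a = b" by simp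
        ultimately show False using *(3) by simp
      qed
      then show "(case p of (b, M) \<Rightarrow> mono_sgn M (L - M) * F M b * series_var v (L - M) (a - b)) = 0"
        by (simp add: bM)
    qed
  qed (auto simp: finite_submultisets)
  also have "\<dots> = (if v \<in># L then mono_sgn (L - {#v#}) {#v#} * F (L - {#v#}) a else 0)"
    by (auto simp: series_var_def dest!: multi_member_split)
  finally show ?thesis .
qed

lemma var_mult_var: "series_var v \<odot> series_var w = koszul (var_deg deg v) (var_deg deg w) (series_var w \<odot> series_var v)"
proof (intro ext)
  fix L a
  show "(series_var v \<odot> series_var w) L a = koszul (var_deg deg v) (var_deg deg w) (series_var w \<odot> series_var v) L a"
  proof (cases "v \<in># L \<and> L - {#v#} = {#w#}")
    case True
    then show ?thesis using mono_sign_swap[of "{#v#}" "{#w#}"]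
      by (auto simp: var_mult_eq[of v] mult_var_eq[of "series_var w" v] koszul_series_apply)
  next
    case False
    then show ?thesis
      by (auto simp: var_mult_eq[of v] mult_var_eq[of "series_var w" v] koszul_series_apply)
         (auto simp: series_var_def)
  qed
qed

lemma mult_comm_homogeneous:
  fixes F G :: "('i, 'k::field_char_0) series"
  assumes "homogeneous deg m F" "homogeneous deg n G"
  shows "F \<odot> G = koszul m n (G \<odot> F)"
proof (intro ext)
  fix L a
  have "(F \<odot> G) L a = (\<Sum>(y, x)\<in>splits (L, a). mono_sgn (fst x) (fst y) * case_prod F x * case_prod G y)"
    unfolding mult_splits
    by (rule sum.reindex_bij_witness[of _ prod.swap prod.swap]) (auto simp: splits_def add.commute)
  also have "\<dots> = (\<Sum>(y, x)\<in>splits (L, a). (if odd m \<and> odd n then - 1 else 1) *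
                 (mono_sgn (fst y) (fst x) * case_prod G y * case_prod F x))"
  proof (intro sum.cong[OF refl], clarify)
    fix M b N c
    show "mono_sgn (fst (N, c)) (fst (M, b)) * F N c * G M b =
      (if odd m \<and> odd n then - 1 else 1) * (mono_sgn (fst (M, b)) (fst (N, c)) * G M b * F N c)"
    proof (cases "F N c * G M b = 0")
      case False
      \<comment> \<open>The degree of \<hbar> is even, so the number of odd variables in a monomial
        has the parity of the total degree.\<close>
      with assms have "odd (odd_size N) \<longleftrightarrow> odd m" "odd (odd_size M) \<longleftrightarrow> odd n"
        unfolding homogeneous_def odd_size_mono_deg by (metis dvd_triv_left even_add mult_eq_0_iff)+
      then have "(mono_sgn N M :: 'k) = (if odd m \<and> odd n then - 1 else 1) * mono_sgn M N"
        by (subst mono_sign_swap) (auto simp: minus_one_power_iff)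
      then show ?thesis by (simp add: mult_ac)
    qed auto
  qed
  also have "\<dots> = koszul m n (G \<odot> F) L a"
    by (simp add: mult_splits koszul_series_apply sum_negf case_prod_beta)
  finally show "(F \<odot> G) L a = koszul m n (G \<odot> F) L a" .
qed

lemma hbar_mult_mult: "hbar_mult F \<odot> G = hbar_mult (F \<odot> G)"
proof (intro ext)
  fix L a show "(hbar_mult F \<odot> G) L a = hbar_mult (F \<odot> G) L a"
    by (cases a) (simp_all add: series_mult_def sum.atMost_Suc_shift del: sum.atMost_Suc)
qed

lemma mult_hbar_mult: "F \<odot> hbar_mult G = hbar_mult (F \<odot> G)"
proof (intro ext)
  fix L a show "(F \<odot> hbar_mult G) L a = hbar_mult (F \<odot> G) L a"
    by (cases a) (auto simp: series_mult_def Suc_diff_le intro!: sum.cong)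
qed

section \<open>Partial derivatives and multiplication by a variable\<close>

lemma left_deriv_linear:
  "left_deriv deg v (F + G) = left_deriv deg v F + left_deriv deg v G"
  "left_deriv deg v (- F) = - left_deriv deg v F"
  "left_deriv deg v (series_scale c F) = series_scale c (left_deriv deg v F)"
  "left_deriv deg v 0 = 0"
  "left_deriv deg v (hbar_mult F) = hbar_mult (left_deriv deg v F)"
  "left_deriv deg v (koszul m n F) = koszul m n (left_deriv deg v F)"
  by (auto simp: left_deriv_def series_scale_def fun_eq_iff algebra_simps koszul_series_apply hbar_mult_def split: nat.split)

lemma right_deriv_linear:
  "right_deriv deg v (F + G) = right_deriv deg v F + right_deriv deg v G"
  "right_deriv deg v (- F) = - right_deriv deg v F"
  "right_deriv deg v (series_scale c F) = series_scale c (right_deriv deg v F)"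
  "right_deriv deg v 0 = 0"
  "right_deriv deg v (hbar_mult F) = hbar_mult (right_deriv deg v F)"
  "right_deriv deg v (koszul m n F) = koszul m n (right_deriv deg v F)"
  by (auto simp: right_deriv_def series_scale_def fun_eq_iff algebra_simps koszul_series_apply hbar_mult_def split: nat.split)

lemma inversions_singletons:
  "v \<noteq> w \<Longrightarrow> inversions {#v#} {#w#} + inversions {#w#} {#v#} = of_bool (odd_var v \<and> odd_var w)"
  using precedes_swap[of v w] by (auto simp: inversions_def split: if_splits)

lemma admissible_add_mset2:
  "v \<noteq> w \<Longrightarrow> admissible deg (add_mset v (add_mset w M)) \<longleftrightarrow>
     admissible deg (add_mset v M) \<and> admissible deg (add_mset w M)"
  by (auto simp: admissible_add_mset)

text \<open>The inversions with \<open>M\<close> agree on both sides. What remains is the position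
  of \<open>v\<close> relative to \<open>w\<close>, seen once in each order; this contributes one
  inversion precisely when both are odd.\<close>

lemma mono_sign_left_left:
  assumes "v \<noteq> w"
  shows "mono_sgn {#v#} (add_mset w M) * mono_sgn {#w#} (add_mset v M) =
    (if odd_var v \<and> odd_var w then - 1 else 1) * (mono_sgn {#w#} M * mono_sgn {#v#} M)"
proof -
  have "inversions {#v#} (add_mset w M) + inversions {#w#} (add_mset v M) =
     of_bool (odd_var v \<and> odd_var w) + (inversions {#w#} M + inversions {#v#} M)"
    using inversions_singletons[OF assms]
    by (simp add: inversions_add_mset(2)[of _ w M] inversions_add_mset(2)[of _ v M])
  then show ?thesis using admissible_add_mset2[OF assms, of M]
    by (auto simp: mono_sign_inversions add_mset_commute simp flip: power_add)
qed

lemma mono_sign_right_right: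
  assumes "v \<noteq> w"
  shows "mono_sgn (add_mset w M) {#v#} * mono_sgn (add_mset v M) {#w#} =
    (if odd_var v \<and> odd_var w then - 1 else 1) * (mono_sgn M {#w#} * mono_sgn M {#v#})"
proof -
  have "inversions (add_mset w M) {#v#} + inversions (add_mset v M) {#w#} =
     of_bool (odd_var v \<and> odd_var w) + (inversions M {#w#} + inversions M {#v#})"
    using inversions_singletons[OF assms]
    by (simp add: inversions_add_mset(1)[of w M] inversions_add_mset(1)[of v M])
  then show ?thesis using admissible_add_mset2[OF assms, of M]
    by (auto simp: mono_sign_inversions add_mset_commute simp flip: power_add)
qed

text \<open>The inversion between \<open>v\<close> and \<open>w\<close> is counted twice and cancels
  modulo 2: operations at opposite ends of a monomial do not cross. Hence left derivatives commute
  without sign with right multiplication, and right derivatives with left multiplication.\<close>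

lemma mono_sign_left_right:
  assumes "v \<noteq> w"
  shows "mono_sgn {#v#} (add_mset w M) * mono_sgn (add_mset v M) {#w#} =
    mono_sgn M {#w#} * mono_sgn {#v#} M"
proof -
  have "even (inversions {#v#} (add_mset w M) + inversions (add_mset v M) {#w#}) \<longleftrightarrow>
     even (inversions M {#w#} + inversions {#v#} M)"
    by (simp add: inversions_add_mset(2)[of _ w M] inversions_add_mset(1)[of v M]) blast
  then show ?thesis using admissible_add_mset2[OF assms, of M]
    by (auto simp: mono_sign_inversions add_mset_commute minus_one_power_iff)
qed

text \<open>For even \<open>v\<close> this is \<open>count + 1 = 1 + count\<close>. For odd
  \<open>v\<close> the multiplicity is 0 or 1: if \<open>v\<close> is absent, only the term
  \<open>F\<close> remains; if it is present, the left side vanishes and the two terms on the right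
  cancel.\<close>

lemma left_deriv_var_mult_same:
  assumes "admissible_series F"
  shows "left_deriv deg v (series_var v \<odot> F) =
     F + koszul (var_deg deg v) (var_deg deg v) (series_var v \<odot> left_deriv deg v F)"
proof (intro ext)
  fix M a
  have "(left_deriv deg v (series_var v \<odot> F)) M a
      = of_nat (count M v + 1) * (mono_sgn {#v#} M * mono_sgn {#v#} M) * F M a"
    by (simp add: left_deriv_def var_mult_eq)
  also have "\<dots> = of_nat (count M v + 1) * of_bool (admissible deg (add_mset v M)) * F M a"
    by (simp add: mono_sign_square)
  also have "\<dots> = (F + koszul (var_deg deg v) (var_deg deg v) (series_var v \<odot> left_deriv deg v F)) M a"
  proof (cases "F M a = 0")
    case True
    then show ?thesis by (auto simp: koszul_series_apply var_mult_eq left_deriv_def)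
  next
    case False
    then have adm: "admissible deg M" using assms unfolding admissible_series_iff by blast
    show ?thesis
    proof (cases "v \<in># M")
      case True
      then obtain N where N: "M = add_mset v N" by (metis multi_member_split)
      have "(series_var v \<odot> left_deriv deg v F) M a
          = of_nat (count M v) * (mono_sgn {#v#} N * mono_sgn {#v#} N) * F M a"
        by (simp add: N var_mult_eq left_deriv_def)
      also have "\<dots> = of_nat (count M v) * F M a"
        using adm by (simp add: mono_sign_square N)
      finally have "(series_var v \<odot> left_deriv deg v F) M a = of_nat (count M v) * F M a" .
      moreover have "count M v = 1" if "odd_var v"
        using adm that N by (auto simp: admissible_add_mset not_in_iff)
      ultimately show ?thesis using adm True
        by (auto simp: koszul_series_apply algebra_simps admissible_add_mset)
    next
      case False
      moreover from this have "count M v = 0" by (simp add: not_in_iff)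
      ultimately show ?thesis using adm by (auto simp: koszul_series_apply var_mult_eq admissible_add_mset)
    qed
  qed
  finally show "left_deriv deg v (series_var v \<odot> F) M a =
    (F + koszul (var_deg deg v) (var_deg deg v) (series_var v \<odot> left_deriv deg v F)) M a" .
qed

lemma right_deriv_mult_var_same:
  assumes "admissible_series F"
  shows "right_deriv deg v (F \<odot> series_var v) =
     F + koszul (var_deg deg v) (var_deg deg v) (right_deriv deg v F \<odot> series_var v)"
proof (intro ext)
  fix M a
  have "(right_deriv deg v (F \<odot> series_var v)) M a
      = of_nat (count M v + 1) * (mono_sgn M {#v#} * mono_sgn M {#v#}) * F M a"
    by (simp add: right_deriv_def mult_var_eq)
  also have "\<dots> = of_nat (count M v + 1) * of_bool (admissible deg (add_mset v M)) * F M a"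
    by (simp add: mono_sign_square)
  also have "\<dots> = (F + koszul (var_deg deg v) (var_deg deg v) (right_deriv deg v F \<odot> series_var v)) M a"
  proof (cases "F M a = 0")
    case True
    then show ?thesis by (auto simp: koszul_series_apply mult_var_eq right_deriv_def)
  next
    case False
    then have adm: "admissible deg M" using assms unfolding admissible_series_iff by blast
    show ?thesis
    proof (cases "v \<in># M")
      case True
      then obtain N where N: "M = add_mset v N" by (metis multi_member_split)
      have "(right_deriv deg v F \<odot> series_var v) M a
          = of_nat (count M v) * (mono_sgn N {#v#} * mono_sgn N {#v#}) * F M a"
        by (simp add: N mult_var_eq right_deriv_def)
      also have "\<dots> = of_nat (count M v) * F M a"
        using adm by (simp add: mono_sign_square N)
      finally have "(right_deriv deg v F \<odot> series_var v) M a = of_nat (count M v) * F M a" .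
      moreover have "count M v = 1" if "odd_var v"
        using adm that N by (auto simp: admissible_add_mset not_in_iff)
      ultimately show ?thesis using adm True
        by (auto simp: koszul_series_apply algebra_simps admissible_add_mset)
    next
      case False
      moreover from this have "count M v = 0" by (simp add: not_in_iff)
      ultimately show ?thesis using adm by (auto simp: koszul_series_apply mult_var_eq admissible_add_mset)
    qed
  qed
  finally show "right_deriv deg v (F \<odot> series_var v) M a =
    (F + koszul (var_deg deg v) (var_deg deg v) (right_deriv deg v F \<odot> series_var v)) M a" .
qed

lemma left_deriv_var_mult_other:
  assumes "v \<noteq> w"
  shows "left_deriv deg v (series_var w \<odot> F) =
     koszul (var_deg deg v) (var_deg deg w) (series_var w \<odot> left_deriv deg v F)"
proof (intro ext)
  fix M a
  show "left_deriv deg v (series_var w \<odot> F) M a =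
     koszul (var_deg deg v) (var_deg deg w) (series_var w \<odot> left_deriv deg v F) M a"
  proof (cases "w \<in># M")
    case True
    then obtain N where N: "M = add_mset w N" by (metis multi_member_split)
    have "left_deriv deg v (series_var w \<odot> F) M a = of_nat (count N v + 1) *
        (mono_sgn {#v#} (add_mset w N) * mono_sgn {#w#} (add_mset v N)) * F (add_mset v N) a"
      using assms by (simp add: N left_deriv_def var_mult_eq add_mset_commute[of v w])
    moreover have "koszul (var_deg deg v) (var_deg deg w) (series_var w \<odot> left_deriv deg v F) M a = of_nat (count N v + 1) * ((if odd_var v \<and> odd_var w then - 1 else 1) * (mono_sgn {#w#} N * mono_sgn {#v#} N)) * F (add_mset v N) a"
      using assms by (simp add: N left_deriv_def var_mult_eq koszul_series_apply algebra_simps)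
    ultimately show ?thesis unfolding mono_sign_left_left[OF assms] by (rule trans[OF _ sym])
  qed (use assms in \<open>simp add: koszul_series_apply left_deriv_def var_mult_eq\<close>)
qed

lemma right_deriv_mult_var_other:
  assumes "v \<noteq> w"
  shows "right_deriv deg v (F \<odot> series_var w) =
     koszul (var_deg deg v) (var_deg deg w) (right_deriv deg v F \<odot> series_var w)"
proof (intro ext)
  fix M a
  show "right_deriv deg v (F \<odot> series_var w) M a =
     koszul (var_deg deg v) (var_deg deg w) (right_deriv deg v F \<odot> series_var w) M a"
  proof (cases "w \<in># M")
    case True
    then obtain N where N: "M = add_mset w N" by (metis multi_member_split)
    have "right_deriv deg v (F \<odot> series_var w) M a = of_nat (count N v + 1) *
        (mono_sgn (add_mset w N) {#v#} * mono_sgn (add_mset v N) {#w#}) * F (add_mset v N) a"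
      using assms by (simp add: N right_deriv_def mult_var_eq add_mset_commute[of v w])
    moreover have "koszul (var_deg deg v) (var_deg deg w) (right_deriv deg v F \<odot> series_var w) M a = of_nat (count N v + 1) * ((if odd_var v \<and> odd_var w then - 1 else 1) * (mono_sgn N {#w#} * mono_sgn N {#v#})) * F (add_mset v N) a"
      using assms by (simp add: N right_deriv_def mult_var_eq koszul_series_apply algebra_simps)
    ultimately show ?thesis unfolding mono_sign_right_right[OF assms] by (rule trans[OF _ sym])
  qed (use assms in \<open>simp add: koszul_series_apply right_deriv_def mult_var_eq\<close>)
qed

lemma left_deriv_mult_var:
  assumes "v \<noteq> w"
  shows "left_deriv deg v (F \<odot> series_var w) = left_deriv deg v F \<odot> series_var w"
proof (intro ext)
  fix M a
  show "left_deriv deg v (F \<odot> series_var w) M a = (left_deriv deg v F \<odot> series_var w) M a"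
  proof (cases "w \<in># M")
    case True
    then obtain N where N: "M = add_mset w N" by (metis multi_member_split)
    have "left_deriv deg v (F \<odot> series_var w) M a = of_nat (count N v + 1) *
        (mono_sgn {#v#} (add_mset w N) * mono_sgn (add_mset v N) {#w#}) * F (add_mset v N) a"
      using assms by (simp add: N left_deriv_def mult_var_eq add_mset_commute[of v w])
    moreover have "(left_deriv deg v F \<odot> series_var w) M a = of_nat (count N v + 1) * (mono_sgn N {#w#} * mono_sgn {#v#} N) * F (add_mset v N) a"
      using assms by (simp add: N left_deriv_def mult_var_eq algebra_simps)
    ultimately show ?thesis unfolding mono_sign_left_right[OF assms] by (rule trans[OF _ sym])
  qed (use assms in \<open>simp add: left_deriv_def mult_var_eq\<close>)
qed

lemma right_deriv_var_mult:
  assumes "v \<noteq> w"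
  shows "right_deriv deg v (series_var w \<odot> F) = series_var w \<odot> right_deriv deg v F"
proof (intro ext)
  fix M a
  show "right_deriv deg v (series_var w \<odot> F) M a = (series_var w \<odot> right_deriv deg v F) M a"
  proof (cases "w \<in># M")
    case True
    then obtain N where N: "M = add_mset w N" by (metis multi_member_split)
    have "right_deriv deg v (series_var w \<odot> F) M a = of_nat (count N v + 1) *
        (mono_sgn {#w#} (add_mset v N) * mono_sgn (add_mset w N) {#v#}) * F (add_mset v N) a"
      using assms by (simp add: N right_deriv_def var_mult_eq add_mset_commute[of v w])
    moreover have "(series_var w \<odot> right_deriv deg v F) M a = of_nat (count N v + 1) * (mono_sgn N {#v#} * mono_sgn {#w#} N) * F (add_mset v N) a"
      using assms by (simp add: N right_deriv_def var_mult_eq algebra_simps)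
    ultimately show ?thesis unfolding mono_sign_left_right[OF assms[symmetric]] by (rule trans[OF _ sym])
  qed (use assms in \<open>simp add: right_deriv_def var_mult_eq\<close>)
qed

lemma left_deriv_var_mult:
  "admissible_series F \<Longrightarrow> left_deriv deg v (series_var w \<odot> F) =
     (if v = w then F else 0) + koszul (var_deg deg v) (var_deg deg w) (series_var w \<odot> left_deriv deg v F)"
  by (simp add: left_deriv_var_mult_same left_deriv_var_mult_other)

lemma right_deriv_mult_var:
  "admissible_series F \<Longrightarrow> right_deriv deg v (F \<odot> series_var w) =
     (if v = w then F else 0) + koszul (var_deg deg v) (var_deg deg w) (right_deriv deg v F \<odot> series_var w)"
  by (simp add: right_deriv_mult_var_same right_deriv_mult_var_other)

lemma deriv_one [simp]: "left_deriv deg v series_one = 0" "right_deriv deg v series_one = 0"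
  by (auto simp: left_deriv_def right_deriv_def series_one_def fun_eq_iff)

end

context graded_variables
begin

lemma mult_nonzero:
  assumes "(F \<odot> G) L a \<noteq> 0"
  obtains M N b c where "L = M + N" "a = b + c" "admissible deg L" "F M b \<noteq> 0" "G N c \<noteq> 0"
proof -
  obtain p where p: "p \<in> splits (L, a)"
    "(case p of (x, y) \<Rightarrow> mono_sgn (fst x) (fst y) * case_prod F x * case_prod G y) \<noteq> 0"
    using assms unfolding mult_splits by (meson sum.not_neutral_contains_not_neutral)
  obtain M b N c where "p = ((M, b), (N, c))" by (metis surj_pair)
  with p that[of M N b c] show ?thesis by (auto simp: splits_def mono_sign_inversions split: if_splits)
qed

section \<open>Stability of the supports under the operations\<close>

lemma power_series_zero: "power_series J deg 0"
  and power_series_one: "power_series J deg series_one"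
  by (auto simp: power_series_def series_one_def split: if_splits)

lemma power_seriesI:
  assumes "power_series J deg F" "\<And>M a. G M a \<noteq> 0 \<Longrightarrow> \<exists>b. F M b \<noteq> 0"
  shows "power_series J deg G"
  using assms unfolding power_series_def by metis

lemma power_series_uminus: "power_series J deg F \<Longrightarrow> power_series J deg (- F)"
  and power_series_scale: "power_series J deg F \<Longrightarrow> power_series J deg (series_scale c F)"
  and power_series_koszul: "power_series J deg F \<Longrightarrow> power_series J deg (koszul m n F)"
  and power_series_eta_zero: "power_series J deg F \<Longrightarrow> power_series J deg (eta_zero F)"
  by (erule power_seriesI; auto simp: series_scale_def koszul_series_apply eta_zero_def split: if_splits)+

lemma power_series_hbar_mult: "power_series J deg F \<Longrightarrow> power_series J deg (hbar_mult F)"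
  by (erule power_seriesI) (auto simp: hbar_mult_def split: nat.splits)

lemma power_series_add:
  assumes "power_series J deg F" "power_series J deg G"
  shows "power_series J deg (F + G)"
proof -
  have "F M a \<noteq> 0 \<or> G M a \<noteq> 0" if "(F + G) M a \<noteq> 0" for M a using that by auto
  with assms show ?thesis unfolding power_series_def by blast
qed

lemma power_series_sum: "(\<And>x. x \<in> X \<Longrightarrow> power_series J deg (f x)) \<Longrightarrow> power_series J deg (\<Sum>x\<in>X. f x)"
  by (induction X rule: infinite_finite_induct) (auto simp: power_series_zero power_series_add simp del: plus_fun_apply zero_fun_apply)

lemma power_series_mult: "power_series J deg F \<Longrightarrow> power_series J deg G \<Longrightarrow> power_series J deg (F \<odot> G)"
  unfolding power_series_def by (metis Un_subset_iff mult_nonzero set_mset_union)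

lemma admissible_series_var: "admissible_series (series_var v)"
  by (simp add: admissible_series_iff series_var_def)

lemma power_series_mono: "power_series J deg F \<Longrightarrow> J \<subseteq> K \<Longrightarrow> power_series K deg F"
  unfolding power_series_def by blast

lemma power_series_admissible: "power_series J deg F \<Longrightarrow> admissible_series F"
  by (rule power_series_mono) simp_all

lemma power_series_left_deriv: "power_series J deg F \<Longrightarrow> power_series J deg (left_deriv deg v F)"
  unfolding power_series_def left_deriv_def
  by (metis admissible_add_mset insert_subset mult_eq_0_iff set_mset_add_mset_insert)

lemma power_series_right_deriv: "power_series J deg F \<Longrightarrow> power_series J deg (right_deriv deg v F)"
  unfolding power_series_def right_deriv_def
  by (metis admissible_add_mset insert_subset mult_eq_0_iff set_mset_add_mset_insert)

lemmas power_series_intros = power_series_zero power_series_one power_series_add power_series_uminus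
  power_series_scale power_series_koszul power_series_eta_zero power_series_hbar_mult
  power_series_mult admissible_series_var power_series_left_deriv power_series_right_deriv

lemma mult_one: "admissible_series F \<Longrightarrow> F \<odot> series_one = F"
proof (intro ext)
  fix L a assume F: "admissible_series F"
  have "(F \<odot> series_one) L a = (\<Sum>(x, y)\<in>splits (L, a). mono_sgn (fst x) (fst y) * case_prod F x * case_prod series_one y)"
    by (rule mult_splits)
  also have "\<dots> = (\<Sum>(x, y)\<in>{((L, a), ({#}, 0))}. mono_sgn (fst x) (fst y) * case_prod F x * case_prod series_one y)"
    by (rule sum.mono_neutral_right[OF finite_splits]) (auto simp: splits_def series_one_def zero_prod_def split: if_splits)
  also have "\<dots> = F L a" using F by (auto simp: series_one_def admissible_series_iff)
  finally show "(F \<odot> series_one) L a = F L a" .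
qed

text \<open>For \<open>v = w\<close> odd, both sides vanish since a monomial that contains
  \<open>v\<close> twice is inadmissible. Otherwise only the mutual inversion of \<open>v\<close>
  and \<open>w\<close> depends on the order.\<close>

lemma left_deriv_swap:
  fixes F :: "('i, 'k::field_char_0) series"
  shows "left_deriv deg v (left_deriv deg w F) =
     koszul (var_deg deg v) (var_deg deg w) (left_deriv deg w (left_deriv deg v F))"
proof (cases "v = w")
  case True
  have "left_deriv deg v (left_deriv deg v F) = 0" if "odd_var v"
    using that by (intro ext) (simp add: left_deriv_def mono_sign_inversions admissible_add_mset)
  with True show ?thesis by (simp add: koszul_def)
next
  case False
  show ?thesis
  proof (intro ext)
    fix M a
    have "even (inversions {#v#} M + inversions {#w#} (add_mset v M)) =
        (even (inversions {#w#} M + inversions {#v#} (add_mset w M)) \<longleftrightarrow> \<not> (odd_var v \<and> odd_var w))"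
    proof -
      have "even (x + (q + y)) = (even (y + (p + x)) \<longleftrightarrow> \<not> P)" if "p + q = of_bool P" for x y p q :: nat and P
        using that by (cases P; simp only: of_bool_eq(1,2); presburger)
      from this[OF inversions_singletons[OF False]] show ?thesis
        unfolding inversions_add_mset(2)[of _ w M] inversions_add_mset(2)[of _ v M] .
    qed
    then have "mono_sgn {#v#} M * mono_sgn {#w#} (add_mset v M) =
      (if odd_var v \<and> odd_var w then - 1 else 1) * (mono_sgn {#w#} M * mono_sgn {#v#} (add_mset w M) :: 'k)"
      using admissible_add_mset2[OF False, of M]
      by (auto simp: mono_sign_inversions add_mset_commute minus_one_power_iff)
    from arg_cong[OF this, of "\<lambda>z. of_nat (count M v + 1) * of_nat (count M w + 1) * z * F (add_mset v (add_mset w M)) a"]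
    show "left_deriv deg v (left_deriv deg w F) M a =
       koszul (var_deg deg v) (var_deg deg w) (left_deriv deg w (left_deriv deg v F)) M a"
      using False
      by (auto simp: left_deriv_def koszul_series_apply add_mset_commute algebra_simps)
  qed
qed

section \<open>The star product\<close>

text \<open>The summand of the star product for \<open>k\<close> contracted pairs, without
  \<open>1 / fact k\<close>, and with indices from a set \<open>J\<close> that will be finite. One
  pair is contracted at a time, which suits induction on \<open>k\<close> with both factors
  arbitrary.\<close>

primrec contraction ::
  "'i set \<Rightarrow> nat \<Rightarrow> ('i, 'k::field_char_0) series \<Rightarrow> ('i, 'k) series \<Rightarrow> ('i, 'k) series" where
  "contraction J 0 F G = F \<odot> G"
| "contraction J (Suc k) F G =
     (\<Sum>i\<in>J. contraction J k (right_deriv deg (Eta i) F) (left_deriv deg (Psi i) G))"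

lemma contraction_linear_left:
  "contraction J k (F + F') G = contraction J k F G + contraction J k F' G"
  "contraction J k 0 G = 0"
  "contraction J k (series_scale c F) G = series_scale c (contraction J k F G)"
  "contraction J k (koszul m n F) G = koszul m n (contraction J k F G)"
  "contraction J k (hbar_mult F) G = hbar_mult (contraction J k F G)"
  by (induction k arbitrary: F F' G)
     (simp_all add: right_deriv_linear sum.distrib series_scale_sum koszul_sum mult_koszul
        hbar_mult_sum hbar_mult_mult del: plus_fun_apply zero_fun_apply)

lemma contraction_linear_right:
  "contraction J k F (G + G') = contraction J k F G + contraction J k F G'"
  "contraction J k F 0 = 0"
  "contraction J k F (series_scale c G) = series_scale c (contraction J k F G)"
  "contraction J k F (koszul m n G) = koszul m n (contraction J k F G)"
  "contraction J k F (hbar_mult G) = hbar_mult (contraction J k F G)"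
  by (induction k arbitrary: F G G')
     (simp_all add: left_deriv_linear sum.distrib series_scale_sum koszul_sum mult_koszul
        hbar_mult_sum mult_hbar_mult del: plus_fun_apply zero_fun_apply)

text \<open>The first factor is differentiated only from the right and only along \<eta>, so a
  \<psi> at its left end is never touched.\<close>

lemma contraction_psi:
  "contraction J k (series_var (Psi i) \<odot> F) G = series_var (Psi i) \<odot> contraction J k F G"
  by (induction k arbitrary: F G) (simp_all add: mult_assoc right_deriv_var_mult mult_sum)

text \<open>The degrees of \<psi> and \<eta> with the same index add up to 2, so they have the same
  parity.\<close>

lemma koszul_var_deg:
  "koszul (var_deg deg (Eta i)) n x = koszul (var_deg deg (Psi i)) n x"
  "koszul m (var_deg deg (Eta i)) x = koszul m (var_deg deg (Psi i)) x"
  by (simp_all add: koszul_def)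

text \<open>Either the new \<eta> is not contracted, and then it may as well stand at the left end
  of the second factor, or it is contracted in one of the \<open>Suc k\<close> rounds. All rounds
  contribute the same, as derivatives commute up to Koszul signs; this is the origin of the factor
  \<open>Suc k\<close>.\<close>

lemma contraction_eta:
  fixes F G :: "('i, 'k::field_char_0) series"
  assumes "finite J" "j \<in> J" "admissible_series F"
  shows "contraction J (Suc k) (F \<odot> series_var (Eta j)) G =
    contraction J (Suc k) F (series_var (Eta j) \<odot> G) +
    series_scale (of_nat (Suc k)) (contraction J k F (left_deriv deg (Psi j) G))"
  using assms(3)
proof (induction k arbitrary: F G)
  case 0
  let ?kz = "\<lambda>i. koszul (var_deg deg (Psi i)) (var_deg deg (Psi j)) :: ('i,'k) series \<Rightarrow> _"
  have "contraction J (Suc 0) (F \<odot> series_var (Eta j)) G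
     = (\<Sum>i\<in>J. (if i = j then F \<odot> left_deriv deg (Psi j) G else 0) + ?kz i
          (right_deriv deg (Eta i) F \<odot> (series_var (Eta j) \<odot> left_deriv deg (Psi i) G)))"
    using 0 by (auto intro!: sum.cong simp: right_deriv_mult_var koszul_var_deg mult_koszul mult_assoc simp del: var_deg.simps)
  also have "\<dots> = F \<odot> left_deriv deg (Psi j) G + contraction J (Suc 0) F (series_var (Eta j) \<odot> G)"
    using assms by (simp add: sum.distrib left_deriv_var_mult_other koszul_var_deg mult_koszul del: var_deg.simps plus_fun_apply zero_fun_apply)
  finally show ?case by (simp add: add.commute del: contraction.simps(2) plus_fun_apply)
next
  case (Suc k)
  let ?kz = "\<lambda>i. koszul (var_deg deg (Psi i)) (var_deg deg (Psi j)) :: ('i,'k) series \<Rightarrow> _"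
  let ?d = "\<lambda>i. left_deriv deg (Psi i)"
  let ?F = "\<lambda>i. right_deriv deg (Eta i) F"
  have "contraction J (Suc (Suc k)) (F \<odot> series_var (Eta j)) G
     = (\<Sum>i\<in>J. (if i = j then contraction J (Suc k) F (?d j G) else 0) +
          ?kz i (contraction J (Suc k) (?F i \<odot> series_var (Eta j)) (?d i G)))"
    unfolding contraction.simps(2)[of J "Suc k"]
    using Suc.prems by (auto intro!: sum.cong simp: right_deriv_mult_var koszul_var_deg contraction_linear_left
        simp del: var_deg.simps contraction.simps plus_fun_apply zero_fun_apply)
  also have "\<dots> = contraction J (Suc k) F (?d j G) + (\<Sum>i\<in>J. ?kz i (contraction J (Suc k) (?F i \<odot> series_var (Eta j)) (?d i G)))"
    using assms by (simp add: sum.distrib del: var_deg.simps contraction.simps plus_fun_apply zero_fun_apply)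
  also have "(\<Sum>i\<in>J. ?kz i (contraction J (Suc k) (?F i \<odot> series_var (Eta j)) (?d i G))) =
     (\<Sum>i\<in>J. contraction J (Suc k) (?F i) (?kz i (series_var (Eta j) \<odot> ?d i G)) +
       series_scale (of_nat (Suc k)) (contraction J k (?F i) (?kz i (?d j (?d i G)))))"
    using Suc.prems by (intro sum.cong refl) (subst Suc.IH, auto intro: power_series_intros simp: koszul_linear
        contraction_linear_right koszul_series_scale simp del: var_deg.simps contraction.simps plus_fun_apply zero_fun_apply)
  \<comment> \<open>Moving the derivative along \<open>Psi i\<close> past \<open>Eta j\<close> costs
    the same sign as exchanging it with the derivative along \<open>Psi j\<close>. Both equal
    \<open>?kz i\<close>, the sign left by the right derivative, so all signs are absorbed.\<close>
  also have "\<dots> = (\<Sum>i\<in>J. contraction J (Suc k) (?F i) (?d i (series_var (Eta j) \<odot> G))) +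
       series_scale (of_nat (Suc k)) (\<Sum>i\<in>J. contraction J k (?F i) (?d i (?d j G)))"
    unfolding sum.distrib series_scale_sum
    by (simp only: left_deriv_var_mult_other[of "Psi _" "Eta j"] var.distinct not_False_eq_True koszul_var_deg
       left_deriv_swap[of "Psi _" "Psi j"] koszul_swap[of "var_deg deg (Psi j)"])
  also have "\<dots> = contraction J (Suc (Suc k)) F (series_var (Eta j) \<odot> G) +
      series_scale (of_nat (Suc k)) (contraction J (Suc k) F (?d j G))"
    by simp
  finally show ?case
    by (auto simp: fun_eq_iff series_scale_def algebra_simps simp del: contraction.simps)
qed

lemma contraction_one: "contraction J (Suc k) series_one G = 0"
  by (simp add: contraction_linear_left)

lemma power_series_contraction:
  "power_series K deg F \<Longrightarrow> power_series K deg G \<Longrightarrow> power_series K deg (contraction J k F G)"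
  by (induction k arbitrary: F G) (auto intro!: power_series_intros power_series_sum)

text \<open>Apart from the restriction of the indices to \<open>J\<close> this is
  \<open>hbar_times_star\<close>; for finite \<open>J\<close> no formal sums are involved.\<close>

definition star ::
  "'i set \<Rightarrow> ('i, 'k::field_char_0) series \<Rightarrow> ('i, 'k) series \<Rightarrow> ('i, 'k) series" where
  "star J F G = (\<lambda>M a. \<Sum>k\<le>a. 1 / fact k * contraction J k F G M (a - k))"

lemma star_linear:
  "star J (F + F') G = star J F G + star J F' G"
  "star J (series_scale c F) G = series_scale c (star J F G)"
  "star J (koszul m n F) G = koszul m n (star J F G)"
  "star J F (G + G') = star J F G + star J F G'"
  "star J F (series_scale c G) = series_scale c (star J F G)"
  "star J F (koszul m n G) = koszul m n (star J F G)"
  unfolding star_def contraction_linear_left contraction_linear_right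
  by (auto simp: fun_eq_iff series_scale_def koszul_series_apply sum.distrib sum_distrib_left sum_negf algebra_simps add_divide_distrib)

lemma star_zero: "star J 0 G = 0" "star J F 0 = 0"
  by (auto simp: star_def fun_eq_iff contraction_linear_left contraction_linear_right)

lemma star_hbar_mult:
  "star J (hbar_mult F) G = hbar_mult (star J F G)"
  "star J F (hbar_mult G) = hbar_mult (star J F G)"
proof -
  have *: "(\<Sum>k\<le>a. 1 / fact k * hbar_mult (C k) M (a - k)) = hbar_mult (\<lambda>M a. \<Sum>k\<le>a. 1 / fact k * C k M (a - k)) M a"
    for C :: "nat \<Rightarrow> ('i, 'k::field_char_0) series" and M a
    by (cases a) (auto simp: Suc_diff_le intro!: sum.cong)
  show "star J (hbar_mult F) G = hbar_mult (star J F G)" "star J F (hbar_mult G) = hbar_mult (star J F G)"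
    unfolding star_def contraction_linear_left contraction_linear_right by (intro ext *)+
qed

lemma star_psi: "star J (series_var (Psi i) \<odot> F) G = series_var (Psi i) \<odot> star J F G"
  by (simp add: star_def contraction_psi var_mult_eq fun_eq_iff sum_distrib_left mult_ac)

lemma star_eta:
  fixes F G :: "('i, 'k::field_char_0) series"
  assumes "finite J" "j \<in> J" "admissible_series F"
  shows "star J (F \<odot> series_var (Eta j)) G =
    star J F (series_var (Eta j) \<odot> G) + hbar_mult (star J F (left_deriv deg (Psi j) G))"
proof (intro ext)
  fix M a
  show "star J (F \<odot> series_var (Eta j)) G M a =
    (star J F (series_var (Eta j) \<odot> G) + hbar_mult (star J F (left_deriv deg (Psi j) G))) M a"
  proof (cases a)
    case 0
    then show ?thesis by (simp add: star_def mult_assoc)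
  next
    case (Suc b)
    \<comment> \<open>The factor \<open>k + 1\<close> from \<open>contraction_eta\<close> turns
      \<open>1 / (k + 1)!\<close> into \<open>1 / k!\<close>, and the lowered summation index is the
      factor \<hbar>.\<close>
    have *: "(1 + of_nat k) * c / ((1 + of_nat k) * fact k) = c / (fact k :: 'k)" for k c
      using of_nat_neq_0[of k, where 'a = 'k] by (simp del: of_nat_Suc add: of_nat_Suc[symmetric])
    have **: "1 + of_nat k \<noteq> (0 :: 'k)" for k using of_nat_neq_0[of k, where 'a = 'k] by simp
    show ?thesis
      unfolding Suc star_def
      by (simp add: sum.atMost_Suc_shift contraction_eta[OF assms] mult_assoc sum.distrib series_scale_def
         distrib_left add_divide_distrib * ** del: sum.atMost_Suc contraction.simps(2))
  qed
qed

lemma star_one: "admissible_series G \<Longrightarrow> star J series_one G = G"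
proof (intro ext)
  fix M a assume "admissible_series G"
  then show "star J series_one G M a = G M a"
    by (cases a) (simp_all add: star_def sum.atMost_Suc_shift contraction_one one_mult del: sum.atMost_Suc contraction.simps(2))
qed

lemma power_series_star:
  assumes "power_series K deg F" "power_series K deg G"
  shows "power_series K deg (star J F G)"
proof -
  have "\<exists>k b. contraction J k F G M b \<noteq> 0" if "star J F G M a \<noteq> 0" for M a
    using that unfolding star_def by (metis (no_types, lifting) mult_eq_0_iff sum.not_neutral_contains_not_neutral)
  then show ?thesis
    using power_series_contraction[OF assms, of J] unfolding power_series_def by metis
qed

end

context graded_variables
begin

section \<open>Power series acting on polynomials\<close>

text \<open>Polynomials built by the moves for which the star product has a rule: \<psi> multiplied
  from the left, \<eta> from the right. The two index sets are separate so that
  \<open>polys J {}\<close> consists of series without any \<eta>.\<close>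

inductive_set polys :: "'i set \<Rightarrow> 'i set \<Rightarrow> ('i, 'k::field_char_0) series set" for J K where
  polys_one: "series_one \<in> polys J K"
| polys_scale: "F \<in> polys J K \<Longrightarrow> series_scale c F \<in> polys J K"
| polys_add: "F \<in> polys J K \<Longrightarrow> G \<in> polys J K \<Longrightarrow> F + G \<in> polys J K"
| polys_hbar: "F \<in> polys J K \<Longrightarrow> hbar_mult F \<in> polys J K"
| polys_psi: "F \<in> polys J K \<Longrightarrow> i \<in> J \<Longrightarrow> series_var (Psi i) \<odot> F \<in> polys J K"
| polys_eta: "F \<in> polys J K \<Longrightarrow> j \<in> K \<Longrightarrow> F \<odot> series_var (Eta j) \<in> polys J K"

lemma polys_admissible: "F \<in> polys J K \<Longrightarrow> admissible_series F"
  by (induction rule: polys.induct) (auto intro: power_series_intros simp del: plus_fun_apply)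

lemma polys_zero: "0 \<in> polys J K"
  using polys_scale[OF polys_one, of 0] by (simp add: series_scale_linear del: zero_fun_apply)

lemma polys_koszul: "F \<in> polys J K \<Longrightarrow> koszul m n F \<in> polys J K"
  using polys_scale[of F J K "-1"] by (auto simp: koszul_def series_scale_def fun_Compl_def)

lemma polys_sum: "(\<And>x. x \<in> X \<Longrightarrow> f x \<in> polys J K) \<Longrightarrow> (\<Sum>x\<in>X. f x) \<in> polys J K"
  by (induction X rule: infinite_finite_induct)
     (auto intro: polys_zero polys_add simp del: plus_fun_apply zero_fun_apply)

lemma var_mult_one: "series_var v \<odot> series_one = series_one \<odot> series_var v"
  by (simp add: one_mult mult_one admissible_series_var)

lemma mult_var_left_commute: "series_var v \<odot> (series_var w \<odot> F) =
    koszul (var_deg deg v) (var_deg deg w) (series_var w \<odot> (series_var v \<odot> F))"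
  unfolding mult_assoc[symmetric] by (subst var_mult_var) (simp add: mult_koszul)

lemma polys_eta_mult: "F \<in> polys J K \<Longrightarrow> j \<in> K \<Longrightarrow> series_var (Eta j) \<odot> F \<in> polys J K"
proof (induction rule: polys.induct)
  case (polys_psi F i)
  then show ?case by (subst mult_var_left_commute) (auto intro: polys_koszul polys.intros)
qed (auto simp: var_mult_one hbar_mult_mult mult_hbar_mult simp flip: mult_assoc intro: polys.intros
      simp del: plus_fun_apply)

lemma polys_left_deriv_psi:
  "F \<in> polys J K \<Longrightarrow> left_deriv deg (Psi j) F \<in> polys J K"
proof (induction rule: polys.induct)
  case (polys_psi F i)
  then show ?case
    by (auto simp: left_deriv_var_mult polys_admissible intro!: polys_add polys_koszul polys.polys_psi
          simp del: plus_fun_apply zero_fun_apply intro: polys_zero)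
qed (auto simp: left_deriv_linear left_deriv_mult_var polys_zero intro: polys.intros
      simp del: plus_fun_apply zero_fun_apply)

definition monomial :: "'i var multiset \<Rightarrow> nat \<Rightarrow> ('i, 'k::field_char_0) series" where
  "monomial M b = (\<lambda>N a. if N = M \<and> a = b then 1 else 0)"

lemma monomial_in_polys:
  "admissible deg M \<Longrightarrow> set_mset M \<subseteq> Psi ` J \<union> Eta ` K \<Longrightarrow>
    (monomial M 0 :: ('i, 'k::field_char_0) series) \<in> polys J K"
proof (induction "size M" arbitrary: M)
  case 0
  then have "monomial M 0 = series_one" by (auto simp: monomial_def series_one_def fun_eq_iff)
  then show ?case by (metis polys_one)
next
  case (Suc n)
  then obtain v N where M: "M = add_mset v N" by (metis size_eq_Suc_imp_eq_union)
  have N: "(monomial N 0 :: ('i, 'k) series) \<in> polys J K"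
    using Suc.prems Suc.hyps(2) M by (intro Suc.hyps(1)) (auto simp: admissible_add_mset)
  \<comment> \<open>A sign is its own inverse, so the monomial is a scalar multiple of the smaller
    monomial times \<open>v\<close>, with \<open>v\<close> put on the side that its kind
    requires.\<close>
  have sgn: "mono_sgn {#v#} N * mono_sgn {#v#} N = (1::'k)" "mono_sgn N {#v#} * mono_sgn N {#v#} = (1::'k)"
    using Suc.prems M by (simp_all add: mono_sign_square)
  have l: "(monomial M 0 :: ('i, 'k) series) = series_scale (mono_sgn {#v#} N) (series_var v \<odot> monomial N 0)"
    using sgn(1) by (auto simp: monomial_def fun_eq_iff series_scale_def var_mult_eq M)
  have r: "(monomial M 0 :: ('i, 'k) series) = series_scale (mono_sgn N {#v#}) (monomial N 0 \<odot> series_var v)"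
    using sgn(2) by (auto simp: monomial_def fun_eq_iff series_scale_def mult_var_eq M)
  consider i where "v = Psi i" "i \<in> J" | j where "v = Eta j" "j \<in> K" using Suc.prems(2) M by auto
  then show ?case
  proof cases
    case 1
    show ?thesis unfolding l unfolding 1(1) by (intro polys_scale polys_psi N 1)
  next
    case 2
    show ?thesis unfolding r unfolding 2(1) by (intro polys_scale polys_eta N 2)
  qed
qed

lemma polysI:
  fixes F :: "('i, 'k::field_char_0) series"
  assumes "finite {(M, a). F M a \<noteq> 0}"
    and "\<And>M a. F M a \<noteq> 0 \<Longrightarrow> admissible deg M \<and> set_mset M \<subseteq> Psi ` J \<union> Eta ` K"
  shows "F \<in> polys J K"
proof -
  have "F = (\<Sum>(M, a)\<in>{(M, a). F M a \<noteq> 0}. series_scale (F M a) (monomial M a))"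
  proof (intro ext)
    fix N b
    have "(\<Sum>(M, a)\<in>{(M, a). F M a \<noteq> 0}. series_scale (F M a) (monomial M a)) N b
        = (\<Sum>p\<in>{(M, a). F M a \<noteq> 0}. if p = (N, b) then F N b else 0)"
      unfolding sum_series_apply by (rule sum.cong) (auto simp: series_scale_def monomial_def split: if_splits)
    then show "F N b = (\<Sum>(M, a)\<in>{(M, a). F M a \<noteq> 0}. series_scale (F M a) (monomial M a)) N b"
      using assms(1) by auto
  qed
  moreover have "(monomial M a :: ('i, 'k) series) \<in> polys J K" if "F M a \<noteq> 0" for M a
  proof (induction a)
    case 0
    show ?case using assms(2)[OF that] by (intro monomial_in_polys) auto
  next
    case (Suc a)
    have "(monomial M (Suc a) :: ('i, 'k) series) = hbar_mult (monomial M a)"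
      by (auto simp: monomial_def hbar_mult_def fun_eq_iff split: nat.split)
    with Suc show ?case by (simp add: polys_hbar)
  qed
  then have "(\<Sum>(M, a)\<in>{(M, a). F M a \<noteq> 0}. series_scale (F M a) (monomial M a)) \<in> polys J K"
    by (intro polys_sum) (auto intro: polys_scale)
  ultimately show ?thesis by metis
qed

section \<open>Setting \<eta> to zero, and the action by normal ordering\<close>

lemma eta_zero_linear:
  "eta_zero (F + G) = eta_zero F + eta_zero G" "eta_zero 0 = 0"
  "eta_zero (series_scale c F) = series_scale c (eta_zero F)"
  "eta_zero (koszul m n F) = koszul m n (eta_zero F)"
  "eta_zero (hbar_mult F) = hbar_mult (eta_zero F)" "eta_zero (- F) = - eta_zero F"
  by (auto simp: eta_zero_def fun_eq_iff series_scale_def koszul_series_apply hbar_mult_def split: nat.split)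

lemma eta_zero_sum: "eta_zero (\<Sum>x\<in>X. f x) = (\<Sum>x\<in>X. eta_zero (f x))"
  by (induction X rule: infinite_finite_induct) (auto simp: eta_zero_linear simp del: plus_fun_apply zero_fun_apply)

lemma eta_zero_idem [simp]: "eta_zero (eta_zero F) = eta_zero F"
  by (auto simp: eta_zero_def fun_eq_iff)

lemma eta_zero_mult: "eta_zero (F \<odot> G) = eta_zero F \<odot> eta_zero G"
proof (intro ext)
  fix L a
  have "(eta_zero F \<odot> eta_zero G) L a = (\<Sum>(x, y)\<in>splits (L, a). if set_mset L \<inter> range Eta = {}
     then mono_sgn (fst x) (fst y) * case_prod F x * case_prod G y else 0)"
    unfolding mult_splits
  proof (intro sum.cong refl, clarify)
    fix M b N c assume "((M, b), N, c) \<in> splits (L, a)"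
    then have "L = M + N" by (simp add: splits_def)
    then show "mono_sgn (fst (M, b)) (fst (N, c)) * eta_zero F M b * eta_zero G N c =
      (if set_mset L \<inter> range Eta = {} then mono_sgn (fst (M, b)) (fst (N, c)) * F M b * G N c else 0)"
      by (simp add: eta_zero_def Int_Un_distrib2)
  qed
  then show "eta_zero (F \<odot> G) L a = (eta_zero F \<odot> eta_zero G) L a"
    by (auto simp: eta_zero_def mult_splits case_prod_beta)
qed

lemma eta_zero_psi [simp]: "eta_zero (series_var (Psi i)) = series_var (Psi i)"
  by (auto simp: eta_zero_def series_var_def fun_eq_iff)

lemma eta_zero_eta [simp]: "eta_zero (series_var (Eta i)) = 0"
  by (auto simp: eta_zero_def series_var_def fun_eq_iff)

lemma eta_zero_left_deriv: "eta_zero (left_deriv deg (Psi j) F) = left_deriv deg (Psi j) (eta_zero F)"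
  by (auto simp: eta_zero_def left_deriv_def fun_eq_iff)

definition act :: "'i set \<Rightarrow> ('i, 'k::field_char_0) series \<Rightarrow> ('i, 'k) series \<Rightarrow> ('i, 'k) series" where
  "act J F x = eta_zero (star J F x)"

lemma act_linear:
  "act J (F + F') x = act J F x + act J F' x"
  "act J (series_scale c F) x = series_scale c (act J F x)"
  "act J (koszul m n F) x = koszul m n (act J F x)"
  "act J (hbar_mult F) x = hbar_mult (act J F x)"
  "act J 0 x = 0"
  "act J F (x + y) = act J F x + act J F y"
  "act J F (hbar_mult x) = hbar_mult (act J F x)"
  by (simp_all add: act_def star_linear star_hbar_mult star_zero eta_zero_linear del: plus_fun_apply zero_fun_apply)

lemma act_psi: "act J (series_var (Psi i) \<odot> F) x = series_var (Psi i) \<odot> act J F x"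
  by (simp add: act_def star_psi eta_zero_mult)

text \<open>The second factor is differentiated along \<psi> only, so its factor
  \<open>Eta j\<close> survives all contractions.\<close>

lemma eta_zero_contraction_eta: "eta_zero (contraction J k F (series_var (Eta j) \<odot> x)) = 0"
  by (induction k arbitrary: F x)
     (simp_all add: eta_zero_mult eta_zero_sum eta_zero_linear left_deriv_var_mult_other contraction_linear_right koszul_linear
       del: plus_fun_apply zero_fun_apply)

lemma eta_zero_act_eta: "eta_zero (star J F (series_var (Eta j) \<odot> x)) = 0"
proof (intro ext)
  fix M a
  have "contraction J k F (series_var (Eta j) \<odot> x) M b = 0" if "set_mset M \<inter> range Eta = {}" for k b
    using fun_cong[OF fun_cong[OF eta_zero_contraction_eta[of J k F j x], of M], of b] that
    by (simp add: eta_zero_def)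
  then show "eta_zero (star J F (series_var (Eta j) \<odot> x)) M a = 0 M a"
    by (simp add: eta_zero_def star_def)
qed

lemma act_eta:
  assumes "finite J" "j \<in> J" "admissible_series F"
  shows "act J (F \<odot> series_var (Eta j)) x = hbar_mult (act J F (left_deriv deg (Psi j) x))"
  by (simp add: act_def star_eta[OF assms] eta_zero_linear eta_zero_act_eta del: plus_fun_apply)

lemma act_one: "admissible_series x \<Longrightarrow> act J series_one x = eta_zero x"
  by (simp add: act_def star_one)

lemma act_admissible: "admissible_series F \<Longrightarrow> admissible_series x \<Longrightarrow> admissible_series (act J F x)"
  by (simp add: act_def power_series_star power_series_eta_zero)

text \<open>This is the composition law \<open>act_star\<close> for the single variable
  \<open>Eta j\<close> as first factor: its star product with \<open>G\<close> is the ordinary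
  product plus \<hbar> times the derivative of \<open>G\<close>, and it acts as \<hbar> times the
  derivative along \<open>Psi j\<close>.\<close>

lemma act_eta_commutator:
  fixes G x :: "('i, 'k::field_char_0) series"
  assumes J: "finite J" "j \<in> J" and G: "G \<in> polys J J" and x: "admissible_series x"
  shows "act J (series_var (Eta j) \<odot> G) x + hbar_mult (act J (left_deriv deg (Psi j) G) x)
       = hbar_mult (left_deriv deg (Psi j) (act J G x))"
  using G x
proof (induction arbitrary: x rule: polys.induct)
  case polys_one
  then show ?case
    by (simp add: var_mult_one act_eta[OF J] power_series_one act_one power_series_left_deriv
        eta_zero_left_deriv act_linear hbar_mult_linear del: zero_fun_apply plus_fun_apply)
next
  case (polys_scale F c)
  then show ?case
    by (simp add: act_linear left_deriv_linear hbar_mult_linear flip: series_scale_linear(1) del: plus_fun_apply)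
next
  case (polys_add F G)
  show ?case
    using polys_add.IH(1)[OF polys_add.prems] polys_add.IH(2)[OF polys_add.prems]
    by (simp add: act_linear left_deriv_linear hbar_mult_linear algebra_simps flip: series_scale_linear(1) del: plus_fun_apply)
next
  case (polys_hbar F)
  then show ?case
    by (simp add: mult_hbar_mult act_linear left_deriv_linear flip: hbar_mult_linear(1) del: plus_fun_apply)
next
  case (polys_psi F i)
  let ?kz = "koszul (var_deg deg (Psi j)) (var_deg deg (Psi i)) :: ('i,'k) series \<Rightarrow> _"
  note adm = polys_admissible[OF polys_psi.hyps(1)]
  have "act J (series_var (Eta j) \<odot> (series_var (Psi i) \<odot> F)) x = ?kz (series_var (Psi i) \<odot> act J (series_var (Eta j) \<odot> F) x)"
    by (subst mult_var_left_commute) (simp add: act_linear koszul_var_deg act_psi del: var_deg.simps)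
  moreover have "act J (left_deriv deg (Psi j) (series_var (Psi i) \<odot> F)) x =
     (if j = i then act J F x else 0) + ?kz (series_var (Psi i) \<odot> act J (left_deriv deg (Psi j) F) x)"
    using adm by (simp add: left_deriv_var_mult act_linear act_psi del: var_deg.simps plus_fun_apply zero_fun_apply)
  moreover have "left_deriv deg (Psi j) (act J (series_var (Psi i) \<odot> F) x) =
     (if j = i then act J F x else 0) + ?kz (series_var (Psi i) \<odot> left_deriv deg (Psi j) (act J F x))"
    using adm polys_psi.prems
    by (simp add: left_deriv_var_mult act_psi act_admissible del: var_deg.simps plus_fun_apply zero_fun_apply)
  moreover have "?kz (series_var (Psi i) \<odot> act J (series_var (Eta j) \<odot> F) x) +
       hbar_mult (?kz (series_var (Psi i) \<odot> act J (left_deriv deg (Psi j) F) x)) =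
     hbar_mult (?kz (series_var (Psi i) \<odot> left_deriv deg (Psi j) (act J F x)))"
    using arg_cong[OF polys_psi.IH[OF polys_psi.prems], of "\<lambda>y. ?kz (series_var (Psi i) \<odot> y)"]
    by (simp add: koszul_linear mult_hbar_mult koszul_hbar_mult del: var_deg.simps plus_fun_apply)
  ultimately show ?case
    by (simp add: hbar_mult_linear del: var_deg.simps plus_fun_apply zero_fun_apply)
next
  \<comment> \<open>A variable \<open>Eta k\<close> at the right end of the polynomial passes a
    derivative on to \<open>x\<close>; therefore the induction hypothesis is applied to the
    derivative of \<open>x\<close>.\<close>
  case (polys_eta F k)
  note adm = polys_admissible[OF polys_eta.hyps(1)]
  show ?case
    using adm polys_eta.IH[OF power_series_left_deriv[OF polys_eta.prems, of "Psi k"]] polys_eta.hyps(2)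
    by (simp add: left_deriv_mult_var act_eta[OF J(1)] power_series_intros left_deriv_linear
        flip: mult_assoc hbar_mult_linear(1) del: plus_fun_apply)
qed

text \<open>Only a factor \<eta> of \<open>F\<close> interacts with \<open>G\<close>; it changes
  \<open>G\<close> into \<open>Eta j\<close> times \<open>G\<close> and into a derivative of
  \<open>G\<close>. Both are again polynomials, so the induction runs over \<open>F\<close> with
  \<open>G\<close> arbitrary.\<close>

theorem act_star:
  assumes J: "finite J" and F: "F \<in> polys J J" and G: "G \<in> polys J J" and x: "admissible_series x"
  shows "act J (star J F G) x = act J F (act J G x)"
  using F G
proof (induction arbitrary: G rule: polys.induct)
  case polys_one
  then show ?case
    using x by (simp add: star_one polys_admissible act_one act_admissible) (simp add: act_def)
next
  case (polys_eta F j)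
  note adm = polys_admissible[OF polys_eta.hyps(1)]
  have "act J (star J (F \<odot> series_var (Eta j)) G) x =
      act J F (act J (series_var (Eta j) \<odot> G) x + hbar_mult (act J (left_deriv deg (Psi j) G) x))"
    using polys_eta by (simp add: star_eta[OF J _ adm] act_linear polys_eta_mult polys_left_deriv_psi del: plus_fun_apply)
  also have "\<dots> = act J F (hbar_mult (left_deriv deg (Psi j) (act J G x)))"
    using act_eta_commutator[OF J polys_eta.hyps(2) polys_eta.prems x] by simp
  also have "\<dots> = act J (F \<odot> series_var (Eta j)) (act J G x)"
    using polys_eta.hyps(2) by (simp add: act_eta[OF J _ adm] act_linear)
  finally show ?case .
qed (simp_all add: star_linear star_hbar_mult star_psi act_linear act_psi del: plus_fun_apply)

end

section \<open>Differential operators on graded commutative algebras\<close>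

context graded_comm_algebra
begin

lemma component_subset: "x \<in> V n \<Longrightarrow> x \<in> A"
  using span_components span_superset by blast

lemma component_closed:
  "0 \<in> V n" "x \<in> V n \<Longrightarrow> y \<in> V n \<Longrightarrow> x + y \<in> V n" "x \<in> V n \<Longrightarrow> - x \<in> V n"
  "x \<in> V n \<Longrightarrow> y \<in> V n \<Longrightarrow> x - y \<in> V n" "x \<in> V n \<Longrightarrow> koszul p q x \<in> V n"
  using subspace_component[of n]
  by (auto simp: koszul_def subspace_0 subspace_add subspace_neg subspace_diff)

lemma mult_diff:
  assumes "x \<in> V m" "y \<in> V m" "z \<in> V n"
  shows "mul (x - y) z = mul x z - mul y z" "mul z (x - y) = mul z x - mul z y"
proof -
  have "x - y \<in> A" "x \<in> A" "y \<in> A" "z \<in> A"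
    using component_subset[OF component_closed(4)[OF assms(1,2)]] assms[THEN component_subset] by simp_all
  then show "mul (x - y) z = mul x z - mul y z" "mul z (x - y) = mul z x - mul z y"
    using mult_add_left[of "x - y" y z] mult_add_right[of z "x - y" y] by (auto simp: algebra_simps)
qed

lemma mult_add:
  assumes "x \<in> V m" "y \<in> V m" "z \<in> V n"
  shows "mul (x + y) z = mul x z + mul y z" "mul z (x + y) = mul z x + mul z y"
  using mult_add_left mult_add_right assms[THEN component_subset] by simp_all

lemma mult_zero:
  assumes "z \<in> V n"
  shows "mul 0 z = 0" "mul z 0 = 0"
  using mult_diff[of 0 n 0 z n] assms component_closed by auto

lemma mult_uminus:
  assumes "x \<in> V m" "z \<in> V n"
  shows "mul (- x) z = - mul x z" "mul z (- x) = - mul z x"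
  using mult_diff[of 0 m x z n] assms component_closed mult_zero by auto

lemma mult_koszul:
  assumes "x \<in> V m" "z \<in> V n"
  shows "mul (koszul p q x) z = koszul p q (mul x z)" "mul z (koszul p q x) = koszul p q (mul z x)"
  using assms by (auto simp: koszul_def mult_uminus)

lemma mult_homogeneous_assoc:
  "x \<in> V m \<Longrightarrow> y \<in> V n \<Longrightarrow> z \<in> V p \<Longrightarrow> mul (mul x y) z = mul x (mul y z)"
  by (blast intro: mult_assoc component_subset)

lemma mult_left_commute:
  assumes "x \<in> V m" "y \<in> V n" "z \<in> V p"
  shows "mul x (mul y z) = koszul m n (mul y (mul x z))"
proof -
  have "mul x (mul y z) = mul (koszul m n (mul y x)) z"
    using mult_comm[OF assms(1,2)] mult_homogeneous_assoc[OF assms] by simp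
  then show ?thesis
    using mult_homogeneous_assoc[OF assms(2,1,3)] mult_koszul(1)[OF mult_degree[OF assms(2,1)] assms(3)]
    by simp
qed

definition homogeneous_map :: "int \<Rightarrow> ('b \<Rightarrow> 'b) \<Rightarrow> bool" where
  "homogeneous_map r D \<longleftrightarrow>
     (\<forall>n. \<forall>x\<in>V n. D x \<in> V (n + r) \<and> (\<forall>y\<in>V n. D (x + y) = D x + D y))"

lemma homogeneous_mapI:
  "(\<And>n x. x \<in> V n \<Longrightarrow> D x \<in> V (n + r)) \<Longrightarrow>
   (\<And>n x y. x \<in> V n \<Longrightarrow> y \<in> V n \<Longrightarrow> D (x + y) = D x + D y) \<Longrightarrow> homogeneous_map r D"
  by (simp add: homogeneous_map_def)

lemma homogeneous_mapD:
  assumes "homogeneous_map r D"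
  shows "x \<in> V n \<Longrightarrow> D x \<in> V (n + r)" "x \<in> V n \<Longrightarrow> y \<in> V n \<Longrightarrow> D (x + y) = D x + D y"
    "D 0 = 0" "x \<in> V n \<Longrightarrow> D (- x) = - D x" "x \<in> V n \<Longrightarrow> D (koszul p q x) = koszul p q (D x)"
proof -
  show 1: "x \<in> V n \<Longrightarrow> D x \<in> V (n + r)" and 2: "x \<in> V n \<Longrightarrow> y \<in> V n \<Longrightarrow> D (x + y) = D x + D y" for x y
    using assms by (auto simp: homogeneous_map_def)
  show 3: "D 0 = 0" using assms component_closed(1)[of 0] by (force simp: homogeneous_map_def)
  show 4: "x \<in> V n \<Longrightarrow> D (- x) = - D x" for x
    using 2[of x "- x"] component_closed(3)[of x n] 3 by (simp add: eq_neg_iff_add_eq_0 add.commute)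
  show "x \<in> V n \<Longrightarrow> D (koszul p q x) = koszul p q (D x)"
    using 4 by (simp add: koszul_def)
qed

text \<open>The failure of \<open>D\<close>, of degree \<open>r\<close>, to commute with multiplication by \<open>v\<close>, of degree
  \<open>m\<close>, up to the term \<open>D v\<close>: passing from \<open>D\<close> to its defect removes the first
  argument \<open>v\<close> from the multibrackets of \<open>D\<close>.\<close>

definition defect :: "int \<Rightarrow> ('b \<Rightarrow> 'b) \<Rightarrow> int \<Rightarrow> 'b \<Rightarrow> 'b \<Rightarrow> 'b" where
  "defect r D m v w = D (mul v w) - mul (D v) w - koszul r m (mul v (D w))"

text \<open>Grothendieck's inductive description of differential operators, in the variant without
  constant term: \<open>diffop 0\<close> means zero and \<open>diffop 1\<close> means derivation.
  The degree is a parameter because taking a defect shifts it by the degree of the argument.\<close>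

primrec diffop :: "nat \<Rightarrow> int \<Rightarrow> ('b \<Rightarrow> 'b) \<Rightarrow> bool" where
  "diffop 0 r D \<longleftrightarrow> (\<forall>n. \<forall>x\<in>V n. D x = 0)"
| "diffop (Suc k) r D \<longleftrightarrow>
     homogeneous_map r D \<and> (\<forall>m. \<forall>v\<in>V m. diffop k (m + r) (defect r D m v))"

lemma diffop_cong:
  assumes "diffop k r D" "\<And>n x. x \<in> V n \<Longrightarrow> D x = D' x"
  shows "diffop k r D'"
  using assms
proof (induction k arbitrary: r D D')
  case (Suc k)
  have "homogeneous_map r D'"
    using Suc.prems component_closed(2) by (simp add: homogeneous_map_def) metis
  moreover have "diffop k (m + r) (defect r D' m v)" if v: "v \<in> V m" for m v
  proof (rule Suc.IH)
    show "diffop k (m + r) (defect r D m v)" using Suc.prems v by simp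
    show "defect r D m v w = defect r D' m v w" if "w \<in> V n" for n w
      using Suc.prems(2) v that mult_degree[OF v that] by (auto simp: defect_def)
  qed
  ultimately show ?case by simp
qed auto

lemma diffop_homogeneous_map: "diffop k r D \<Longrightarrow> homogeneous_map r D"
proof (cases k)
  case 0
  assume "diffop k r D"
  with 0 have D: "D x = 0" if "x \<in> V n" for x n using that by auto
  show ?thesis by (rule homogeneous_mapI) (use D D[OF component_closed(2)] component_closed(1) in simp_all)
qed auto

lemma diffop_Suc: "diffop k r D \<Longrightarrow> diffop (Suc k) r D"
proof (induction k arbitrary: r D)
  case 0
  then have "defect r D m v w = 0" if "v \<in> V m" "w \<in> V n" for m v n w
    using that mult_degree[of v m w n] mult_zero by (auto simp: defect_def koszul_linear)
  then show ?case using 0 diffop_homogeneous_map[OF 0] by simp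
next
  case (Suc k)
  show ?case
    unfolding diffop.simps(2)[of "Suc k"] using Suc.IH Suc.prems unfolding diffop.simps(2)[of k] by blast
qed

lemma diffop_mono: "diffop k r D \<Longrightarrow> k \<le> l \<Longrightarrow> diffop l r D"
  by (induction l) (auto simp: le_Suc_eq simp del: diffop.simps intro: diffop_Suc)

lemma diffop_add: "diffop k r D \<Longrightarrow> diffop k r D' \<Longrightarrow> diffop k r (\<lambda>x. D x + D' x)"
proof (induction k arbitrary: r D D')
  case (Suc k)
  then have D: "homogeneous_map r D" "homogeneous_map r D'" by auto
  have "homogeneous_map r (\<lambda>x. D x + D' x)"
    using D by (auto simp: homogeneous_map_def component_closed)
  moreover have "diffop k (m + r) (defect r (\<lambda>x. D x + D' x) m v)" if v: "v \<in> V m" for m v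
  proof (rule diffop_cong)
    show "diffop k (m + r) (\<lambda>w. defect r D m v w + defect r D' m v w)"
      using Suc v by simp
    show "defect r D m v w + defect r D' m v w = defect r (\<lambda>x. D x + D' x) m v w" if w: "w \<in> V n" for n w
      using mult_add[OF homogeneous_mapD(1)[OF D(1) v] homogeneous_mapD(1)[OF D(2) v] w]
        mult_add[OF homogeneous_mapD(1)[OF D(1) w] homogeneous_mapD(1)[OF D(2) w] v]
      by (simp add: defect_def koszul_linear algebra_simps)
  qed
  ultimately show ?case by simp
qed auto

lemma diffop_zero: "diffop k r (\<lambda>x. 0)"
  by (rule diffop_mono[of 0]) auto

lemma diffop_sum: "(\<And>i. i \<in> X \<Longrightarrow> diffop k r (f i)) \<Longrightarrow> diffop k r (\<lambda>x. \<Sum>i\<in>X. f i x)"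
  by (induction X rule: infinite_finite_induct) (auto simp: diffop_zero diffop_add simp del: diffop.simps)

text \<open>The defect of \<open>g\<close> times \<open>D\<close> is \<open>g\<close> times the
  defect of \<open>D\<close>; the sign of moving \<open>v\<close> past \<open>g\<close> combines
  with that for \<open>D\<close> into the one for degree \<open>p + r\<close>.\<close>

lemma diffop_mult_left: "g \<in> V p \<Longrightarrow> diffop k r D \<Longrightarrow> diffop k (p + r) (\<lambda>x. mul g (D x))"
proof (induction k arbitrary: r D)
  case 0
  then show ?case using mult_zero by auto
next
  case (Suc k)
  then have D: "homogeneous_map r D" and g: "g \<in> V p" by auto
  have "mul g (D x) \<in> V (n + (p + r))" if "x \<in> V n" for x n
    using mult_degree[OF g homogeneous_mapD(1)[OF D that]] by (simp add: algebra_simps)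
  then have "homogeneous_map (p + r) (\<lambda>x. mul g (D x))"
    using homogeneous_mapD(2)[OF D] mult_add(2)[OF homogeneous_mapD(1)[OF D] homogeneous_mapD(1)[OF D] g]
    by (intro homogeneous_mapI) simp_all
  moreover have "diffop k (m + (p + r)) (defect (p + r) (\<lambda>x. mul g (D x)) m v)" if v: "v \<in> V m" for m v
  proof (rule diffop_cong)
    show "diffop k (m + (p + r)) (\<lambda>w. mul g (defect r D m v w))"
      using Suc.IH[OF g, of "m + r"] Suc.prems v by (simp add: algebra_simps)
    show "mul g (defect r D m v w) = defect (p + r) (\<lambda>x. mul g (D x)) m v w" if w: "w \<in> V n" for n w
    proof -
      note Dv = homogeneous_mapD(1)[OF D v] and Dw = homogeneous_mapD(1)[OF D w]
        and Dvw = homogeneous_mapD(1)[OF D mult_degree[OF v w]]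
      have a: "mul (D v) w \<in> V (m + n + r)" using mult_degree[OF Dv w] by (simp add: algebra_simps)
      have b: "mul v (D w) \<in> V (m + n + r)" using mult_degree[OF v Dw] by (simp add: algebra_simps)
      have "mul g (defect r D m v w) = mul g (D (mul v w)) - mul g (mul (D v) w) - koszul r m (mul g (mul v (D w)))"
        unfolding defect_def using mult_diff(2)[OF component_closed(4)[OF Dvw a] component_closed(5)[OF b] g]
          mult_diff(2)[OF Dvw a g] mult_koszul(2)[OF b g] by simp
      moreover have "koszul r m (mul g (mul v (D w))) = koszul (p + r) m (mul v (mul g (D w)))"
        unfolding mult_left_commute[OF g v Dw] by (auto simp: koszul_def)
      ultimately show ?thesis
        using mult_homogeneous_assoc[OF g Dv w] by (simp add: defect_def)
    qed
  qed
  ultimately show ?case by simp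
qed

lemma diffop_uminus: "diffop k r D \<Longrightarrow> diffop k r (\<lambda>x. - D x)"
proof -
  assume D: "diffop k r D"
  have "- one \<in> V 0" using one_degree component_closed by simp
  from diffop_mult_left[OF this D] have "diffop k r (\<lambda>x. mul (- one) (D x))" by simp
  then show ?thesis
  proof (rule diffop_cong)
    fix n x assume "x \<in> V n"
    note Dx = homogeneous_mapD(1)[OF diffop_homogeneous_map[OF D] this]
    show "mul (- one) (D x) = - D x"
      using mult_uminus(1)[OF one_degree Dx] mult_one[OF component_subset[OF Dx]] by simp
  qed
qed

lemma diffop_koszul: "diffop k r D \<Longrightarrow> diffop k r (\<lambda>x. koszul p q (D x))"
  by (cases "odd p"; cases "odd q"; simp add: koszul_def diffop_uminus)

definition derivation :: "int \<Rightarrow> ('b \<Rightarrow> 'b) \<Rightarrow> bool" where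
  "derivation s \<delta> \<longleftrightarrow> homogeneous_map s \<delta> \<and>
     (\<forall>m n. \<forall>v\<in>V m. \<forall>w\<in>V n. \<delta> (mul v w) = mul (\<delta> v) w + koszul s m (mul v (\<delta> w)))"

lemma derivation_iff_diffop: "derivation s \<delta> \<longleftrightarrow> diffop 1 s \<delta>"
proof -
  have "defect s \<delta> m v w = 0 \<longleftrightarrow> \<delta> (mul v w) = mul (\<delta> v) w + koszul s m (mul v (\<delta> w))" for m v w
    by (auto simp: defect_def algebra_simps)
  then show ?thesis unfolding derivation_def by auto
qed

text \<open>Iterated partial derivatives arise by composing with one derivation after another, so
  this case of the additivity of orders is enough to bound their order.\<close>

lemma diffop_comp_derivation:
  assumes \<delta>: "derivation s \<delta>"
  shows "diffop k r D \<Longrightarrow> diffop (Suc k) (r + s) (\<lambda>x. D (\<delta> x))"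
proof (induction k arbitrary: r D)
  case 0
  have "\<delta> x \<in> V (n + s)" if "x \<in> V n" for x n
    using \<delta> that homogeneous_mapD(1) by (auto simp: derivation_def)
  with 0 have "diffop 0 (r + s) (\<lambda>x. D (\<delta> x))" by auto
  then show ?case by (rule diffop_Suc)
next
  case (Suc k)
  have hD: "homogeneous_map r D" using Suc.prems diffop_homogeneous_map by blast
  have h\<delta>: "homogeneous_map s \<delta>" using \<delta> by (simp add: derivation_def)
  have "D (\<delta> x) \<in> V (n + (r + s))" if "x \<in> V n" for x n
    using homogeneous_mapD(1)[OF hD homogeneous_mapD(1)[OF h\<delta> that]] by (simp add: algebra_simps)
  then have "homogeneous_map (r + s) (\<lambda>x. D (\<delta> x))"
    using homogeneous_mapD(2)[OF hD homogeneous_mapD(1)[OF h\<delta>] homogeneous_mapD(1)[OF h\<delta>]]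
    by (intro homogeneous_mapI) (simp_all add: homogeneous_mapD(2)[OF h\<delta>])
  moreover have "diffop (Suc k) (m + (r + s)) (defect (r + s) (\<lambda>x. D (\<delta> x)) m v)" if v: "v \<in> V m" for m v
  proof (rule diffop_cong)
    note \<delta>v = homogeneous_mapD(1)[OF h\<delta> v] and Dv = homogeneous_mapD(1)[OF hD v]
    have eq: "m + s + r = m + (r + s)" "m + r + s = m + (r + s)" by simp_all
    have "diffop k (m + s + r) (defect r D (m + s) (\<delta> v))" using Suc.prems \<delta>v by simp
    from diffop_Suc[OF this] have 1: "diffop (Suc k) (m + (r + s)) (defect r D (m + s) (\<delta> v))"
      unfolding eq .
    from diffop_koszul[OF diffop_mult_left[OF \<delta>v Suc.prems]]
    have 2: "diffop (Suc k) (m + (r + s)) (\<lambda>w. koszul r (m + s) (mul (\<delta> v) (D w)))"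
      unfolding eq .
    have "diffop k (m + r) (defect r D m v)" using Suc.prems v by simp
    from diffop_koszul[OF Suc.IH[OF this]]
    have 3: "diffop (Suc k) (m + (r + s)) (\<lambda>w. koszul s m (defect r D m v (\<delta> w)))"
      unfolding eq .
    have "diffop (Suc k) s \<delta>"
      using \<delta> diffop_mono[of 1 s \<delta> "Suc k"] unfolding derivation_iff_diffop by (simp del: diffop.simps)
    from diffop_koszul[OF diffop_mult_left[OF Dv this]]
    have 4: "diffop (Suc k) (m + (r + s)) (\<lambda>w. koszul s m (mul (D v) (\<delta> w)))"
      unfolding eq .
    \<comment> \<open>Apply \<open>D\<close> to both terms of the Leibniz rule for
      \<open>\<delta> (mul v w)\<close> and expand by the definition of the defect. After
      subtracting what the defect of the composite removes, these four terms remain; the third has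
      the right order by the induction hypothesis.\<close>
    show "diffop (Suc k) (m + (r + s)) (\<lambda>w. defect r D (m + s) (\<delta> v) w + koszul r (m + s) (mul (\<delta> v) (D w))
        + koszul s m (defect r D m v (\<delta> w)) + koszul s m (mul (D v) (\<delta> w)))"
      by (intro diffop_add 1 2 3 4)
    show "defect r D (m + s) (\<delta> v) w + koszul r (m + s) (mul (\<delta> v) (D w))
        + koszul s m (defect r D m v (\<delta> w)) + koszul s m (mul (D v) (\<delta> w)) = defect (r + s) (\<lambda>x. D (\<delta> x)) m v w"
      if w: "w \<in> V n" for n w
    proof -
      note \<delta>w = homogeneous_mapD(1)[OF h\<delta> w]
      have a: "mul (\<delta> v) w \<in> V (m + n + s)" using mult_degree[OF \<delta>v w] by (simp add: algebra_simps)
      have b: "mul v (\<delta> w) \<in> V (m + n + s)" using mult_degree[OF v \<delta>w] by (simp add: algebra_simps)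
      have "D (\<delta> (mul v w)) = D (mul (\<delta> v) w) + koszul s m (D (mul v (\<delta> w)))"
        using \<delta> v w homogeneous_mapD(2)[OF hD a component_closed(5)[OF b]] homogeneous_mapD(5)[OF hD b]
        by (simp add: derivation_def)
      moreover have "koszul s m (koszul r m x) = koszul (r + s) m x" for x :: 'b by (auto simp: koszul_def)
      ultimately show ?thesis by (simp add: defect_def koszul_linear algebra_simps)
    qed
  qed
  ultimately show ?case by simp
qed

text \<open>The argument list is reversed, so its last entry is the first argument. The recursion
  multiplies entries at the head only, hence it leaves this entry alone until it is one of the last
  two.\<close>

lemma order_bracket_append:
  assumes D: "homogeneous_map r D" and v: "v \<in> V m"
  shows "xs \<noteq> [] \<Longrightarrow> \<forall>(n, w)\<in>set xs. w \<in> V n \<Longrightarrow>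
    order_bracket mul D (xs @ [(m, v)]) = order_bracket mul (defect r D m v) xs"
proof (induction xs rule: measure_induct_rule[of length])
  case (less xs)
  then obtain n w ys where xs: "xs = (n, w) # ys" by (cases xs) auto
  then have w: "w \<in> V n" using less.prems by simp
  show ?case
  proof (cases ys)
    case Nil
    \<comment> \<open>With two entries left, commuting \<open>D w\<close>, of degree
      \<open>n + r\<close>, past \<open>v\<close> cancels the sign for \<open>m\<close> and
      \<open>n\<close> and leaves that for \<open>r\<close> and \<open>m\<close>.\<close>
    have "koszul m n (mul (D w) v) = koszul r m (mul v (D w))"
      unfolding mult_comm[OF homogeneous_mapD(1)[OF D w] v] by (auto simp: koszul_def)
    then show ?thesis by (simp add: xs Nil defect_def)
  next
    case (Cons p zs)
    then obtain n' w' where ys: "ys = (n', w') # zs" by (cases p) auto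
    have "mul w' w \<in> V (n' + n)" using less.prems by (simp add: xs ys mult_degree)
    then show ?thesis
      using less.IH[of "(n' + n, mul w' w) # zs"] less.IH[of "(n', w') # zs"] less.IH[of "(n, w) # zs"] less.prems
      by (simp add: xs ys)
  qed
qed

theorem diffop_order_le:
  assumes "diffop k r D"
  shows "order_le k D"
proof -
  have "order_bracket mul D vs = 0" if "length vs = k + 1" "\<forall>(n, w)\<in>set vs. w \<in> V n" for vs
    using assms that
  proof (induction k arbitrary: r D vs)
    case 0
    then obtain m v where "vs = [(m, v)]" by (cases vs) auto
    with 0 show ?case by auto
  next
    case (Suc k)
    obtain xs m v where vs: "vs = xs @ [(m, v)]" using Suc.prems(2)
      by (metis Suc_eq_plus1 append_butlast_last_id length_0_conv nat.simps(3) surj_pair)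
    then have "order_bracket mul D vs = order_bracket mul (defect r D m v) xs"
      using Suc.prems by (auto intro!: order_bracket_append)
    also have "\<dots> = 0" using Suc.prems vs by (intro Suc.IH[of "m + r"]) auto
    finally show ?case .
  qed
  then show ?thesis by (simp add: order_le_def)
qed

text \<open>\<open>diffop\<close> speaks of homogeneous arguments only; full linearity extends the
  Leibniz rule to an arbitrary second factor.\<close>

lemma derivation_leibniz:
  assumes D: "linear_of_degree r D" "diffop 1 r D" and x: "x \<in> V m" and y: "y \<in> A"
  shows "D (mul x y) = mul (D x) y + koszul r m (mul x (D y))"
proof -
  note h = diffop_homogeneous_map[OF D(2)]
  note Dx = homogeneous_mapD(1)[OF h x]
  have xA: "x \<in> A" "D x \<in> A" using x Dx component_subset by auto
  have A: "subspace A" using span_components subspace_span by metis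
  \<comment> \<open>The memberships are part of the claim because \<open>D\<close> and the product
    are additive on the carrier only.\<close>
  have "y \<in> A \<and> mul x y \<in> A \<and> D y \<in> A \<and> D (mul x y) = mul (D x) y + koszul r m (mul x (D y))"
    using y unfolding span_components[symmetric]
  proof (induction rule: span_induct_alt)
    case base
    show ?case
      using span_zero mult_zero(2)[OF x] mult_zero(2)[OF Dx] homogeneous_mapD(3)[OF h] by (simp add: koszul_linear)
  next
    case (step c z y)
    then obtain n where z: "z \<in> V n" by auto
    note Dz = homogeneous_mapD(1)[OF h z]
    have zA: "z \<in> A" "D z \<in> A" "mul x z \<in> A" "mul x (D z) \<in> A" "scale c z \<in> A" "scale c (D z) \<in> A" "scale c (mul x z) \<in> A"
      using z Dz mult_degree[OF x z] mult_degree[OF x Dz] component_subset A subspace_scale by blast+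
    have yA: "y \<in> A" "mul x y \<in> A" "D y \<in> A" using step span_components by auto
    have IH: "D (mul x y) = mul (D x) y + koszul r m (mul x (D y))" using step by simp
    have lz: "D (mul x z) = mul (D x) z + koszul r m (mul x (D z))"
      using D(2) x z derivation_iff_diffop unfolding derivation_def by blast
    have e1: "mul x (scale c z + y) = scale c (mul x z) + mul x y"
      using mult_add_right[OF xA(1) zA(5) yA(1)] mult_scale_right[OF xA(1) zA(1)] by simp
    have e2: "D (scale c z + y) = scale c (D z) + D y"
      using D(1) zA yA unfolding linear_of_degree_def by simp
    have e3: "D (scale c (mul x z) + mul x y) = scale c (D (mul x z)) + D (mul x y)"
      using D(1) zA yA unfolding linear_of_degree_def by simp
    have e4: "mul (D x) (scale c z + y) = scale c (mul (D x) z) + mul (D x) y"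
      using mult_add_right[OF xA(2) zA(5) yA(1)] mult_scale_right[OF xA(2) zA(1)] by simp
    have e5: "mul x (scale c (D z) + D y) = scale c (mul x (D z)) + mul x (D y)"
      using mult_add_right[OF xA(1) zA(6) yA(3)] mult_scale_right[OF xA(1) zA(2)] by simp
    have "D (mul x (scale c z + y)) = mul (D x) (scale c z + y) + koszul r m (mul x (D (scale c z + y)))"
      unfolding e1 e2 e3 e4 e5 IH lz by (auto simp: koszul_def algebra_simps scale_right_distrib)
    moreover have "scale c z + y \<in> A" "mul x (scale c z + y) \<in> A" "D (scale c z + y) \<in> A"
      unfolding e1 e2 using A zA yA by (auto intro: subspace_add)
    ultimately show ?case using span_components by auto
  qed
  then show ?thesis by simp
qed

end

section \<open>The Chevalley-Eilenberg algebra\<close>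

interpretation series: vector_space series_scale
  by unfold_locales (auto simp: series_scale_def fun_eq_iff algebra_simps)

context graded_variables
begin

lemma CE_iff: "F \<in> CE J deg \<longleftrightarrow> power_series J deg F \<and>
    (\<forall>M a. F M a \<noteq> 0 \<longrightarrow> a = 0 \<and> set_mset M \<inter> range Eta = {}) \<and> finite {M. F M 0 \<noteq> 0}"
proof -
  have "eta_zero F = F \<and> hbar_zero F = F \<longleftrightarrow> (\<forall>M a. F M a \<noteq> 0 \<longrightarrow> a = 0 \<and> set_mset M \<inter> range Eta = {})"
  proof
    assume F: "eta_zero F = F \<and> hbar_zero F = F"
    have "F M a = (if set_mset M \<inter> range Eta = {} then F M a else 0)" for M a
      using F by (metis eta_zero_def)
    moreover have "F M a = (if a = 0 then F M 0 else 0)" for M a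
      using F by (metis hbar_zero_def)
    ultimately show "\<forall>M a. F M a \<noteq> 0 \<longrightarrow> a = 0 \<and> set_mset M \<inter> range Eta = {}" by metis
  next
    assume F: "\<forall>M a. F M a \<noteq> 0 \<longrightarrow> a = 0 \<and> set_mset M \<inter> range Eta = {}"
    show "eta_zero F = F \<and> hbar_zero F = F"
    proof (intro conjI ext)
      fix M a
      show "eta_zero F M a = F M a" using F[rule_format, of M a] by (auto simp: eta_zero_def)
      show "hbar_zero F M a = F M a" using F[rule_format, of M a] by (auto simp: hbar_zero_def)
    qed
  qed
  then show ?thesis by (auto simp: CE_def)
qed

lemma CE_power_series: "F \<in> CE J deg \<Longrightarrow> power_series J deg F"
  by (simp add: CE_def)

lemma CE_eta_zero: "F \<in> CE J deg \<Longrightarrow> eta_zero F = F"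
  by (simp add: CE_def)

lemma CE_hbar: "F \<in> CE J deg \<Longrightarrow> a > 0 \<Longrightarrow> F M a = 0"
  unfolding CE_iff by (metis not_less_zero)

lemma CE_mono: "F \<in> CE J deg \<Longrightarrow> J \<subseteq> K \<Longrightarrow> F \<in> CE K deg"
  unfolding CE_iff using power_series_mono by blast

lemma CE_subset_mono:
  assumes F: "F \<in> CE J deg" and "power_series K deg G"
    and "\<And>M a. G M a \<noteq> 0 \<Longrightarrow> F M a \<noteq> 0"
  shows "G \<in> CE K deg"
proof -
  have "{M. G M 0 \<noteq> 0} \<subseteq> {M. F M 0 \<noteq> 0}" using assms(3) by blast
  with F have "finite {M. G M 0 \<noteq> 0}" unfolding CE_iff by (meson finite_subset)
  with assms show ?thesis unfolding CE_iff by blast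
qed

lemma CE_zero: "0 \<in> CE J deg"
  by (simp add: CE_iff power_series_zero)

lemma CE_scale: "F \<in> CE J deg \<Longrightarrow> series_scale c F \<in> CE J deg"
  using CE_subset_mono[of F J J "series_scale c F"] power_series_scale[of J F c] CE_power_series[of F J]
  by (fastforce simp: series_scale_def)

lemma CE_add:
  assumes "F \<in> CE J deg" "G \<in> CE J deg"
  shows "F + G \<in> CE J deg"
proof -
  have nz: "F M a \<noteq> 0 \<or> G M a \<noteq> 0" if "(F + G) M a \<noteq> 0" for M a using that by auto
  then have "{M. (F + G) M 0 \<noteq> 0} \<subseteq> {M. F M 0 \<noteq> 0} \<union> {M. G M 0 \<noteq> 0}" by blast
  then have "finite {M. (F + G) M 0 \<noteq> 0}"
    using assms unfolding CE_iff by (meson finite_UnI finite_subset)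
  moreover have "power_series J deg (F + G)" using assms by (intro power_series_add CE_power_series)
  ultimately show ?thesis using assms nz unfolding CE_iff by blast
qed

lemma CE_sum: "(\<And>x. x \<in> X \<Longrightarrow> f x \<in> CE J deg) \<Longrightarrow> (\<Sum>x\<in>X. f x) \<in> CE J deg"
  by (induction X rule: infinite_finite_induct) (auto simp: CE_zero CE_add simp del: plus_fun_apply zero_fun_apply)

lemma CE_one: "series_one \<in> CE J deg"
  unfolding CE_iff by (auto simp: power_series_one) (auto simp: series_one_def split: if_splits)

lemma CE_mult:
  assumes "F \<in> CE J deg" "G \<in> CE J deg"
  shows "F \<odot> G \<in> CE J deg"
proof -
  have nz: "\<exists>M N. L = M + N \<and> a = 0 \<and> F M 0 \<noteq> 0 \<and> G N 0 \<noteq> 0" if "(F \<odot> G) L a \<noteq> 0" for L a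
    using that by (rule mult_nonzero) (use assms in \<open>metis CE_hbar add_0 neq0_conv\<close>)
  then have "{L. (F \<odot> G) L 0 \<noteq> 0} \<subseteq> (\<lambda>(M, N). M + N) ` ({M. F M 0 \<noteq> 0} \<times> {M. G M 0 \<noteq> 0})"
    by force
  then have "finite {L. (F \<odot> G) L 0 \<noteq> 0}"
    using assms unfolding CE_iff by (meson finite_SigmaI finite_imageI finite_subset)
  moreover have "power_series J deg (F \<odot> G)" using assms by (intro power_series_mult CE_power_series)
  moreover have "a = 0 \<and> set_mset L \<inter> range Eta = {}" if "(F \<odot> G) L a \<noteq> 0" for L a
  proof -
    from nz[OF that] obtain M N where "L = M + N" "a = 0" "F M 0 \<noteq> 0" "G N 0 \<noteq> 0" by blast
    moreover from this(3,4) assms have "set_mset M \<inter> range Eta = {}" "set_mset N \<inter> range Eta = {}"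
      unfolding CE_iff by blast+
    ultimately show ?thesis by (simp add: Int_Un_distrib2)
  qed
  ultimately show ?thesis unfolding CE_iff by blast
qed

lemma CE_left_deriv:
  assumes F: "F \<in> CE J deg"
  shows "left_deriv deg v F \<in> CE J deg"
proof -
  have nz: "F (add_mset v M) a \<noteq> 0" if "left_deriv deg v F M a \<noteq> 0" for M a
    using that by (auto simp: left_deriv_def)
  then have "add_mset v ` {M. left_deriv deg v F M 0 \<noteq> 0} \<subseteq> {M. F M 0 \<noteq> 0}" by auto
  then have "finite (add_mset v ` {M. left_deriv deg v F M 0 \<noteq> 0})"
    using F unfolding CE_iff by (meson finite_subset)
  then have "finite {M. left_deriv deg v F M 0 \<noteq> 0}"
    by (rule finite_imageD) (simp add: inj_on_def)
  moreover have "power_series J deg (left_deriv deg v F)"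
    using F by (intro power_series_left_deriv CE_power_series)
  moreover have "a = 0 \<and> set_mset M \<inter> range Eta = {}" if "left_deriv deg v F M a \<noteq> 0" for M a
  proof -
    have "a = 0 \<and> set_mset (add_mset v M) \<inter> range Eta = {}" using nz[OF that] F unfolding CE_iff by blast
    then show ?thesis by auto
  qed
  ultimately show ?thesis unfolding CE_iff by blast
qed

lemma CE_polys: "F \<in> CE J deg \<Longrightarrow> F \<in> polys J {}"
proof (rule polysI)
  assume F: "F \<in> CE J deg"
  have "{(M, a). F M a \<noteq> 0} \<subseteq> {M. F M 0 \<noteq> 0} \<times> {0}" using F unfolding CE_iff by auto
  with F show "finite {(M, a). F M a \<noteq> 0}" unfolding CE_iff by (meson finite.simps finite_SigmaI finite_subset)
  show "admissible deg M \<and> set_mset M \<subseteq> Psi ` J \<union> Eta ` {}" if nz: "F M a \<noteq> 0" for M a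
  proof -
    have "admissible deg M" "set_mset M \<subseteq> Psi ` J \<union> Eta ` J" "set_mset M \<inter> range Eta = {}"
      using F nz unfolding CE_iff power_series_def by blast+
    then show ?thesis by blast
  qed
qed

text \<open>A polynomial contains finitely many variables. This is what permits replacing
  \<open>I\<close> by a finite index set once an argument is given.\<close>

lemma CE_finite_support:
  assumes F: "F \<in> CE K deg"
  shows "\<exists>J. finite J \<and> J \<subseteq> K \<and> F \<in> CE J deg"
proof -
  define J where "J = {i. \<exists>M. F M 0 \<noteq> 0 \<and> Psi i \<in># M}"
  have "Psi ` J \<subseteq> \<Union> (set_mset ` {M. F M 0 \<noteq> 0})" by (auto simp: J_def)
  then have "finite (Psi ` J)" using F unfolding CE_iff by (meson finite_UN_I finite_set_mset finite_subset)
  then have "finite J" by (rule finite_imageD) (simp add: inj_on_def)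
  moreover have "J \<subseteq> K"
    using F unfolding CE_iff power_series_def J_def by blast
  moreover have "power_series J deg F"
    unfolding power_series_def
  proof (intro allI impI conjI subsetI)
    fix M a v assume nz: "F M a \<noteq> 0"
    with F show "admissible deg M" unfolding CE_iff power_series_def by blast
    assume v: "v \<in># M"
    from nz F have "a = 0" "set_mset M \<inter> range Eta = {}" unfolding CE_iff by blast+
    with v nz show "v \<in> Psi ` J \<union> Eta ` J" by (cases v) (auto simp: J_def)
  qed
  then have "F \<in> CE J deg" using CE_subset_mono[OF F] by blast
  ultimately show ?thesis by blast
qed

section \<open>The grading and the partial derivatives as derivations\<close>

lemma homogeneous_zero: "homogeneous deg n 0"
  by (simp add: homogeneous_def)

lemma homogeneous_add: "homogeneous deg n F \<Longrightarrow> homogeneous deg n G \<Longrightarrow> homogeneous deg n (F + G)"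
  unfolding homogeneous_def by (metis add_0 plus_fun_apply)

lemma homogeneous_scale: "homogeneous deg n F \<Longrightarrow> homogeneous deg n (series_scale c F)"
  by (simp add: homogeneous_def series_scale_def)

lemma homogeneous_mult: "homogeneous deg m F \<Longrightarrow> homogeneous deg n G \<Longrightarrow> homogeneous deg (m + n) (F \<odot> G)"
  unfolding homogeneous_def
proof (intro allI impI)
  fix L a assume F: "\<forall>M a. F M a \<noteq> 0 \<longrightarrow> mono_deg deg M + 2 * int a = m"
    and G: "\<forall>M a. G M a \<noteq> 0 \<longrightarrow> mono_deg deg M + 2 * int a = n" and nz: "(F \<odot> G) L a \<noteq> 0"
  from nz obtain M N b c where "L = M + N" "a = b + c" "F M b \<noteq> 0" "G N c \<noteq> 0" by (rule mult_nonzero)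
  with F G have "mono_deg deg M + 2 * int b = m" "mono_deg deg N + 2 * int c = n" by blast+
  with \<open>L = M + N\<close> \<open>a = b + c\<close> show "mono_deg deg L + 2 * int a = m + n" by (simp add: mono_deg_def)
qed

lemma homogeneous_left_deriv: "homogeneous deg n F \<Longrightarrow> homogeneous deg (n - var_deg deg v) (left_deriv deg v F)"
  by (force simp: homogeneous_def left_deriv_def mono_deg_def)

lemma homogeneous_right_deriv: "homogeneous deg n F \<Longrightarrow> homogeneous deg (n - var_deg deg v) (right_deriv deg v F)"
  by (force simp: homogeneous_def right_deriv_def mono_deg_def)

lemma CE_vector_graded: "graded_space series_scale (CE J deg) (CE_component J deg :: int \<Rightarrow> ('i, 'k::field_char_0) series set)"
proof
  fix n
  show "series.subspace (CE_component J deg n :: ('i, 'k) series set)"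
    by (rule series.subspaceI) (auto simp: CE_component_def CE_zero CE_add CE_scale homogeneous_zero homogeneous_add
         homogeneous_scale simp del: plus_fun_apply zero_fun_apply)
next
  show "series.span (\<Union>n. CE_component J deg n) = (CE J deg :: ('i, 'k) series set)"
  proof
    have "series.subspace (CE J deg :: ('i, 'k) series set)"
      by (rule series.subspaceI) (auto simp: CE_zero CE_add CE_scale simp del: plus_fun_apply zero_fun_apply)
    then show "series.span (\<Union>n. CE_component J deg n) \<subseteq> (CE J deg :: ('i, 'k) series set)"
      by (rule series.span_minimal[rotated]) (auto simp: CE_component_def)
    show "(CE J deg :: ('i, 'k) series set) \<subseteq> series.span (\<Union>n. CE_component J deg n)"
    proof
      fix F :: "('i, 'k) series" assume F: "F \<in> CE J deg"
      have "F = (\<Sum>M\<in>{M. F M 0 \<noteq> 0}. series_scale (F M 0) (monomial M 0))"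
      proof (intro ext)
        fix N b
        have "(\<Sum>M\<in>{M. F M 0 \<noteq> 0}. series_scale (F M 0) (monomial M 0)) N b
            = (\<Sum>M\<in>{M. F M 0 \<noteq> 0}. if M = N then F N b else 0)"
          unfolding sum_series_apply using CE_hbar[OF F, of b N]
          by (intro sum.cong) (auto simp: series_scale_def monomial_def)
        then show "F N b = (\<Sum>M\<in>{M. F M 0 \<noteq> 0}. series_scale (F M 0) (monomial M 0)) N b"
          using F CE_hbar[OF F, of b N] unfolding CE_iff by (cases b) auto
      qed
      moreover have "(monomial M 0 :: ('i, 'k) series) \<in> CE_component J deg (mono_deg deg M)" if "F M 0 \<noteq> 0" for M
      proof -
        have "power_series J deg (monomial M 0 :: ('i, 'k) series)" "set_mset M \<inter> range Eta = {}"
          using F that unfolding CE_iff power_series_def by (auto simp: monomial_def split: if_splits)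
        moreover have "{N. monomial M 0 N 0 \<noteq> (0::'k)} = {M}" by (auto simp: monomial_def)
        ultimately have "(monomial M 0 :: ('i, 'k) series) \<in> CE J deg"
          unfolding CE_iff by (auto simp: monomial_def split: if_splits)
        then show ?thesis by (simp add: CE_component_def homogeneous_def monomial_def)
      qed
      then have "(\<Sum>M\<in>{M. F M 0 \<noteq> 0}. series_scale (F M 0) (monomial M 0)) \<in> series.span (\<Union>n. CE_component J deg n)"
        by (intro series.span_sum series.span_scale series.span_base) auto
      ultimately show "F \<in> series.span (\<Union>n. CE_component J deg n)" by metis
    qed
  qed
next
  fix S :: "int set" and x :: "int \<Rightarrow> ('i, 'k) series" and m
  assume S: "finite S" and x: "\<forall>n\<in>S. x n \<in> CE_component J deg n" and sum: "(\<Sum>n\<in>S. x n) = 0" and m: "m \<in> S"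
  show "x m = 0"
  proof (intro ext, rule ccontr)
    fix M a assume nz: "x m M a \<noteq> 0 M a"
    have hom: "x n M a \<noteq> 0 \<Longrightarrow> mono_deg deg M + 2 * int a = n" if "n \<in> S" for n
      using x that by (auto simp: CE_component_def homogeneous_def)
    have "x n M a = (if n = m then x m M a else 0)" if "n \<in> S" for n
      using hom[OF that] hom[OF m] nz by (metis zero_fun_apply)
    then have "(\<Sum>n\<in>S. x n) M a = (\<Sum>n\<in>S. if n = m then x m M a else 0)"
      unfolding sum_series_apply by (rule sum.cong[OF refl])
    then show False using sum nz S m by simp
  qed
qed

theorem CE_graded_comm_algebra:
  "graded_comm_algebra series_scale (CE J deg) (CE_component J deg) (series_mult deg) (series_one :: ('i, 'k::field_char_0) series)"
proof -
  interpret graded_space series_scale "CE J deg" "CE_component J deg :: int \<Rightarrow> ('i, 'k) series set"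
    by (rule CE_vector_graded)
  have adm: "admissible_series F" if "F \<in> CE J deg" for F :: "('i, 'k) series"
    using that CE_power_series power_series_admissible by blast
  have one: "homogeneous deg 0 (series_one :: ('i, 'k) series)"
    by (auto simp: homogeneous_def series_one_def mono_deg_def split: if_splits)
  show ?thesis
    by unfold_locales (auto simp: CE_component_def mult_assoc one_mult adm CE_mult CE_one homogeneous_mult one
         intro: mult_comm_homogeneous simp del: plus_fun_apply)
qed

text \<open>The Koszul sign of moving a derivative along \<open>v\<close> past \<open>F\<close>,
  taken monomial by monomial. Thus the Leibniz rule makes sense for inhomogeneous \<open>F\<close>
  and can be proved by induction on polynomials.\<close>

definition sign_twist :: "'i var \<Rightarrow> ('i, 'k::field_char_0) series \<Rightarrow> ('i, 'k) series" where
  "sign_twist v F = (\<lambda>M a. if odd_var v \<and> odd (odd_size M) then - F M a else F M a)"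

lemma sign_twist_homogeneous: "homogeneous deg n F \<Longrightarrow> sign_twist v F = koszul (var_deg deg v) n F"
proof (intro ext)
  fix M a assume "homogeneous deg n F"
  then have "F M a \<noteq> 0 \<Longrightarrow> odd (odd_size M) \<longleftrightarrow> odd n"
    unfolding homogeneous_def odd_size_mono_deg by (metis dvd_triv_left even_add)
  then show "sign_twist v F M a = koszul (var_deg deg v) n F M a"
    by (cases "F M a = 0") (auto simp: sign_twist_def koszul_series_apply)
qed

lemma sign_twist_linear:
  "sign_twist v (F + G) = sign_twist v F + sign_twist v G"
  "sign_twist v (series_scale c F) = series_scale c (sign_twist v F)"
  "sign_twist v (hbar_mult F) = hbar_mult (sign_twist v F)"
  by (auto simp: sign_twist_def fun_eq_iff series_scale_def hbar_mult_def split: nat.split)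

lemma sign_twist_var_mult:
  "sign_twist v (series_var w \<odot> F) = koszul (var_deg deg v) (var_deg deg w) (series_var w \<odot> sign_twist v F)"
  by (auto simp: sign_twist_def fun_eq_iff koszul_series_apply var_mult_eq dest!: multi_member_split)

lemma left_deriv_mult:
  fixes F G :: "('i, 'k::field_char_0) series"
  assumes "F \<in> polys J {}" "admissible_series G"
  shows "left_deriv deg v (F \<odot> G) = left_deriv deg v F \<odot> G + sign_twist v F \<odot> left_deriv deg v G"
  using assms(1)
proof (induction rule: polys.induct)
  case polys_one
  have "sign_twist v series_one = (series_one :: ('i, 'k) series)"
    by (auto simp: sign_twist_def series_one_def fun_eq_iff)
  then show ?case
    using assms(2) by (simp add: one_mult power_series_left_deriv del: plus_fun_apply zero_fun_apply)
next
  case (polys_psi F i)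
  note adm = polys_admissible[OF polys_psi.hyps(1)]
  show ?case
    using adm assms(2)
    by (simp add: mult_assoc left_deriv_var_mult polys_psi.IH power_series_mult sign_twist_var_mult mult_koszul
       koszul_linear algebra_simps del: plus_fun_apply zero_fun_apply var_deg.simps)
qed (simp_all add: left_deriv_linear sign_twist_linear hbar_mult_mult hbar_mult_linear series_scale_linear
      algebra_simps del: plus_fun_apply zero_fun_apply)

lemma left_deriv_derivation:
  "graded_comm_algebra.derivation (CE_component J deg) (series_mult deg) (- var_deg deg v)
     (left_deriv deg v :: ('i, 'k::field_char_0) series \<Rightarrow> _)"
proof -
  interpret graded_comm_algebra series_scale "CE J deg" "CE_component J deg" "series_mult deg" "series_one :: ('i, 'k) series"
    by (rule CE_graded_comm_algebra)
  have "homogeneous_map (- var_deg deg v) (left_deriv deg v :: ('i, 'k) series \<Rightarrow> _)"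
  proof (rule homogeneous_mapI)
    show "left_deriv deg v F \<in> CE_component J deg (n + - var_deg deg v)"
      if "F \<in> CE_component J deg n" for n and F :: "('i, 'k) series"
      using that homogeneous_left_deriv[of n F v] by (simp add: CE_component_def CE_left_deriv)
  qed (simp add: left_deriv_linear del: plus_fun_apply)
  moreover have "left_deriv deg v (F \<odot> G) = left_deriv deg v F \<odot> G + koszul (- var_deg deg v) m (F \<odot> left_deriv deg v G)"
    if "F \<in> CE_component J deg m" "G \<in> CE_component J deg n" for m n and F G :: "('i, 'k) series"
  proof -
    have "F \<in> polys J {}" "admissible_series G" "homogeneous deg m F"
      using that CE_polys power_series_admissible[OF CE_power_series] by (auto simp: CE_component_def)
    from left_deriv_mult[OF this(1,2), of v] sign_twist_homogeneous[OF this(3), of v] show ?thesis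
      by (simp add: koszul_def mult_koszul del: plus_fun_apply)
  qed
  ultimately show ?thesis unfolding derivation_def by blast
qed

end

section \<open>Coefficients of powers of \<open>\<hbar>\<close>\<close>

text \<open>The coefficient is placed in power 0 of \<hbar>, so that it is again a series and can be
  an element of the Chevalley-Eilenberg algebra.\<close>

definition hbar_coeff :: "nat \<Rightarrow> ('i, 'k::field_char_0) series \<Rightarrow> ('i, 'k) series" where
  "hbar_coeff c F = (\<lambda>M a. if a = 0 then F M c else 0)"

lemma hbar_coeff_linear:
  "hbar_coeff c (F + G) = hbar_coeff c F + hbar_coeff c G"
  "hbar_coeff c (series_scale b F) = series_scale b (hbar_coeff c F)" "hbar_coeff c 0 = 0"
  "hbar_coeff (Suc c) (hbar_mult F) = hbar_coeff c F" "hbar_coeff 0 (hbar_mult F) = 0"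
  by (auto simp: hbar_coeff_def series_scale_def fun_eq_iff)

lemma hbar_coeff_sum: "hbar_coeff c (\<Sum>x\<in>X. f x) = (\<Sum>x\<in>X. hbar_coeff c (f x))"
  by (induction X rule: infinite_finite_induct) (auto simp: hbar_coeff_linear simp del: plus_fun_apply zero_fun_apply)

lemma eta_zero_hbar_coeff: "eta_zero (hbar_coeff c F) = hbar_coeff c (eta_zero F)"
  by (auto simp: eta_zero_def hbar_coeff_def fun_eq_iff)

lemma hbar_deriv_funpow:
  fixes F :: "('i, 'k::field_char_0) series"
  shows "(hbar_deriv ^^ p) F M a = fact (a + p) / fact a * F M (a + p)"
proof (induction p arbitrary: a)
  case (Suc p)
  have "(hbar_deriv ^^ Suc p) F M a = of_nat (Suc a) * (hbar_deriv ^^ p) F M (Suc a)"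
    by (simp add: hbar_deriv_def[of "(hbar_deriv ^^ p) F"])
  also have "\<dots> = of_nat (Suc a) * (fact (Suc a + p) / fact (Suc a)) * F M (Suc a + p)"
    unfolding Suc by (simp only: mult.assoc)
  also have "of_nat (Suc a) * (fact (Suc a + p) / fact (Suc a)) = (fact (Suc a + p) / fact a :: 'k)"
    unfolding fact_Suc[of a] by (simp del: of_nat_Suc fact_Suc)
  finally show ?case by simp
qed simp

text \<open>The factor \<open>fact p\<close> cancels the \<open>1 / fact p\<close> in the formula
  for \<open>CE_Delta\<close>.\<close>

lemma hbar_zero_hbar_deriv: "hbar_zero ((hbar_deriv ^^ p) F) = series_scale (fact p) (hbar_coeff p F)"
  by (auto simp: hbar_zero_def hbar_coeff_def series_scale_def hbar_deriv_funpow fun_eq_iff)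

lemma formal_sum_finite:
  assumes "finite Y" "Y \<subseteq> X" "\<And>x. x \<in> X \<Longrightarrow> x \<notin> Y \<Longrightarrow> f x = 0"
  shows "formal_sum X f = (\<Sum>x\<in>Y. f x)"
proof (intro ext)
  fix M a
  have "x \<in> Y" if "x \<in> X" "f x M a \<noteq> 0" for x
    using assms(3)[of x] that by (metis zero_fun_apply)
  then have "formal_sum X f M a = (\<Sum>x\<in>Y. f x M a)"
    unfolding formal_sum_def using assms(1,2) by (intro sum.mono_neutral_left) auto
  then show "formal_sum X f M a = (\<Sum>x\<in>Y. f x) M a" by (simp add: sum_series_apply)
qed

lemma finite_multi_indices: "finite J \<Longrightarrow> finite (multi_indices J k)"
  unfolding multi_indices_def by (rule finite_lists_length_eq)

context graded_variables
begin

lemma hbar_coeff_mult: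
  assumes "hbar_coeff 0 y = y"
  shows "hbar_coeff b (G \<odot> y) = hbar_coeff b G \<odot> y"
proof (intro ext)
  fix L a
  have y: "y M c = 0" if "c > 0" for M c
    using that assms by (metis hbar_coeff_def neq0_conv)
  have "(G \<odot> y) L b = (\<Sum>M | M \<subseteq># L. mono_sgn M (L - M) * G M b * y (L - M) 0)"
    unfolding series_mult_def
    by (subst sum.remove[of _ b]) (auto intro!: sum.neutral simp: y)
  moreover have "(hbar_coeff b G \<odot> y) L 0 = (\<Sum>M | M \<subseteq># L. mono_sgn M (L - M) * G M b * y (L - M) 0)"
    by (simp add: series_mult_def hbar_coeff_def)
  moreover have "(hbar_coeff b G \<odot> y) L a = 0" if "a > 0"
    unfolding series_mult_def using that by (intro sum.neutral ballI) (auto simp: hbar_coeff_def y)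
  ultimately show "hbar_coeff b (G \<odot> y) L a = (hbar_coeff b G \<odot> y) L a"
    by (auto simp: hbar_coeff_def[of b "G \<odot> y"])
qed

lemma derivs_append:
  "eta_derivs deg (js @ is) F = eta_derivs deg js (eta_derivs deg is F)"
  "psi_derivs deg (js @ is) F = psi_derivs deg js (psi_derivs deg is F)"
  by (simp_all add: eta_derivs_def psi_derivs_def)

lemma derivs_simps [simp]:
  "eta_derivs deg [] F = F" "psi_derivs deg [] F = F"
  "eta_derivs deg (i # is) F = right_deriv deg (Eta i) (eta_derivs deg is F)"
  "psi_derivs deg (i # is) F = left_deriv deg (Psi i) (psi_derivs deg is F)"
  by (simp_all add: eta_derivs_def psi_derivs_def)

lemma contraction_eq_sum:
  "finite J \<Longrightarrow> contraction J k F G = (\<Sum>is\<in>multi_indices J k. eta_derivs deg is F \<odot> psi_derivs deg is G)"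
proof (induction k arbitrary: F G)
  case 0
  have "multi_indices J 0 = {[]}" by (auto simp: multi_indices_def)
  then show ?case by simp
next
  case (Suc k)
  \<comment> \<open>The index contracted by the outermost recursion step belongs to the derivative
    applied first, so it is the last entry of the tuple.\<close>
  have "contraction J (Suc k) F G = (\<Sum>(i, js)\<in>J \<times> multi_indices J k.
      eta_derivs deg (js @ [i]) F \<odot> psi_derivs deg (js @ [i]) G)"
    using Suc by (simp add: derivs_append sum.cartesian_product)
  also have "\<dots> = (\<Sum>is\<in>multi_indices J (Suc k). eta_derivs deg is F \<odot> psi_derivs deg is G)"
    by (rule sum.reindex_bij_witness[of _ "\<lambda>is. (last is, butlast is)" "\<lambda>(i, js). js @ [i]"])
       (auto simp: multi_indices_def length_Suc_conv_rev)
  finally show ?case .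
qed

lemma psi_derivs_linear:
  "psi_derivs deg is 0 = 0" "psi_derivs deg is (F + G) = psi_derivs deg is F + psi_derivs deg is G"
  by (induction "is") (auto simp: left_deriv_linear simp del: plus_fun_apply zero_fun_apply)

lemma eta_derivs_zero: "eta_derivs deg is 0 = 0"
  by (induction "is") (auto simp: right_deriv_linear simp del: plus_fun_apply zero_fun_apply)

lemma power_series_eta_derivs: "power_series J deg F \<Longrightarrow> power_series J deg (eta_derivs deg is F)"
  by (induction "is") (auto intro: power_series_right_deriv)

lemma CE_psi_derivs: "F \<in> CE J deg \<Longrightarrow> psi_derivs deg is F \<in> CE J deg"
  by (induction "is") (auto intro: CE_left_deriv)

lemma psi_derivs_outside:
  assumes "power_series J deg F" "\<not> set is \<subseteq> J"
  shows "psi_derivs deg is F = 0"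
  using assms(2)
proof (induction "is")
  case (Cons i "is")
  have ps: "power_series J deg (psi_derivs deg is F)"
    using assms(1) by (induction "is") (auto intro: power_series_left_deriv)
  show ?case
  proof (cases "set is \<subseteq> J")
    case True
    then have "i \<notin> J" using Cons.prems by simp
    then have "psi_derivs deg is F (add_mset (Psi i) M) a = 0" for M a
      using ps unfolding power_series_def by force
    then show ?thesis by (simp add: left_deriv_def fun_eq_iff)
  qed (use Cons.IH in \<open>simp add: left_deriv_linear del: zero_fun_apply\<close>)
qed simp

text \<open>A coefficient of an iterated derivative depends on a single coefficient of
  \<open>F\<close>. This locality decides which terms of \<Gamma> a truncation has to keep.\<close>

lemma eta_derivs_cong:
  "F (M + image_mset Eta (mset is)) a = F' (M + image_mset Eta (mset is)) a \<Longrightarrow>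
    eta_derivs deg is F M a = eta_derivs deg is F' M a"
  by (induction "is" arbitrary: M) (simp_all add: right_deriv_def)

lemma psi_derivs_cong:
  "F (M + image_mset Psi (mset is)) a = F' (M + image_mset Psi (mset is)) a \<Longrightarrow>
    psi_derivs deg is F M a = psi_derivs deg is F' M a"
  by (induction "is" arbitrary: M) (simp_all add: left_deriv_def)

lemma eta_derivs_nonzero: "eta_derivs deg is F M a \<noteq> 0 \<Longrightarrow> F (M + image_mset Eta (mset is)) a \<noteq> 0"
  using eta_derivs_cong[of F M "is" a 0] by (auto simp: eta_derivs_zero)

lemma psi_derivs_nonzero: "psi_derivs deg is F M a \<noteq> 0 \<Longrightarrow> F (M + image_mset Psi (mset is)) a \<noteq> 0"
  using psi_derivs_cong[of F M "is" a 0] by (auto simp: psi_derivs_linear)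

lemma CE_hbar_coeff: "x \<in> CE J deg \<Longrightarrow> hbar_coeff c x = (if c = 0 then x else 0)"
  by (auto simp: hbar_coeff_def fun_eq_iff dest: CE_hbar)

lemma hbar_coeff_act:
  assumes "finite J" "x \<in> CE K deg"
  shows "hbar_coeff c (act J F x) = (\<Sum>k\<le>c. series_scale (1 / fact k) (\<Sum>is\<in>multi_indices J k.
    eta_zero (hbar_coeff (c - k) (eta_derivs deg is F)) \<odot> psi_derivs deg is x))"
proof -
  have "hbar_coeff c (star J F x) = (\<Sum>k\<le>c. series_scale (1 / fact k) (hbar_coeff (c - k) (contraction J k F x)))"
    by (auto simp: fun_eq_iff hbar_coeff_def star_def sum_series_apply series_scale_def)
  also have "\<dots> = (\<Sum>k\<le>c. series_scale (1 / fact k) (\<Sum>is\<in>multi_indices J k.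
    hbar_coeff (c - k) (eta_derivs deg is F) \<odot> psi_derivs deg is x))"
    using CE_psi_derivs[OF assms(2)]
    by (simp add: contraction_eq_sum[OF assms(1)] hbar_coeff_sum hbar_coeff_mult CE_hbar_coeff[of _ K])
  finally show ?thesis
    using CE_psi_derivs[OF assms(2)]
    by (simp add: act_def flip: eta_zero_hbar_coeff)
       (simp add: eta_zero_sum eta_zero_linear eta_zero_mult CE_eta_zero[of _ K])
qed

lemma act_scale: "act J F (series_scale c x) = series_scale c (act J F x)"
  by (simp add: act_def star_linear eta_zero_linear)

text \<open>The action is linear in \<hbar>, but the result of one application contains higher
  powers of \<hbar>; this Cauchy product formula describes a second application.\<close>

lemma hbar_coeff_act_sum:
  fixes y :: "('i, 'k::field_char_0) series"
  shows "hbar_coeff c (act J F y) = (\<Sum>b\<le>c. hbar_coeff (c - b) (act J F (hbar_coeff b y)))"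
proof (induction c arbitrary: y)
  have split: "y = hbar_coeff 0 y + hbar_mult (\<lambda>M a. y M (Suc a))" for y :: "('i, 'k::field_char_0) series"
    by (auto simp: fun_eq_iff hbar_coeff_def hbar_mult_def split: nat.split)
  {
    case 0
    show ?case
      by (subst split) (simp add: act_linear hbar_coeff_linear del: plus_fun_apply zero_fun_apply)
  next
    case (Suc c)
    have "hbar_coeff (Suc c) (act J F y) = hbar_coeff (Suc c) (act J F (hbar_coeff 0 y)) +
        hbar_coeff c (act J F (\<lambda>M a. y M (Suc a)))"
      by (subst split) (simp add: act_linear hbar_coeff_linear del: plus_fun_apply zero_fun_apply)
    also have "hbar_coeff c (act J F (\<lambda>M a. y M (Suc a))) =
       (\<Sum>b\<le>c. hbar_coeff (c - b) (act J F (hbar_coeff b (\<lambda>M a. y M (Suc a)))))"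
      by (rule Suc.IH)
    also have "\<dots> = (\<Sum>b\<le>c. hbar_coeff (Suc c - Suc b) (act J F (hbar_coeff (Suc b) y)))"
      by (simp add: hbar_coeff_def[of _ y] hbar_coeff_def[of _ "\<lambda>M a. y M (Suc a)"])
    finally show ?case
      by (simp add: sum.atMost_Suc_shift del: sum.atMost_Suc plus_fun_apply)
  }
qed

lemma homogeneous_eta_derivs:
  "homogeneous deg n F \<Longrightarrow> homogeneous deg (n - (\<Sum>i\<leftarrow>is. 1 - deg i)) (eta_derivs deg is F)"
proof (induction "is")
  case (Cons i "is")
  from homogeneous_right_deriv[OF Cons.IH[OF Cons.prems], of "Eta i"] show ?case
    by (simp add: algebra_simps)
qed simp

lemma homogeneous_hbar_coeff: "homogeneous deg n F \<Longrightarrow> homogeneous deg (n - 2 * int c) (hbar_coeff c F)"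
  unfolding homogeneous_def
proof (intro allI impI)
  fix M a assume F: "\<forall>M a. F M a \<noteq> 0 \<longrightarrow> mono_deg deg M + 2 * int a = n" and "hbar_coeff c F M a \<noteq> 0"
  then have "a = 0" "F M c \<noteq> 0" by (auto simp: hbar_coeff_def split: if_splits)
  with F[rule_format, of M c] show "mono_deg deg M + 2 * int a = n - 2 * int c" by simp
qed

lemma homogeneous_eta_zero: "homogeneous deg n F \<Longrightarrow> homogeneous deg n (eta_zero F)"
  by (auto simp: homogeneous_def eta_zero_def split: if_splits)

text \<open>Only the products of coefficients have to agree: where one factor vanishes on both
  sides, the other may differ.\<close>

lemma mult_coeff_cong:
  assumes "\<And>M N b c. L = M + N \<Longrightarrow> a = b + c \<Longrightarrow> F M b * G N c = F' M b * G' N c"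
  shows "(F \<odot> G) L a = (F' \<odot> G') L a"
  unfolding mult_splits by (rule sum.cong) (auto simp: splits_def mult.assoc assms)

end

text \<open>The multibracket evaluates \<open>D\<close> only at products of its arguments, so
  agreement on a multiplicatively closed set that contains them is enough.\<close>

lemma order_bracket_cong:
  assumes "\<And>v. v \<in> S \<Longrightarrow> D v = D' v" "\<And>v w. v \<in> S \<Longrightarrow> w \<in> S \<Longrightarrow> mul v w \<in> S"
  shows "snd ` set vs \<subseteq> S \<Longrightarrow> order_bracket mul D vs = order_bracket mul D' vs"
proof (induction vs rule: measure_induct_rule[of length])
  case (less vs)
  show ?case
  proof (cases vs)
    case (Cons p ws)
    obtain n w where p: "p = (n, w)" by (cases p)
    show ?thesis
    proof (cases ws)
      case Nil
      then show ?thesis using less.prems assms(1) by (simp add: Cons p)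
    next
      case (Cons q us)
      obtain m v where q: "q = (m, v)" by (cases q)
      show ?thesis
        using less.IH[of "(m + n, mul v w) # us"] less.IH[of "(m, v) # us"] less.IH[of "(n, w) # us"] less.prems assms(2)
        by (simp add: \<open>vs = p # ws\<close> Cons p q)
    qed
  qed simp
qed

lemma inputs_simps [simp]:
  "inputs {#} = 0" "inputs (M + N) = inputs M + inputs N"
  "inputs (image_mset Eta B) = size B" "inputs (image_mset Psi B) = 0"
  by (simp_all add: inputs_def) (induction B; auto)+

lemma outputs_simps [simp]:
  "outputs {#} = 0" "outputs (M + N) = outputs M + outputs N"
  "outputs (image_mset Psi B) = size B" "outputs (image_mset Eta B) = 0"
  by (simp_all add: outputs_def) (induction B; auto)+

lemma psi_eta_decomposition:
  obtains M' N' where "M = image_mset Psi M' + image_mset Eta N'"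
proof -
  have "\<exists>M' N'. M = image_mset Psi M' + image_mset Eta N'"
  proof (induction M)
    case (add v M)
    then obtain M' N' where "M = image_mset Psi M' + image_mset Eta N'" by blast
    then have "add_mset v M = (case v of Psi i \<Rightarrow> image_mset Psi (add_mset i M') + image_mset Eta N'
        | Eta i \<Rightarrow> image_mset Psi M' + image_mset Eta (add_mset i N'))"
      by (simp split: var.split)
    then show ?case by (cases v) (metis var.case(1), metis var.case(2))
  qed (metis add_0 image_mset_empty)
  then show ?thesis using that by blast
qed

section \<open>The operators of a Maurer-Cartan series\<close>

text \<open>The properties of \<Gamma> from which the operators are studied.
  \<open>Gamma_finite\<close> combines goodness with \<open>operations\<close>: for given inputs and
  weight, there are finitely many output monomials over all numbers of outputs together.\<close>

locale bv_series = graded_variables deg for deg :: "'i::linorder \<Rightarrow> int" +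
  fixes I :: "'i set" and \<Gamma> :: "('i, 'k::field_char_0) series"
  assumes Gamma_series: "power_series I deg \<Gamma>"
    and Gamma_degree: "homogeneous deg 3 \<Gamma>"
    and Gamma_finite: "finite {M. set_mset M \<subseteq> range Psi \<and> \<Gamma> (M + image_mset Eta N) a \<noteq> 0}"
    and Gamma_eta_zero: "eta_zero \<Gamma> = 0"
    and Gamma_master: "hbar_times_star I deg \<Gamma> \<Gamma> = 0"
begin

sublocale CE: graded_comm_algebra series_scale "CE I deg" "CE_component I deg" "series_mult deg"
  "series_one :: ('i, 'k) series"
  by (rule CE_graded_comm_algebra)

definition operator :: "nat \<Rightarrow> ('i, 'k) series \<Rightarrow> ('i, 'k) series" where
  "operator a x = (if a = 0 then CE_Delta0 I deg \<Gamma> x else CE_Delta I deg \<Gamma> a x)"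

definition op_coeff :: "nat \<Rightarrow> 'i list \<Rightarrow> ('i, 'k) series" where
  "op_coeff p is = eta_zero (hbar_coeff p (eta_derivs deg is \<Gamma>))"

lemma op_coeff_Nil: "op_coeff p [] = 0"
  using Gamma_eta_zero by (simp add: op_coeff_def eta_zero_hbar_coeff hbar_coeff_linear del: zero_fun_apply)

lemma op_coeff_component: "op_coeff p is \<in> CE_component I deg (3 - 2 * int p - (\<Sum>i\<leftarrow>is. 1 - deg i))"
proof -
  have nz: "a = 0 \<and> set_mset M \<inter> range Eta = {} \<and> eta_derivs deg is \<Gamma> M p \<noteq> 0"
    if "op_coeff p is M a \<noteq> 0" for M a
    using that by (auto simp: op_coeff_def eta_zero_def hbar_coeff_def split: if_splits)
  have psi: "set_mset M \<subseteq> range Psi" if "set_mset M \<inter> range Eta = {}" for M :: "'i var multiset"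
    using that by (metis Int_iff empty_iff rangeI subsetI var.exhaust)
  have "{M. op_coeff p is M 0 \<noteq> 0} \<subseteq> {M. set_mset M \<subseteq> range Psi \<and> \<Gamma> (M + image_mset Eta (mset is)) p \<noteq> 0}"
    using nz psi eta_derivs_nonzero[of "is" \<Gamma>] by blast
  then have "finite {M. op_coeff p is M 0 \<noteq> 0}" using Gamma_finite by (rule finite_subset)
  moreover have "power_series I deg (op_coeff p is)"
    using power_series_eta_derivs[OF Gamma_series] by (rule power_seriesI) (use nz in blast)
  ultimately have "op_coeff p is \<in> CE I deg" using nz unfolding CE_iff by blast
  moreover have "homogeneous deg (3 - 2 * int p - (\<Sum>i\<leftarrow>is. 1 - deg i)) (op_coeff p is)"
    using homogeneous_eta_zero[OF homogeneous_hbar_coeff[OF homogeneous_eta_derivs[OF Gamma_degree, of "is"], of p]]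
    by (simp add: op_coeff_def algebra_simps)
  ultimately show ?thesis by (simp add: CE_component_def)
qed

lemma hbar_coeff_act_Gamma:
  assumes "finite J" "x \<in> CE I deg"
  shows "hbar_coeff c (act J \<Gamma> x) = (\<Sum>k\<le>c. series_scale (1 / fact k) (\<Sum>is\<in>multi_indices J k.
    op_coeff (c - k) is \<odot> psi_derivs deg is x))"
  by (simp add: hbar_coeff_act[OF assms] op_coeff_def)

text \<open>Derivatives along indices outside \<open>J\<close> kill \<open>x\<close>, so the formal
  sums over \<open>I\<close> reduce to finite ones, and \<open>p\<close> is determined by the number
  \<open>k\<close> of derivatives.\<close>

lemma operator_eq:
  assumes J: "finite J" "J \<subseteq> I" and x: "x \<in> CE J deg"
  shows "operator a x = hbar_coeff (a + 1) (act J \<Gamma> x)"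
proof -
  have xI: "x \<in> CE I deg" using CE_mono[OF x J(2)] .
  have out: "psi_derivs deg is x = 0" if "is \<notin> multi_indices J k" "is \<in> multi_indices I k" for k "is"
    using that psi_derivs_outside[OF CE_power_series[OF x]] by (auto simp: multi_indices_def)
  have sub: "multi_indices J k \<subseteq> multi_indices I k" for k
    using J(2) by (auto simp: multi_indices_def)
  show ?thesis
  proof (cases "a = 0")
    case True
    have "CE_Delta0 I deg \<Gamma> x = (\<Sum>i\<in>J. op_coeff 0 [i] \<odot> left_deriv deg (Psi i) x)"
    proof -
      have hz: "hbar_zero F = hbar_coeff 0 F" for F :: "('i, 'k) series"
        by (simp add: hbar_zero_def hbar_coeff_def)
      have "left_deriv deg (Psi i) x = 0" if "i \<notin> J" for i
        using psi_derivs_outside[OF CE_power_series[OF x], of "[i]"] that by simp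
      then show ?thesis
        unfolding CE_Delta0_def using J
        by (subst formal_sum_finite[of J]) (auto simp: op_coeff_def hz simp del: zero_fun_apply)
    qed
    also have "\<dots> = (\<Sum>is\<in>multi_indices J 1. op_coeff 0 is \<odot> psi_derivs deg is x)"
      by (rule sum.reindex_bij_witness[of _ hd "\<lambda>i. [i]"]) (auto simp: multi_indices_def length_Suc_conv)
    \<comment> \<open>The coefficient of \<hbar> also has a summand without derivatives; it is zero
      by \<open>op_coeff_Nil\<close>.\<close>
    also have "\<dots> = hbar_coeff 1 (act J \<Gamma> x)"
    proof -
      have "multi_indices J 0 = {[]}" by (auto simp: multi_indices_def)
      then show ?thesis by (simp add: hbar_coeff_act_Gamma[OF J(1) xI] op_coeff_Nil series_scale_linear del: zero_fun_apply)
    qed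
    finally show ?thesis using True by (simp add: operator_def)
  next
    case False
    have summand: "series_scale (1 / (fact p * fact k)) (formal_sum (multi_indices I k) (\<lambda>is.
          eta_zero (hbar_zero ((hbar_deriv ^^ p) (eta_derivs deg is \<Gamma>))) \<odot> psi_derivs deg is x))
        = series_scale (1 / fact k) (\<Sum>is\<in>multi_indices J k. op_coeff p is \<odot> psi_derivs deg is x)" for p k
    proof -
      have "formal_sum (multi_indices I k) (\<lambda>is.
          eta_zero (hbar_zero ((hbar_deriv ^^ p) (eta_derivs deg is \<Gamma>))) \<odot> psi_derivs deg is x)
        = (\<Sum>is\<in>multi_indices J k. series_scale (fact p) (op_coeff p is \<odot> psi_derivs deg is x))"
        using out by (subst formal_sum_finite[OF finite_multi_indices[OF J(1)] sub])
           (auto simp: hbar_zero_hbar_deriv eta_zero_linear op_coeff_def simp del: zero_fun_apply)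
      then show ?thesis by (simp add: series_scale_linear flip: series_scale_sum)
    qed
    have "CE_Delta I deg \<Gamma> a x = (\<Sum>(p, k) | p + k = a + 1. series_scale (1 / fact k)
        (\<Sum>is\<in>multi_indices J k. op_coeff p is \<odot> psi_derivs deg is x))"
      unfolding CE_Delta_def summand ..
    also have "\<dots> = (\<Sum>k\<le>a + 1. series_scale (1 / fact k) (\<Sum>is\<in>multi_indices J k. op_coeff (a + 1 - k) is \<odot> psi_derivs deg is x))"
      by (rule sum.reindex_bij_witness[of _ "\<lambda>k. (a + 1 - k, k)" snd]) (auto dest!: sym[of _ "Suc a"])
    finally show ?thesis using False by (simp add: operator_def hbar_coeff_act_Gamma[OF J(1) xI])
  qed
qed

text \<open>The last index is differentiated first, hence induction from the end of the list. The
  empty list is excluded: it gives the identity, which is not \<open>diffop 0\<close>.\<close>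

lemma psi_derivs_diffop:
  "is \<noteq> [] \<Longrightarrow> CE.diffop (length is) (- (\<Sum>i\<leftarrow>is. deg i + 1)) (psi_derivs deg is)"
proof (induction "is" rule: rev_induct)
  case (snoc i "is")
  have d: "CE.derivation (- (deg i + 1)) (left_deriv deg (Psi i))"
    using left_deriv_derivation[of I "Psi i"] by simp
  show ?case
  proof (cases "is = []")
    case True
    have "psi_derivs deg [i] = left_deriv deg (Psi i)" by (rule ext) simp
    with True d show ?thesis using CE.derivation_iff_diffop by simp
  next
    case False
    have eq: "psi_derivs deg (is @ [i]) = (\<lambda>x. psi_derivs deg is (left_deriv deg (Psi i) x))"
      by (rule ext) (simp add: derivs_append)
    have sum: "(\<Sum>i\<leftarrow>is @ [i]. deg i + 1) = (\<Sum>i\<leftarrow>is. deg i + 1) + (deg i + 1)"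
      by simp
    show ?thesis
      unfolding eq sum length_append_singleton minus_add_distrib
      using CE.diffop_comp_derivation[OF d snoc.IH[OF False]] unfolding minus_add_distrib .
  qed
qed simp

lemma act_diffop:
  assumes J: "finite J"
  shows "CE.diffop c (3 - 2 * int c) (\<lambda>x. hbar_coeff c (act J \<Gamma> x))"
proof (rule CE.diffop_cong)
  have "CE.diffop c (3 - 2 * int c) (\<lambda>x. series_scale (1 / fact k) (op_coeff (c - k) is) \<odot> psi_derivs deg is x)"
    if k: "k \<le> c" and "is": "is \<in> multi_indices J k" for k "is"
  proof (cases "is = []")
    case True
    then show ?thesis
      using CE.diffop_zero by (simp add: op_coeff_Nil series_scale_linear del: zero_fun_apply)
  next
    case False
    have len: "length is = k" using "is" by (simp add: multi_indices_def)
    \<comment> \<open>An \<eta>-derivative of \<Gamma> and the matching \<psi>-derivative of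
      \<open>x\<close> lower the degree by 2 together, as much as the factor \<hbar> of that
      contraction.\<close>
    have deg: "3 - 2 * int (c - k) - (\<Sum>i\<leftarrow>is. 1 - deg i) + - (\<Sum>i\<leftarrow>is. deg i + 1) = 3 - 2 * int c"
    proof -
      have "(\<Sum>i\<leftarrow>is. 1 - deg i) + (\<Sum>i\<leftarrow>is. deg i + 1) = 2 * int k"
        unfolding len[symmetric] by (induction "is") auto
      with k show ?thesis by (simp add: of_nat_diff)
    qed
    have "series_scale (1 / fact k) (op_coeff (c - k) is) \<in> CE_component I deg (3 - 2 * int (c - k) - (\<Sum>i\<leftarrow>is. 1 - deg i))"
      using op_coeff_component by (simp add: CE_component_def CE_scale homogeneous_scale)
    from CE.diffop_mult_left[OF this psi_derivs_diffop[OF False]]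
    show ?thesis unfolding deg len using k by (rule CE.diffop_mono)
  qed
  then show "CE.diffop c (3 - 2 * int c) (\<lambda>x. \<Sum>k\<le>c. \<Sum>is\<in>multi_indices J k.
      series_scale (1 / fact k) (op_coeff (c - k) is) \<odot> psi_derivs deg is x)"
    by (intro CE.diffop_sum) auto
  show "(\<Sum>k\<le>c. \<Sum>is\<in>multi_indices J k. series_scale (1 / fact k) (op_coeff (c - k) is) \<odot> psi_derivs deg is x)
      = hbar_coeff c (act J \<Gamma> x)" if "x \<in> CE_component I deg n" for n x
    using that by (simp add: hbar_coeff_act_Gamma[OF J] CE_component_def series_scale_sum)
qed

lemma act_linear_of_degree:
  assumes J: "finite J"
  shows "CE.linear_of_degree (3 - 2 * int c) (\<lambda>x. hbar_coeff c (act J \<Gamma> x))"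
  unfolding CE.linear_of_degree_def
  using CE.homogeneous_mapD(1)[OF CE.diffop_homogeneous_map[OF act_diffop[OF J, of c]]]
  by (auto simp: act_linear act_scale hbar_coeff_linear simp del: plus_fun_apply)

text \<open>\<open>act\<close> depends on the index set, so an identity between several arguments
  needs one \<open>J\<close> that serves all of them.\<close>

lemma CE_common_support:
  assumes "finite X" "X \<subseteq> CE K deg"
  obtains J where "finite J" "J \<subseteq> K" "X \<subseteq> CE J deg"
proof -
  have "\<forall>x\<in>X. \<exists>J. finite J \<and> J \<subseteq> K \<and> x \<in> CE J deg" using assms(2) CE_finite_support by blast
  then obtain J where J: "\<And>x. x \<in> X \<Longrightarrow> finite (J x) \<and> J x \<subseteq> K \<and> x \<in> CE (J x) deg" by metis
  show ?thesis
  proof (rule that[of "\<Union>x\<in>X. J x"])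
    show "X \<subseteq> CE (\<Union>x\<in>X. J x) deg"
    proof
      fix x assume "x \<in> X"
      then show "x \<in> CE (\<Union>x\<in>X. J x) deg" using J[of x] CE_mono[of x "J x"] by blast
    qed
  qed (use J assms(1) in auto)
qed

lemma operator_linear_of_degree: "CE.linear_of_degree (1 - 2 * int a) (operator a)"
proof -
  have *: "operator a (x + y) = operator a x + operator a y"
    "operator a (series_scale c x) = series_scale c (operator a x)"
    "x \<in> CE_component I deg n \<Longrightarrow> operator a x \<in> CE_component I deg (n + (1 - 2 * int a))"
    if xy: "x \<in> CE I deg" "y \<in> CE I deg" for x y c n
  proof -
    obtain J where J: "finite J" "J \<subseteq> I" "{x, y} \<subseteq> CE J deg"
      using CE_common_support[of "{x, y}" I] xy by blast
    then have J': "x \<in> CE J deg" "y \<in> CE J deg" "x + y \<in> CE J deg" "series_scale c x \<in> CE J deg"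
      by (auto intro: CE_scale simp: CE_add simp del: plus_fun_apply)
    note lin = act_linear_of_degree[OF J(1), of "a + 1", unfolded CE.linear_of_degree_def]
    show "operator a (x + y) = operator a x + operator a y"
      "operator a (series_scale c x) = series_scale c (operator a x)"
      using lin xy by (simp_all add: operator_eq[OF J(1,2)] J' del: plus_fun_apply)
    show "operator a x \<in> CE_component I deg (n + (1 - 2 * int a))" if "x \<in> CE_component I deg n"
      using lin that by (simp add: operator_eq[OF J(1,2)] J')
  qed
  have sub: "x \<in> CE_component I deg n \<Longrightarrow> x \<in> CE I deg" for x :: "('i, 'k) series" and n
    by (simp add: CE_component_def)
  show ?thesis unfolding CE.linear_of_degree_def using * sub by blast
qed

lemma operator_order: "CE.order_le (a + 1) (operator a)"
  unfolding CE.order_le_def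
proof (intro allI impI, elim conjE)
  fix vs :: "(int \<times> ('i, 'k) series) list"
  assume len: "length vs = a + 1 + 1" and vs: "\<forall>(m, v)\<in>set vs. v \<in> CE_component I deg m"
  then have "snd ` set vs \<subseteq> CE I deg" by (auto simp: CE_component_def)
  then obtain J where J: "finite J" "J \<subseteq> I" "snd ` set vs \<subseteq> CE J deg"
    using CE_common_support[of "snd ` set vs" I] by blast
  have "order_bracket (series_mult deg) (operator a) vs =
      order_bracket (series_mult deg) (\<lambda>x. hbar_coeff (a + 1) (act J \<Gamma> x)) vs"
    using J by (intro order_bracket_cong[of "CE J deg"] operator_eq CE_mult)
  also have "\<dots> = 0"
    using CE.diffop_order_le[OF act_diffop[OF J(1), of "a + 1"]] len vs unfolding CE.order_le_def by blast
  finally show "order_bracket (series_mult deg) (operator a) vs = 0" .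
qed

lemma operator_0_leibniz:
  assumes x: "x \<in> CE_component I deg m" and y: "y \<in> CE I deg"
  shows "operator 0 (x \<odot> y) = operator 0 x \<odot> y + koszul 1 m (x \<odot> operator 0 y)"
proof -
  have "x \<in> CE I deg" using x by (simp add: CE_component_def)
  with y obtain J where J: "finite J" "J \<subseteq> I" "{x, y} \<subseteq> CE J deg"
    using CE_common_support[of "{x, y}" I] by blast
  then have "x \<in> CE J deg" "y \<in> CE J deg" "x \<odot> y \<in> CE J deg" by (auto intro: CE_mult)
  with CE.derivation_leibniz[OF act_linear_of_degree[OF J(1), of 1] act_diffop[OF J(1), of 1] x y] show ?thesis
    by (simp add: operator_eq[OF J(1,2)] del: plus_fun_apply CE.diffop.simps)
qed

end

section \<open>The relations between the operators\<close>

context bv_series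
begin

text \<open>The \<psi> in these terms are not restricted; \<open>Gamma_finite\<close> bounds them
  once the \<eta> and the power of \<hbar> are bounded.\<close>

definition bounded_terms :: "'i set \<Rightarrow> nat \<Rightarrow> nat \<Rightarrow> ('i var multiset \<times> nat) set" where
  "bounded_terms J D P = {(M, p). \<Gamma> M p \<noteq> 0 \<and> p \<le> P \<and> (\<forall>j. Eta j \<in># M \<longrightarrow> j \<in> J) \<and> inputs M \<le> D}"

definition term_indices :: "('i var multiset \<times> nat) set \<Rightarrow> 'i set" where
  "term_indices T = {i. \<exists>(M, p)\<in>T. Psi i \<in># M \<or> Eta i \<in># M}"

definition truncation :: "('i var multiset \<times> nat) set \<Rightarrow> ('i, 'k) series" where
  "truncation T = (\<lambda>M p. if (M, p) \<in> T then \<Gamma> M p else 0)"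

lemma finite_bounded_terms:
  assumes "finite J"
  shows "finite (bounded_terms J D P)"
proof -
  define NN where "NN = mset ` {xs. set xs \<subseteq> J \<and> length xs \<le> D}"
  have "finite NN" unfolding NN_def using finite_lists_length_le[OF assms] by blast
  moreover have "bounded_terms J D P \<subseteq> (\<Union>N\<in>NN. \<Union>p\<in>{..P}.
     (\<lambda>M. (M + image_mset Eta N, p)) ` {M. set_mset M \<subseteq> range Psi \<and> \<Gamma> (M + image_mset Eta N) p \<noteq> 0})"
  proof (clarify)
    fix M p assume *: "(M, p) \<in> bounded_terms J D P"
    obtain M' N where M: "M = image_mset Psi M' + image_mset Eta N" by (rule psi_eta_decomposition)
    obtain xs where xs: "mset xs = N" using ex_mset by blast
    have "set xs \<subseteq> J" "length xs \<le> D"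
      using * by (auto simp: bounded_terms_def M simp flip: xs)
    then have "N \<in> NN" using xs by (auto simp: NN_def)
    moreover have "p \<le> P" "\<Gamma> M p \<noteq> 0" using * by (auto simp: bounded_terms_def)
    moreover have "set_mset (image_mset Psi M') \<subseteq> range Psi" by auto
    ultimately show "(M, p) \<in> (\<Union>N\<in>NN. \<Union>p\<in>{..P}.
     (\<lambda>M. (M + image_mset Eta N, p)) ` {M. set_mset M \<subseteq> range Psi \<and> \<Gamma> (M + image_mset Eta N) p \<noteq> 0})"
      unfolding M by blast
  qed
  ultimately show ?thesis
    using Gamma_finite by (elim finite_subset) (intro finite_UN_I finite_imageI; simp)
qed

lemma finite_term_indices:
  assumes "finite T"
  shows "finite (term_indices T)"
proof -
  have "term_indices T \<subseteq> (\<Union>(M, p)\<in>T. (Psi -` set_mset M) \<union> (Eta -` set_mset M))"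
    by (auto simp: term_indices_def)
  moreover have "finite (\<Union>(M, p)\<in>T. (Psi -` set_mset M) \<union> (Eta -` set_mset M))"
    using assms by (auto intro!: finite_vimageI simp: inj_on_def)
  ultimately show ?thesis by (rule finite_subset)
qed

lemma term_indices_subset: "term_indices (bounded_terms J D P) \<subseteq> I"
  using Gamma_series unfolding term_indices_def bounded_terms_def power_series_def by blast

lemma truncation_polys:
  assumes "finite T" "term_indices T \<subseteq> J"
  shows "truncation T \<in> polys J J"
proof (rule polysI)
  have "{(M, a). truncation T M a \<noteq> 0} \<subseteq> T" by (auto simp: truncation_def)
  then show "finite {(M, a). truncation T M a \<noteq> 0}" using assms(1) by (rule finite_subset)
  show "admissible deg M \<and> set_mset M \<subseteq> Psi ` J \<union> Eta ` J" if "truncation T M a \<noteq> 0" for M a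
  proof -
    have T: "(M, a) \<in> T" "\<Gamma> M a \<noteq> 0" using that by (auto simp: truncation_def split: if_splits)
    have "v \<in> Psi ` J \<union> Eta ` J" if "v \<in># M" for v
      using that T(1) assms(2) by (cases v) (auto simp: term_indices_def)
    then show ?thesis using T(2) Gamma_series unfolding power_series_def by blast
  qed
qed

lemma truncation_bounded:
  assumes "p \<le> P" "\<And>j. Eta j \<in># M \<Longrightarrow> j \<in> J" "inputs M \<le> D"
  shows "truncation (bounded_terms J D P) M p = \<Gamma> M p"
  using assms by (auto simp: truncation_def bounded_terms_def)

text \<open>At the monomial \<open>L\<close>, the second factor has only \<eta> from
  \<open>L\<close>, so its terms lie in \<open>T0\<close> and the contracted indices in
  \<open>J1\<close>. The first factor has \<eta> from \<open>L\<close> and contracted ones: at most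
  \<open>P\<close> of each, whence the bound \<open>2 * P\<close> and the set \<open>J1\<close> in
  \<open>T1\<close>.\<close>

lemma star_truncation:
  fixes P :: nat and J :: "'i set"
  defines "T0 \<equiv> bounded_terms J P P"
  defines "J1 \<equiv> J \<union> term_indices T0"
  defines "T1 \<equiv> bounded_terms J1 (2 * P) P"
  defines "J2 \<equiv> J1 \<union> term_indices T1"
  assumes J: "finite J" "J \<subseteq> I"
    and L: "\<And>j. Eta j \<in># L \<Longrightarrow> j \<in> J" "inputs L \<le> P" "p \<le> P"
  shows "star J2 (truncation T1) (truncation T1) L p = 0"
proof -
  have fin: "finite J1" "finite J2"
    using J(1) by (simp_all add: J1_def J2_def T0_def T1_def finite_bounded_terms finite_term_indices)
  have sub: "J1 \<subseteq> J2" "J2 \<subseteq> I"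
    using J(2) term_indices_subset by (auto simp: J1_def J2_def T0_def T1_def)
  let ?f = "\<lambda>F is. eta_derivs deg is F \<odot> psi_derivs deg is F"
  have outside: "psi_derivs deg is \<Gamma> N c = 0"
    if "\<not> set is \<subseteq> J1" "N \<subseteq># L" "c \<le> P" for "is" N c
  proof (rule ccontr)
    assume "psi_derivs deg is \<Gamma> N c \<noteq> 0"
    then have "\<Gamma> (N + image_mset Psi (mset is)) c \<noteq> 0" by (rule psi_derivs_nonzero)
    moreover have "j \<in> J" if "Eta j \<in># N + image_mset Psi (mset is)" for j
      using that L(1) \<open>N \<subseteq># L\<close> by (auto dest: mset_subset_eqD)
    moreover have "inputs N \<le> inputs L" using \<open>N \<subseteq># L\<close> by (metis inputs_simps(2) le_add1 mset_subset_eq_exists_conv)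
    ultimately have "(N + image_mset Psi (mset is), c) \<in> T0"
      using L(2) \<open>c \<le> P\<close> by (auto simp: T0_def bounded_terms_def)
    then have "set is \<subseteq> term_indices T0"
      unfolding term_indices_def by (intro subsetI CollectI bexI[of _ "(N + image_mset Psi (mset is), c)"]) auto
    with that(1) show False by (auto simp: J1_def)
  qed
  have zero: "?f \<Gamma> is L q = 0" if "\<not> set is \<subseteq> J1" "q \<le> P" for "is" q
  proof -
    have "?f \<Gamma> is L q = (eta_derivs deg is \<Gamma> \<odot> 0) L q"
      by (rule mult_coeff_cong) (use outside[OF that(1)] that(2) in auto)
    then show ?thesis by simp
  qed
  \<comment> \<open>If a contracted index lies outside \<open>J1\<close>, the first factors may
    differ, but the second factor vanishes for \<Gamma> and for its truncation alike.\<close>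
  have agree: "?f (truncation T1) is L q = ?f \<Gamma> is L q" if len: "length is = k" "k + q \<le> P" for "is" k q
  proof (rule mult_coeff_cong)
    fix M N b c assume MN: "L = M + N" "q = b + c"
    have psi: "psi_derivs deg is (truncation T1) N c = psi_derivs deg is \<Gamma> N c"
      unfolding T1_def
      by (intro psi_derivs_cong truncation_bounded) (use MN L len in \<open>auto simp: J1_def\<close>)
    show "eta_derivs deg is (truncation T1) M b * psi_derivs deg is (truncation T1) N c =
        eta_derivs deg is \<Gamma> M b * psi_derivs deg is \<Gamma> N c"
    proof (cases "set is \<subseteq> J1")
      case True
      have "eta_derivs deg is (truncation T1) M b = eta_derivs deg is \<Gamma> M b"
        unfolding T1_def
        by (intro eta_derivs_cong truncation_bounded) (use MN L len True in \<open>auto simp: J1_def\<close>)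
      with psi show ?thesis by simp
    next
      case False
      have "psi_derivs deg is \<Gamma> N c = 0" by (rule outside[OF False]) (use MN len in auto)
      with psi show ?thesis by simp
    qed
  qed
  have "contraction J2 k (truncation T1) (truncation T1) L (p - k) =
      formal_sum (multi_indices I k) (?f \<Gamma>) L (p - k)" if k: "k \<le> p" for k
  proof -
    have "contraction J2 k (truncation T1) (truncation T1) L (p - k) = (\<Sum>is\<in>multi_indices J2 k. ?f \<Gamma> is L (p - k))"
      unfolding contraction_eq_sum[OF fin(2)] sum_series_apply
      by (rule sum.cong[OF refl], rule agree[of _ k]) (use k L(3) in \<open>auto simp: multi_indices_def\<close>)
    \<comment> \<open>The index sets \<open>J2\<close> and \<open>I\<close> differ, but nonzero
      summands come only from tuples in \<open>J1\<close>, which is contained in both.\<close>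
    also have "\<dots> = (\<Sum>is | is \<in> multi_indices I k \<and> ?f \<Gamma> is L (p - k) \<noteq> 0. ?f \<Gamma> is L (p - k))"
    proof (rule sum.mono_neutral_right[OF finite_multi_indices[OF fin(2)]])
      have "set is \<subseteq> J1" if "?f \<Gamma> is L (p - k) \<noteq> 0" for "is"
        using zero[of "is" "p - k"] that L(3) by (meson diff_le_self le_trans)
      then show "{is \<in> multi_indices I k. ?f \<Gamma> is L (p - k) \<noteq> 0} \<subseteq> multi_indices J2 k"
        using sub(1) unfolding multi_indices_def by blast
      show "\<forall>is\<in>multi_indices J2 k - {is \<in> multi_indices I k. ?f \<Gamma> is L (p - k) \<noteq> 0}. ?f \<Gamma> is L (p - k) = 0"
        using sub(2) unfolding multi_indices_def by blast
    qed
    finally show ?thesis by (simp add: formal_sum_def)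
  qed
  then have "star J2 (truncation T1) (truncation T1) L p = hbar_times_star I deg \<Gamma> \<Gamma> L p"
    unfolding star_def hbar_times_star_def by (intro sum.cong) auto
  then show ?thesis using Gamma_master by simp
qed

text \<open>At \<eta> = 0 every \<eta> of a contributing term must be contracted with a variable of
  \<open>x\<close>, and each contraction uses up one \<hbar>; so only terms with indices in
  \<open>K\<close> and at most \<open>c\<close> inputs matter.\<close>

lemma act_cong:
  assumes J: "finite J" and x: "x \<in> CE K deg"
    and eq: "\<And>M p. p \<le> c \<Longrightarrow> (\<And>j. Eta j \<in># M \<Longrightarrow> j \<in> K) \<Longrightarrow> inputs M \<le> c \<Longrightarrow> F M p = G M p"
  shows "hbar_coeff c (act J F x) = hbar_coeff c (act J G x)"
proof -
  have "eta_zero (hbar_coeff (c - k) (eta_derivs deg is F)) \<odot> psi_derivs deg is x =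
      eta_zero (hbar_coeff (c - k) (eta_derivs deg is G)) \<odot> psi_derivs deg is x"
    if "k \<le> c" "is \<in> multi_indices J k" for k "is"
  proof (cases "set is \<subseteq> K")
    case True
    have "eta_derivs deg is F M (c - k) = eta_derivs deg is G M (c - k)"
      if M: "set_mset M \<inter> range Eta = {}" for M
    proof (rule eta_derivs_cong, rule eq)
      have "inputs M = 0" using M by (auto simp: inputs_def filter_mset_eq_conv)
      then show "inputs (M + image_mset Eta (mset is)) \<le> c"
        using \<open>k \<le> c\<close> \<open>is \<in> multi_indices J k\<close> by (simp add: multi_indices_def)
      show "j \<in> K" if "Eta j \<in># M + image_mset Eta (mset is)" for j
        using that M True by auto
    qed simp
    then have "eta_zero (hbar_coeff (c - k) (eta_derivs deg is F)) = eta_zero (hbar_coeff (c - k) (eta_derivs deg is G))"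
      by (auto simp: eta_zero_def hbar_coeff_def fun_eq_iff)
    then show ?thesis by simp
  next
    case False
    then show ?thesis using psi_derivs_outside[OF CE_power_series[OF x]] by (simp del: zero_fun_apply)
  qed
  then show ?thesis by (simp add: hbar_coeff_act[OF J x])
qed

theorem operator_relations:
  assumes x: "x \<in> CE I deg"
  shows "(\<Sum>a\<le>n. operator a (operator (n - a) x)) = 0"
proof -
  obtain J where J: "finite J" "J \<subseteq> I" "x \<in> CE J deg" using CE_finite_support[OF x] by blast
  \<comment> \<open>The operators with indices \<open>a\<close> and \<open>n - a\<close> are the
    coefficients of \<open>\<hbar>^(a + 1)\<close> and \<open>\<hbar>^(n - a + 1)\<close>.\<close>
  define P where "P = n + 2"
  \<comment> \<open>\<open>T0\<close> holds the terms that can act on \<open>x\<close>, and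
    \<open>J1\<close> all indices that may occur in the result; \<open>T1\<close> then suffices for
    the second application too.\<close>
  define T0 where "T0 = bounded_terms J P P"
  define J1 where "J1 = J \<union> term_indices T0"
  define T1 where "T1 = bounded_terms J1 (2 * P) P"
  define J2 where "J2 = J1 \<union> term_indices T1"
  let ?G = "truncation T1"
  have fin: "finite J1" "finite J2" "finite T1"
    using J(1) by (simp_all add: J1_def J2_def T0_def T1_def finite_bounded_terms finite_term_indices)
  have sub: "J \<subseteq> J1" "J1 \<subseteq> J2" "J1 \<subseteq> I" "J2 \<subseteq> I"
    using J(2) term_indices_subset by (auto simp: J1_def J2_def T0_def T1_def)
  have trunc: "hbar_coeff c (act J2 ?G y) = hbar_coeff c (act J2 \<Gamma> y)" if "y \<in> CE J1 deg" "c \<le> P" for y c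
    by (rule act_cong[OF fin(2) that(1)]) (use that(2) in \<open>auto simp: T1_def intro!: truncation_bounded\<close>)
  have op: "hbar_coeff (Suc a) (act J2 ?G y) = operator a y" if "y \<in> CE J1 deg" "a \<le> n" for y a
    using trunc[OF that(1), of "Suc a"] that operator_eq[OF fin(2) sub(4) CE_mono[OF that(1) sub(2)], of a]
    by (simp add: P_def)
  have low: "hbar_coeff 0 (act J2 ?G y) = 0" for y
  proof -
    have "eta_zero ?G = 0"
    proof (intro ext)
      fix M p show "eta_zero ?G M p = 0 M p"
        using fun_cong[OF fun_cong[OF Gamma_eta_zero, of M], of p] by (auto simp: eta_zero_def truncation_def)
    qed
    then have "eta_zero (?G \<odot> y) = 0" by (simp add: eta_zero_mult)
    moreover have "hbar_coeff 0 (act J2 ?G y) = hbar_coeff 0 (eta_zero (?G \<odot> y))"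
      by (auto simp: hbar_coeff_def act_def star_def eta_zero_def fun_eq_iff)
    ultimately show ?thesis by (simp add: hbar_coeff_linear del: zero_fun_apply)
  qed
  have x1: "x \<in> CE J1 deg" using CE_mono[OF J(3) sub(1)] .
  have closed: "operator a x \<in> CE J1 deg" if "a \<le> n" for a
  proof -
    have "op_coeff (Suc a - k) is \<odot> psi_derivs deg is x \<in> CE J1 deg"
      if k: "k \<le> Suc a" "is \<in> multi_indices J k" for k "is"
    proof (rule CE_mult)
      show "psi_derivs deg is x \<in> CE J1 deg" by (rule CE_psi_derivs[OF x1])
      have oI: "op_coeff (Suc a - k) is \<in> CE I deg" using op_coeff_component by (simp add: CE_component_def)
      show "op_coeff (Suc a - k) is \<in> CE J1 deg"
      proof (rule CE_subset_mono[OF oI])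
        show "power_series J1 deg (op_coeff (Suc a - k) is)"
          unfolding power_series_def
        proof (intro allI impI conjI subsetI)
          fix M b v assume nz: "op_coeff (Suc a - k) is M b \<noteq> 0"
          show "admissible deg M" using nz CE_power_series[OF oI] unfolding power_series_def by blast
          have M: "set_mset M \<inter> range Eta = {}" "eta_derivs deg is \<Gamma> M (Suc a - k) \<noteq> 0"
            using nz by (auto simp: op_coeff_def eta_zero_def hbar_coeff_def split: if_splits)
          from M(2) have "\<Gamma> (M + image_mset Eta (mset is)) (Suc a - k) \<noteq> 0" by (rule eta_derivs_nonzero)
          moreover have "inputs M = 0" using M(1) by (auto simp: inputs_def filter_mset_eq_conv)
          ultimately have "(M + image_mset Eta (mset is), Suc a - k) \<in> T0"
            using k \<open>a \<le> n\<close> M(1) by (auto simp: T0_def bounded_terms_def P_def multi_indices_def)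
          moreover assume "v \<in># M"
          ultimately show "v \<in> Psi ` J1 \<union> Eta ` J1"
            by (cases v) (force simp: J1_def term_indices_def)+
        qed
      qed
    qed
    then have "hbar_coeff (Suc a) (act J \<Gamma> x) \<in> CE J1 deg"
      unfolding hbar_coeff_act_Gamma[OF J(1) x] by (intro CE_sum CE_scale) auto
    then show ?thesis by (simp add: operator_eq[OF J])
  qed
  have "0 = hbar_coeff P (act J2 (star J2 ?G ?G) x)"
  proof -
    \<comment> \<open>The star square of the truncation need not be zero, but it vanishes in all
      coefficients that contribute to its action on \<open>x\<close> up to power
      \<open>P\<close>.\<close>
    have "hbar_coeff P (act J2 (star J2 ?G ?G) x) = hbar_coeff P (act J2 0 x)"
      by (rule act_cong[OF fin(2) J(3)])
         (simp add: star_truncation[OF J(1,2), of _ P, folded T0_def, folded J1_def, folded T1_def, folded J2_def])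
    then show ?thesis by (simp add: act_linear hbar_coeff_linear del: zero_fun_apply)
  qed
  also have "\<dots> = hbar_coeff P (act J2 ?G (act J2 ?G x))"
  proof -
    have "?G \<in> polys J2 J2" by (rule truncation_polys[OF fin(3)]) (simp add: J2_def)
    then show ?thesis
      using act_star[OF fin(2) _ _ power_series_admissible[OF CE_power_series[OF x]]] by simp
  qed
  also have "\<dots> = (\<Sum>b\<le>P. hbar_coeff (P - b) (act J2 ?G (hbar_coeff b (act J2 ?G x))))"
    by (rule hbar_coeff_act_sum)
  \<comment> \<open>By \<open>low\<close> the summand \<open>b = 0\<close> drops out here; the
    summand in which the outer operator has power 0 drops out in the next step.\<close>
  also have "\<dots> = (\<Sum>b\<le>Suc n. hbar_coeff (Suc n - b) (act J2 ?G (hbar_coeff (Suc b) (act J2 ?G x))))"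
  proof -
    have "act J2 ?G 0 = 0" by (simp add: act_def star_zero eta_zero_linear del: zero_fun_apply)
    moreover have "P = Suc (Suc n)" by (simp add: P_def)
    ultimately show ?thesis
      by (simp only: sum.atMost_Suc_shift[of _ "Suc n"] low hbar_coeff_linear add_0_left diff_Suc_Suc)
  qed
  also have "\<dots> = (\<Sum>b\<le>n. operator (n - b) (operator b x))"
  proof -
    have "hbar_coeff (Suc n - b) (act J2 ?G (hbar_coeff (Suc b) (act J2 ?G x))) = operator (n - b) (operator b x)"
      if "b \<le> n" for b
      using that by (simp add: op[OF x1] op[OF closed] Suc_diff_le)
    then show ?thesis by (simp add: low del: plus_fun_apply zero_fun_apply)
  qed
  also have "\<dots> = (\<Sum>a\<le>n. operator a (operator (n - a) x))"
    by (rule sum.reindex_bij_witness[of _ "\<lambda>a. n - a" "\<lambda>a. n - a"]) auto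
  finally show ?thesis by simp
qed

end

section \<open>Good homotopy involutive Lie bialgebras\<close>

lemma (in Lie_diamond_B_infty_algebra) good_bv_series:
  assumes "good \<Gamma>"
  shows "bv_series deg I \<Gamma>"
proof
  show "finite {M. set_mset M \<subseteq> range Psi \<and> \<Gamma> (M + image_mset Eta N) a \<noteq> 0}" for N a
  proof -
    let ?out = "{m. \<exists>M. inputs M = size N \<and> outputs M = m \<and> \<Gamma> M a \<noteq> 0}"
    have "finite ?out" using assms by (simp add: good_def)
    \<comment> \<open>Goodness leaves finitely many numbers of outputs, and for each of them
      \<open>operations\<close> leaves finitely many monomials.\<close>
    moreover have "{M. set_mset M \<subseteq> range Psi \<and> \<Gamma> (M + image_mset Eta N) a \<noteq> 0} \<subseteq>
       (\<Union>m\<in>?out. {M. set_mset M \<subseteq> range Psi \<and> size M = m \<and> \<Gamma> (M + image_mset Eta N) a \<noteq> 0})"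
    proof
      fix M assume M: "M \<in> {M. set_mset M \<subseteq> range Psi \<and> \<Gamma> (M + image_mset Eta N) a \<noteq> 0}"
      then have sub: "set_mset M \<subseteq> range Psi" by simp
      have "inputs M = 0" "outputs M = size M"
        using sub by (auto simp: inputs_def outputs_def filter_mset_eq_conv intro!: arg_cong[of _ _ size])
      then have "inputs (M + image_mset Eta N) = size N \<and> outputs (M + image_mset Eta N) = size M" by simp
      with M show "M \<in> (\<Union>m\<in>?out. {M. set_mset M \<subseteq> range Psi \<and> size M = m \<and> \<Gamma> (M + image_mset Eta N) a \<noteq> 0})"
        by blast
    qed
    ultimately show ?thesis using operations by (elim finite_subset) (intro finite_UN_I; simp)
  qed
  interpret graded_variables deg .
  \<comment> \<open>Each term of the series of the differential contains an \<eta>, so the absence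
    of operations without inputs passes from the difference to \<Gamma> itself.\<close>
  have "eta_zero differential_series = 0"
  proof (intro ext)
    fix M a
    have "differential_series M a = 0" if M: "set_mset M \<inter> range Eta = {}"
    proof -
      have "(series_var (Psi i) \<odot> series_var (Eta j)) M a = (0::'k)" for i j
        using M by (auto simp: mult_var_eq)
      then show ?thesis
        unfolding differential_series_def formal_sum_def by (intro sum.neutral) (auto simp: series_scale_def)
    qed
    then show "eta_zero differential_series M a = 0 M a" by (simp add: eta_zero_def)
  qed
  moreover have "eta_zero (\<Gamma> - differential_series) = eta_zero \<Gamma> - eta_zero differential_series"
    by (auto simp: eta_zero_def fun_eq_iff)
  ultimately show "eta_zero \<Gamma> = 0" using no_inputless by simp
qed (use series degree master_equation in auto)

context bv_series
begin

theorem BV_com_infty: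
  "BV_com_infty_algebra series_scale (CE I deg) (CE_component I deg)
     (series_mult deg) series_one (\<lambda>F. - CE_Delta0 I deg \<Gamma> F) (CE_Delta I deg \<Gamma>)"
proof -
  have op0: "CE_Delta0 I deg \<Gamma> x = operator 0 x" for x by (simp add: operator_def)
  have op: "CE_Delta I deg \<Gamma> a = operator a" if "a \<ge> 1" for a
    using that by (intro ext) (simp add: operator_def)
  have closed: "operator 0 x \<in> CE I deg" if "x \<in> CE I deg" for x
  proof -
    from CE_finite_support[OF that] obtain J where "finite J" "J \<subseteq> I" "x \<in> CE J deg" by blast
    then show ?thesis
      using that op_coeff_component
      by (simp add: operator_eq hbar_coeff_act_Gamma CE_component_def)
         (intro CE_add CE_sum CE_scale CE_mult CE_psi_derivs; simp)
  qed
  have lin: "operator 0 (x + y) = operator 0 x + operator 0 y"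
    "operator 0 (series_scale c x) = series_scale c (operator 0 x)"
    if "x \<in> CE I deg" "y \<in> CE I deg" for x y c
    using operator_linear_of_degree[of 0] that unfolding CE.linear_of_degree_def by blast+
  have neg: "operator 0 (- x) = - operator 0 x" if "x \<in> CE I deg" for x
    using lin(2)[OF that that, of "- 1"] by (simp add: series_scale_def fun_Compl_def)
  show ?thesis
  proof unfold_locales
    show "CE.linear_of_degree 1 (\<lambda>F. - CE_Delta0 I deg \<Gamma> F)"
      using operator_linear_of_degree[of 0] CE.component_closed(3)
      unfolding CE.linear_of_degree_def op0 by (simp add: series_scale_linear del: plus_fun_apply)
    show "- CE_Delta0 I deg \<Gamma> (- CE_Delta0 I deg \<Gamma> x) = 0" if "x \<in> CE I deg" for x
      using operator_relations[OF that, of 0] neg[OF closed[OF that]] by (simp add: op0)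
    show "- CE_Delta0 I deg \<Gamma> (x \<odot> y) = - CE_Delta0 I deg \<Gamma> x \<odot> y + koszul m 1 (x \<odot> - CE_Delta0 I deg \<Gamma> y)"
      if "x \<in> CE_component I deg m" "y \<in> CE I deg" for x m y
      using operator_0_leibniz[OF that] by (simp add: op0 koszul_swap[of m 1] koszul_linear)
    show "CE.linear_of_degree (1 - 2 * int a) (CE_Delta I deg \<Gamma> a)" if "a \<ge> 1" for a
      using operator_linear_of_degree by (simp add: op[OF that])
    show "CE.order_le (a + 1) (CE_Delta I deg \<Gamma> a)" if "a \<ge> 1" for a
      unfolding op[OF that] by (rule operator_order)
    \<comment> \<open>The differential is minus \<open>CE_Delta0\<close>, and the relations use
      minus the differential; the two signs cancel, which leaves \<open>operator 0\<close>.\<close>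
    show "let \<Delta>' = (\<lambda>a. if a = 0 then (\<lambda>y. - (- CE_Delta0 I deg \<Gamma> y)) else CE_Delta I deg \<Gamma> a)
      in (\<Sum>a\<le>n. \<Delta>' a (\<Delta>' (n - a) x)) = 0" if "x \<in> CE I deg" for x n
    proof -
      have "(if a = 0 then (\<lambda>y. - (- CE_Delta0 I deg \<Gamma> y)) else CE_Delta I deg \<Gamma> a) = operator a" for a
        by (intro ext) (simp add: operator_def)
      then show ?thesis using operator_relations[OF that] by (simp only: Let_def)
    qed
  qed
qed

end

theorem proposition5p4p1:
  fixes scale :: "'k::field_char_0 \<Rightarrow> 'g::ab_group_add \<Rightarrow> 'g"
    and A :: "'g set" and V :: "int \<Rightarrow> 'g set" and d :: "'g \<Rightarrow> 'g"
    and I :: "'i::linorder set" and e :: "'i \<Rightarrow> 'g" and deg :: "'i \<Rightarrow> int"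
    and \<Gamma> :: "('i, 'k) series"
  assumes "Lie_diamond_B_infty_algebra scale A V d I e deg \<Gamma>"
    and "good \<Gamma>"
  shows "BV_com_infty_algebra series_scale (CE I deg) (CE_component I deg)
           (series_mult deg) series_one (\<lambda>F. - CE_Delta0 I deg \<Gamma> F) (CE_Delta I deg \<Gamma>)"
  using Lie_diamond_B_infty_algebra.good_bv_series[OF assms] by (rule bv_series.BV_com_infty)

end
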